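(* The linear plethystic bialgebra with noncommuting variables $\mathcal P^{\diamondsuit}_{\mathrm{lin}}$ is isomorphic to the homotopy cardinality of the incidence bialgebra of the simplicial groupoid $\mathcal B^{\mathsf S^{\mathrm r}}\mathcal T_{\mathsf M^{\mathrm r}}(\mathsf{Ass})$.
   Context: Monads and operads. $\mathbf{Grpd}$ is the category of groupoids. $\mathsf{M}^{\mathrm r}$ is the monad on $\mathbf{Grpd}$ sending $A$ to $\bigsqcup_{n\ge 1}A^n$ (nonempty tuples, morphisms componentwise), unit $a\mapsto (a)$, multiplication $\mu$ concatenation. $\mathsf{S}^{\mathrm r}$ sends $A$ to $\bigsqcup_{n\ge1}A^n/\!/\mathfrak S_n$ (same objects, with additional isomorphisms $(a_1,\dots,a_n)\to(a_{\sigma(1)},\dots,a_{\sigma(n)})$), same unit and multiplication; the inclusion $\mathsf M^{\mathrm r}\Rightarrow\mathsf S^{\mathrm r}$ is a monad map. An $\mathsf M^{\mathrm r}$-operad $Q$ consists of groupoids $Q_0$ (colours), $Q_1$ (operations), functors $s\colon Q_1\to\mathsf M^{\mathrm r}Q_0$, $t\colon Q_1\to Q_0$, composition $m\colon\mathsf M^{\mathrm r}Q_1\times_{\mathsf M^{\mathrm r}Q_0}Q_1\to Q_1$ (the $Q_1$ factor the root) and units $e$, with the usual laws. $\mathsf{Ass}$ is the terminal $\mathsf M^{\mathrm r}$-operad on one colour ($Q_0=1$, $Q_1=\mathsf M^{\mathrm r}1$ discrete, composition $\mu$). $\mathcal T$-construction. (i) For a category $C$ internal to $\mathbf{Grpd}$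 with discrete $C_0$, $\mathcal T_{\mathsf M^{\mathrm r}}(C)$ is the $\mathsf M^{\mathrm r}$-operad with colours $C_0$ whose operations are the pullback of $\mathsf M^{\mathrm r}(\text{target})$ along $C_0\times\mathsf M^{\mathrm r}1\to\mathsf M^{\mathrm r}C_0$, $(c,(\ast,\dots,\ast))\mapsto(c,\dots,c)$: nonempty tuples $(f_1,\dots,f_n)$ of arrows of $C$ with common target $c$ (inputs the sources, output $c$) with the morphisms of $\mathsf M^{\mathrm r}C_1$; composition $(f_1,\dots,f_k)\circ((g^1_j)_j,\dots,(g^k_j)_j)=(f_1g^1_1,\dots,f_1g^1_{n_1},\dots,f_kg^k_{n_k})$; units identities. (ii) For an $\mathsf M^{\mathrm r}$-operad $Q$ with discrete $Q_0$, $\mathcal T^{\mathsf M^{\mathrm r}}(Q)$ is the category with objects $Q_0$, arrows $c\to d$ the operations with all inputs $c$ and output $d$, composition $y\circ x=m((x,\dots,x);y)$, identities $e$. (iii) $\mathcal T_{\mathsf M^{\mathrm r}}(Q):=\mathcal T_{\mathsf M^{\mathrm r}}(\mathcal T^{\mathsf M^{\mathrm r}}(Q))$. Bar construction. For an $\mathsf M^{\mathrm r}$-operad $Q$, $Q_n:=\mathsf M^{\mathrm r}Q_{n-1}\times_{\mathsf M^{\mathrm r}Q_0}Q_1$ ($n\ge2$). $\mathcal B^{\mathsf S^{\mathrm r}}Q$ has $n$-simplices $\mathsf S^{\mathrm r}Q_n$; $d_0$ discards the top (leafward) level keeping outputs, $d_n$ discards the root level and flattens using $\mathsf M^{\mathrm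 r}\Rightarrow\mathsf S^{\mathrm r}$ and the multiplication of $\mathsf S^{\mathrm r}$, inner faces compose adjacent levels via $m$, degeneracies insert units. Incidence bialgebra. $|G|=\sum_{[x]}1/|\mathrm{Aut}(x)|$. For $X=\mathcal B^{\mathsf S^{\mathrm r}}Q$, $\mathbb Q_{\pi_0X_1}$ has basis $\delta_a$; $\Delta(\delta_f)=\sum_{a,b}\frac{|\Phi_{f;a,b}|}{|\mathrm{Aut}(a)||\mathrm{Aut}(b)|}\delta_a\otimes\delta_b$ with $\Phi_{f;a,b}$ the homotopy fibre over $(a,b)$ of $(d_2,d_0)$ restricted to the homotopy fibre of $d_1$ over $f$; $\epsilon(\delta_f)=$ cardinality of the homotopy fibre of $s_0$ over $f$; product by juxtaposition (unit adjoined). The bialgebra. $W$ is the set of nonempty finite words $\omega=\omega_1\cdots\omega_n$ in positive integers, $\mathbf x_\omega=x_{\omega_1}\cdots x_{\omega_n}$. Power series in noncommuting variables $x_1,x_2,\dots$ without constant term with rational coefficients are written $F=\sum_{\omega\in W}f_\omega\mathbf x_\omega$; plethystic substitution $(G\circledast F)(x_1,x_2,\dots)=G(F_1,F_2,\dots)$, $F_k(x_1,x_2,\dots)=F(x_k,x_{2k},\dots)$. $\mathcal P^{\diamondsuit}_{\mathrm{lin}}$ is the polynomial algebra $\mathbb Q[a_\omega:\omega\in W]$, $a_\omega(F)=f_\omega$, with $\Delta(a_\omega)(F,G)=a_\omega(G\circledast F)$ and $\epsilon(a_\omega)=a_\omega(x_1)$. *)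

theory Defs
  imports Complex_Main "HOL-Library.Poly_Mapping" "HOL-Library.Product_Plus"
begin

section \<open>Groupoids and functors\<close>

text \<open>
  Groupoids, functors, operads and internal categories are carried by records of raw data, since
  the constructions below use the data only.  \<open>Cmp G g f\<close> is \<open>g\<close> after \<open>f\<close>, and is
  meaningful when \<open>Dom G g = Cod G f\<close>.
\<close>

record ('o, 'a) grpd =
  Obj :: "'o set"
  Arr :: "'a set"
  Dom :: "'a \<Rightarrow> 'o"
  Cod :: "'a \<Rightarrow> 'o"
  Idn :: "'o \<Rightarrow> 'a"
  Cmp :: "'a \<Rightarrow> 'a \<Rightarrow> 'a"

record ('o, 'a, 'p, 'b) ftor =
  ob :: "'o \<Rightarrow> 'p"
  ar :: "'a \<Rightarrow> 'b"

definition id_ftor :: "('o, 'a, 'o, 'a) ftor" where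
  "id_ftor = \<lparr>ob = id, ar = id\<rparr>"

definition comp_ftor :: "('p, 'b, 'q, 'c) ftor \<Rightarrow> ('o, 'a, 'p, 'b) ftor \<Rightarrow> ('o, 'a, 'q, 'c) ftor"
    (infixl \<open>\<circ>\<^sub>F\<close> 55) where
  "G \<circ>\<^sub>F F = \<lparr>ob = ob G \<circ> ob F, ar = ar G \<circ> ar F\<rparr>"

definition pair_ftor :: "('o, 'a, 'p, 'b) ftor \<Rightarrow> ('o, 'a, 'q, 'c) ftor \<Rightarrow>
    ('o, 'a, 'p \<times> 'q, 'b \<times> 'c) ftor" where
  "pair_ftor F G = \<lparr>ob = (\<lambda>x. (ob F x, ob G x)), ar = (\<lambda>\<alpha>. (ar F \<alpha>, ar G \<alpha>))\<rparr>"

definition one_grpd :: "(unit, unit) grpd" where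
  "one_grpd = \<lparr>Obj = UNIV, Arr = UNIV, Dom = id, Cod = id, Idn = id, Cmp = (\<lambda>_ _. ())\<rparr>"

definition prod_grpd :: "('o, 'a) grpd \<Rightarrow> ('p, 'b) grpd \<Rightarrow> ('o \<times> 'p, 'a \<times> 'b) grpd" where
  "prod_grpd A B = \<lparr>Obj = Obj A \<times> Obj B, Arr = Arr A \<times> Arr B,
     Dom = map_prod (Dom A) (Dom B), Cod = map_prod (Cod A) (Cod B),
     Idn = map_prod (Idn A) (Idn B),
     Cmp = (\<lambda>(g, g') (f, f'). (Cmp A g f, Cmp B g' f'))\<rparr>"

definition Aut :: "('o, 'a) grpd \<Rightarrow> 'o \<Rightarrow> 'a set" where
  "Aut G x = {\<alpha> \<in> Arr G. Dom G \<alpha> = x \<and> Cod G \<alpha> = x}"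

definition iso_class :: "('o, 'a) grpd \<Rightarrow> 'o \<Rightarrow> 'o set" where
  "iso_class G x = {y \<in> Obj G. \<exists>\<alpha> \<in> Arr G. Dom G \<alpha> = x \<and> Cod G \<alpha> = y}"

definition pi0 :: "('o, 'a) grpd \<Rightarrow> 'o set set" where
  "pi0 G = iso_class G ` Obj G"

definition rep :: "'o set \<Rightarrow> 'o" where
  "rep c = (SOME x. x \<in> c)"

text \<open>The cardinality of a groupoid is only meaningful under \<open>hfinite\<close>.\<close>

definition hfinite :: "('o, 'a) grpd \<Rightarrow> bool" where
  "hfinite G \<longleftrightarrow> finite (pi0 G) \<and> (\<forall>x \<in> Obj G. finite (Aut G x))"

definition hcard :: "('o, 'a) grpd \<Rightarrow> rat" where
  "hcard G = (\<Sum>c \<in> pi0 G. 1 / of_nat (card (Aut G (rep c))))"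

text \<open>
  The homotopy fibre of \<open>F : X \<rightarrow> B\<close> over \<open>b\<close>: objects are pairs \<open>(x, \<beta> : F x \<rightarrow> b)\<close>, and a
  morphism \<open>(x, \<beta>) \<rightarrow> (x', \<beta>')\<close> is an \<open>\<alpha> : x \<rightarrow> x'\<close> with \<open>\<beta>' \<circ> F \<alpha> = \<beta>\<close>.  As \<open>\<beta>\<close> is determined by
  \<open>\<alpha>\<close> and \<open>\<beta>'\<close>, the morphism is encoded by \<open>(\<alpha>, \<beta>')\<close>.
\<close>

definition hfib :: "('o, 'a) grpd \<Rightarrow> ('p, 'b) grpd \<Rightarrow> ('o, 'a, 'p, 'b) ftor \<Rightarrow> 'p \<Rightarrow>
    ('o \<times> 'b, 'a \<times> 'b) grpd" where
  "hfib X B F b = \<lparr>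
     Obj = {(x, \<beta>). x \<in> Obj X \<and> \<beta> \<in> Arr B \<and> Dom B \<beta> = ob F x \<and> Cod B \<beta> = b},
     Arr = {(\<alpha>, \<beta>'). \<alpha> \<in> Arr X \<and> \<beta>' \<in> Arr B \<and> Dom B \<beta>' = ob F (Cod X \<alpha>) \<and> Cod B \<beta>' = b},
     Dom = (\<lambda>(\<alpha>, \<beta>'). (Dom X \<alpha>, Cmp B \<beta>' (ar F \<alpha>))),
     Cod = (\<lambda>(\<alpha>, \<beta>'). (Cod X \<alpha>, \<beta>')),
     Idn = (\<lambda>(x, \<beta>). (Idn X x, \<beta>)),
     Cmp = (\<lambda>(\<alpha>\<^sub>2, \<beta>\<^sub>2) (\<alpha>\<^sub>1, \<beta>\<^sub>1). (Cmp X \<alpha>\<^sub>2 \<alpha>\<^sub>1, \<beta>\<^sub>2))\<rparr>"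

definition hfib_proj :: "('o \<times> 'b, 'a \<times> 'b, 'o, 'a) ftor" where
  "hfib_proj = \<lparr>ob = fst, ar = fst\<rparr>"


section \<open>The monads\<close>

definition Mr :: "('o, 'a) grpd \<Rightarrow> ('o list, 'a list) grpd" where
  "Mr A = \<lparr>
     Obj = {xs. xs \<noteq> [] \<and> set xs \<subseteq> Obj A},
     Arr = {fs. fs \<noteq> [] \<and> set fs \<subseteq> Arr A},
     Dom = map (Dom A), Cod = map (Cod A), Idn = map (Idn A), Cmp = map2 (Cmp A)\<rparr>"

text \<open>
  A morphism \<open>(a\<^sub>0, \<dots>, a\<^sub>n\<^sub>-\<^sub>1) \<rightarrow> (b\<^sub>0, \<dots>, b\<^sub>n\<^sub>-\<^sub>1)\<close> of \<open>Sr A\<close> consists of a permutation \<open>\<sigma>\<close> of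
  \<open>{0, \<dots>, n - 1}\<close> and morphisms \<open>f\<^sub>i : a (\<sigma> i) \<rightarrow> b i\<close> of \<open>A\<close>.  It is encoded as the list of the
  pairs \<open>(\<sigma> i, f\<^sub>i)\<close>.
\<close>

definition Sr :: "('o, 'a) grpd \<Rightarrow> ('o list, (nat \<times> 'a) list) grpd" where
  "Sr A = \<lparr>
     Obj = {xs. xs \<noteq> [] \<and> set xs \<subseteq> Obj A},
     Arr = {ps. ps \<noteq> [] \<and> snd ` set ps \<subseteq> Arr A \<and>
                distinct (map fst ps) \<and> fst ` set ps = {..<length ps}},
     Dom = (\<lambda>ps. map (\<lambda>k. Dom A (the (map_of ps k))) [0..<length ps]),
     Cod = map (\<lambda>(k, f). Cod A f),
     Idn = (\<lambda>xs. enumerate 0 (map (Idn A) xs)),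
     Cmp = (\<lambda>qs ps. map (\<lambda>(k, g). (fst (ps ! k), Cmp A g (snd (ps ! k)))) qs)\<rparr>"

definition Sr_map :: "('o, 'a, 'p, 'b) ftor \<Rightarrow>
    ('o list, (nat \<times> 'a) list, 'p list, (nat \<times> 'b) list) ftor" where
  "Sr_map F = \<lparr>ob = map (ob F), ar = map (map_prod id (ar F))\<rparr>"

text \<open>
  Multiplication \<open>Sr (Sr A) \<rightarrow> Sr A\<close>.  On a morphism whose \<open>i\<close>-th entry is \<open>(k, ps)\<close>, the list \<open>ps\<close>
  is a morphism out of the \<open>k\<close>-th block of the source, which has \<open>length ps\<close> entries; so the entry
  \<open>(j, f)\<close> of \<open>ps\<close> starts at position \<open>j\<close> plus the total length of the source blocks before the
  \<open>k\<close>-th.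
\<close>

definition block_start :: "(nat \<times> 'x list) list \<Rightarrow> nat \<Rightarrow> nat" where
  "block_start pss k = (\<Sum>l<k. length (the (map_of pss l)))"

definition Sr_mult :: "('o list list, (nat \<times> (nat \<times> 'a) list) list, 'o list, (nat \<times> 'a) list) ftor"
  where
  "Sr_mult = \<lparr>ob = concat,
     ar = (\<lambda>pss. concat (map (\<lambda>(k, ps). map (\<lambda>(j, f). (block_start pss k + j, f)) ps) pss))\<rparr>"

definition Mr_to_Sr :: "('o list, 'a list, 'o list, (nat \<times> 'a) list) ftor" where
  "Mr_to_Sr = \<lparr>ob = id, ar = enumerate 0\<rparr>"


section \<open>Operads and the T-construction\<close>

text \<open>In \<open>cmps\<close>, the second component of the argument is the root operation.\<close>

record ('c, 'd, 'o, 'a) Mr_operad =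
  Col :: "('c, 'd) grpd"
  Opn :: "('o, 'a) grpd"
  inp :: "('o, 'a, 'c list, 'd list) ftor"
  out :: "('o, 'a, 'c, 'd) ftor"
  cmps :: "('o list \<times> 'o, 'a list \<times> 'a, 'o, 'a) ftor"
  unt :: "('c, 'd, 'o, 'a) ftor"

text \<open>Categories internal to groupoids; \<open>icmp\<close> sends \<open>(y, x)\<close> to \<open>y \<circ> x\<close>.\<close>

record ('c, 'd, 'o, 'a) icat =
  iOb :: "('c, 'd) grpd"
  iAr :: "('o, 'a) grpd"
  isrc :: "('o, 'a, 'c, 'd) ftor"
  itgt :: "('o, 'a, 'c, 'd) ftor"
  icmp :: "('o \<times> 'o, 'a \<times> 'a, 'o, 'a) ftor"
  iid :: "('c, 'd, 'o, 'a) ftor"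

definition Ass :: "(unit, unit, unit list, unit list) Mr_operad" where
  "Ass = \<lparr>Col = one_grpd, Opn = Mr one_grpd, inp = id_ftor,
     out = \<lparr>ob = (\<lambda>_. ()), ar = (\<lambda>_. ())\<rparr>,
     cmps = \<lparr>ob = (\<lambda>(xs, x). concat xs), ar = (\<lambda>(xs, x). concat xs)\<rparr>,
     unt = \<lparr>ob = (\<lambda>c. [c]), ar = (\<lambda>c. [c])\<rparr>\<rparr>"

text \<open>
  The operad of a category with discrete objects.  An element of the pullback of \<open>Mr\<close> of the target
  along \<open>(c, (*, \<dots>, *)) \<mapsto> (c, \<dots>, c)\<close> is a nonempty tuple with a common target, the common
  target being determined by the tuple.
\<close>

definition T_cat :: "('c, 'd, 'o, 'a) icat \<Rightarrow> ('c, 'd, 'o list, 'a list) Mr_operad" where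
  "T_cat C = \<lparr>
     Col = iOb C,
     Opn = (Mr (iAr C))\<lparr>
       Obj := {fs \<in> Obj (Mr (iAr C)). \<exists>c. \<forall>f \<in> set fs. ob (itgt C) f = c},
       Arr := {\<alpha>s \<in> Arr (Mr (iAr C)). \<exists>\<gamma>. \<forall>\<alpha> \<in> set \<alpha>s. ar (itgt C) \<alpha> = \<gamma>}\<rparr>,
     inp = \<lparr>ob = map (ob (isrc C)), ar = map (ar (isrc C))\<rparr>,
     out = \<lparr>ob = (\<lambda>fs. ob (itgt C) (hd fs)), ar = (\<lambda>\<alpha>s. ar (itgt C) (hd \<alpha>s))\<rparr>,
     cmps = \<lparr>
       ob = (\<lambda>(gss, fs). concat (map2 (\<lambda>f gs. map (\<lambda>g. ob (icmp C) (f, g)) gs) fs gss)),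
       ar = (\<lambda>(\<beta>ss, \<alpha>s). concat (map2 (\<lambda>\<alpha> \<beta>s. map (\<lambda>\<beta>. ar (icmp C) (\<alpha>, \<beta>)) \<beta>s) \<alpha>s \<beta>ss))\<rparr>,
     unt = \<lparr>ob = (\<lambda>c. [ob (iid C) c]), ar = (\<lambda>\<gamma>. [ar (iid C) \<gamma>])\<rparr>\<rparr>"

text \<open>The category of an operad with discrete colours.\<close>

definition T_operad :: "('c, 'd, 'o, 'a) Mr_operad \<Rightarrow> ('c, 'd, 'o, 'a) icat" where
  "T_operad Q = \<lparr>
     iOb = Col Q,
     iAr = (Opn Q)\<lparr>
       Obj := {q \<in> Obj (Opn Q). \<exists>c. \<forall>x \<in> set (ob (inp Q) q). x = c},
       Arr := {\<alpha> \<in> Arr (Opn Q). \<exists>\<gamma>. \<forall>\<delta> \<in> set (ar (inp Q) \<alpha>). \<delta> = \<gamma>}\<rparr>,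
     isrc = \<lparr>ob = (\<lambda>q. hd (ob (inp Q) q)), ar = (\<lambda>\<alpha>. hd (ar (inp Q) \<alpha>))\<rparr>,
     itgt = out Q,
     icmp = \<lparr>
       ob = (\<lambda>(y, x). ob (cmps Q) (replicate (length (ob (inp Q) y)) x, y)),
       ar = (\<lambda>(\<psi>, \<phi>). ar (cmps Q) (replicate (length (ar (inp Q) \<psi>)) \<phi>, \<psi>))\<rparr>,
     iid = unt Q\<rparr>"

definition T_Mr :: "('c, 'd, 'o, 'a) Mr_operad \<Rightarrow> ('c, 'd, 'o list, 'a list) Mr_operad" where
  "T_Mr Q = T_cat (T_operad Q)"


section \<open>The bar construction\<close>

text \<open>
  The groupoids \<open>Q\<^sub>n\<close> are realised inside a single type of trees: \<open>Q\<^sub>0\<close> consists of the leaves,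
  labelled by colours, and \<open>Q\<^sub>n\<^sub>+\<^sub>1 = Mr Q\<^sub>n \<times>\<^bsub>Mr Q\<^sub>0\<^esub> Q\<^sub>1\<close> of the nodes labelled by a root operation
  whose inputs are the output colours of its children.  For \<open>n = 0\<close> this is the canonical identification
  \<open>Q\<^sub>1 = Mr Q\<^sub>0 \<times>\<^bsub>Mr Q\<^sub>0\<^esub> Q\<^sub>1\<close>.  Objects and morphisms of \<open>Q\<^sub>n\<close> are trees of objects and of morphisms.
\<close>

datatype ('c, 'o) otree = Leaf 'c | Node (kids: "('c, 'o) otree list") (root: 'o)

fun tree_out :: "('o \<Rightarrow> 'c) \<Rightarrow> ('c, 'o) otree \<Rightarrow> 'c" where
  "tree_out t (Leaf c) = c"
| "tree_out t (Node xs q) = t q"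

primrec bar_trees ::
    "'c set \<Rightarrow> 'o set \<Rightarrow> ('o \<Rightarrow> 'c list) \<Rightarrow> ('o \<Rightarrow> 'c) \<Rightarrow> nat \<Rightarrow> ('c, 'o) otree set" where
  "bar_trees C P s t 0 = Leaf ` C"
| "bar_trees C P s t (Suc n) =
     {Node xs q | xs q. xs \<noteq> [] \<and> set xs \<subseteq> bar_trees C P s t n \<and> q \<in> P \<and> map (tree_out t) xs = s q}"

function tree_map2 :: "('c \<Rightarrow> 'c \<Rightarrow> 'c) \<Rightarrow> ('o \<Rightarrow> 'o \<Rightarrow> 'o) \<Rightarrow>
    ('c, 'o) otree \<Rightarrow> ('c, 'o) otree \<Rightarrow> ('c, 'o) otree" where
  "tree_map2 f g (Leaf a) (Leaf b) = Leaf (f a b)"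
| "tree_map2 f g (Node xs q) (Node ys r) = Node (map2 (tree_map2 f g) xs ys) (g q r)"
| "tree_map2 f g (Leaf a) (Node ys r) = Leaf a"
| "tree_map2 f g (Node xs q) (Leaf b) = Node xs q"
  by pat_completeness auto
termination
  by (relation "measure (\<lambda>(f, g, x, y). size x)")
     (auto dest!: set_zip_leftD simp: less_Suc_eq_le intro: size_list_estimation')

definition bar_level :: "('c, 'd, 'o, 'a) Mr_operad \<Rightarrow> nat \<Rightarrow> (('c, 'o) otree, ('d, 'a) otree) grpd"
  where
  "bar_level Q n = \<lparr>
     Obj = bar_trees (Obj (Col Q)) (Obj (Opn Q)) (ob (inp Q)) (ob (out Q)) n,
     Arr = bar_trees (Arr (Col Q)) (Arr (Opn Q)) (ar (inp Q)) (ar (out Q)) n,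
     Dom = map_otree (Dom (Col Q)) (Dom (Opn Q)),
     Cod = map_otree (Cod (Col Q)) (Cod (Opn Q)),
     Idn = map_otree (Idn (Col Q)) (Idn (Opn Q)),
     Cmp = tree_map2 (Cmp (Col Q)) (Cmp (Opn Q))\<rparr>"

text \<open>
  The faces \<open>d\<^sub>i\<close>, \<open>i < n\<close>, and the degeneracies \<open>s\<^sub>i\<close>, \<open>i \<le> n\<close>, on trees of height \<open>n\<close>.  Levels are
  counted from the leaves: \<open>d\<^sub>0\<close> replaces the operations next to the leaves by their output colours,
  \<open>d\<^sub>i\<close> for \<open>0 < i < n\<close> composes the operations of levels \<open>i\<close> and \<open>i + 1\<close>, \<open>s\<^sub>0\<close> inserts units at
  the leaves and \<open>s\<^sub>n\<close> a unit at the root.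
\<close>

primrec tree_face :: "('o \<Rightarrow> 'c) \<Rightarrow> ('o list \<times> 'o \<Rightarrow> 'o) \<Rightarrow> nat \<Rightarrow> nat \<Rightarrow>
    ('c, 'o) otree \<Rightarrow> ('c, 'o) otree" where
  "tree_face t m 0 i x = x"
| "tree_face t m (Suc n) i x =
     (if i < n then Node (map (tree_face t m n i) (kids x)) (root x)
      else if n = 0 then Leaf (t (root x))
      else Node (concat (map kids (kids x))) (m (map root (kids x), root x)))"

primrec tree_degen :: "('o \<Rightarrow> 'c) \<Rightarrow> ('c \<Rightarrow> 'o) \<Rightarrow> nat \<Rightarrow> nat \<Rightarrow>
    ('c, 'o) otree \<Rightarrow> ('c, 'o) otree" where
  "tree_degen t e 0 i x = Node [x] (e (tree_out t x))"
| "tree_degen t e (Suc n) i x =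
     (if i \<le> n then Node (map (tree_degen t e n i) (kids x)) (root x)
      else Node [x] (e (tree_out t x)))"

definition inner_face :: "('c, 'd, 'o, 'a) Mr_operad \<Rightarrow> nat \<Rightarrow> nat \<Rightarrow>
    (('c, 'o) otree, ('d, 'a) otree, ('c, 'o) otree, ('d, 'a) otree) ftor" where
  "inner_face Q n i = \<lparr>ob = tree_face (ob (out Q)) (ob (cmps Q)) n i,
                       ar = tree_face (ar (out Q)) (ar (cmps Q)) n i\<rparr>"

definition degeneracy :: "('c, 'd, 'o, 'a) Mr_operad \<Rightarrow> nat \<Rightarrow> nat \<Rightarrow>
    (('c, 'o) otree, ('d, 'a) otree, ('c, 'o) otree, ('d, 'a) otree) ftor" where
  "degeneracy Q n i = \<lparr>ob = tree_degen (ob (out Q)) (ob (unt Q)) n i,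
                       ar = tree_degen (ar (out Q)) (ar (unt Q)) n i\<rparr>"

definition discard_root ::
    "(('c, 'o) otree, ('d, 'a) otree, ('c, 'o) otree list, ('d, 'a) otree list) ftor" where
  "discard_root = \<lparr>ob = kids, ar = kids\<rparr>"

text \<open>\<open>Fc X n i\<close> is \<open>d\<^sub>i : X\<^sub>n \<rightarrow> X\<^sub>n\<^sub>-\<^sub>1\<close> and \<open>Dg X n i\<close> is \<open>s\<^sub>i : X\<^sub>n \<rightarrow> X\<^sub>n\<^sub>+\<^sub>1\<close>.\<close>

record ('o, 'a) sgrpd =
  Lvl :: "nat \<Rightarrow> ('o, 'a) grpd"
  Fc :: "nat \<Rightarrow> nat \<Rightarrow> ('o, 'a, 'o, 'a) ftor"
  Dg :: "nat \<Rightarrow> nat \<Rightarrow> ('o, 'a, 'o, 'a) ftor"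

definition bar_Sr :: "('c, 'd, 'o, 'a) Mr_operad \<Rightarrow>
    (('c, 'o) otree list, (nat \<times> ('d, 'a) otree) list) sgrpd" where
  "bar_Sr Q = \<lparr>
     Lvl = (\<lambda>n. Sr (bar_level Q n)),
     Fc = (\<lambda>n i. if i < n then Sr_map (inner_face Q n i)
                 else Sr_mult \<circ>\<^sub>F Sr_map (Mr_to_Sr \<circ>\<^sub>F discard_root)),
     Dg = (\<lambda>n i. Sr_map (degeneracy Q n i))\<rparr>"


section \<open>Bialgebras over the rationals\<close>

text \<open>
  The vector space with basis \<open>B\<close> is the space of finitely supported functions with support in
  \<open>B\<close>, and its tensor square is the one with basis \<open>B \<times> B\<close>.  The structure maps are given on the
  basis and extended linearly.
\<close>

definition scale :: "rat \<Rightarrow> ('b \<Rightarrow>\<^sub>0 rat) \<Rightarrow> ('b \<Rightarrow>\<^sub>0 rat)" where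
  "scale c p = Poly_Mapping.map ((*) c) p"

definition lin :: "('b \<Rightarrow> ('c \<Rightarrow>\<^sub>0 rat)) \<Rightarrow> ('b \<Rightarrow>\<^sub>0 rat) \<Rightarrow> ('c \<Rightarrow>\<^sub>0 rat)" where
  "lin h p = (\<Sum>x \<in> Poly_Mapping.keys p. scale (Poly_Mapping.lookup p x) (h x))"

definition tens :: "('b \<Rightarrow>\<^sub>0 rat) \<Rightarrow> ('c \<Rightarrow>\<^sub>0 rat) \<Rightarrow> ('b \<times> 'c \<Rightarrow>\<^sub>0 rat)" where
  "tens p q = (\<Sum>x \<in> Poly_Mapping.keys p. \<Sum>y \<in> Poly_Mapping.keys q.
     Poly_Mapping.single (x, y) (Poly_Mapping.lookup p x * Poly_Mapping.lookup q y))"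

abbreviation basis_elt :: "'b \<Rightarrow> ('b \<Rightarrow>\<^sub>0 rat)" where
  "basis_elt x \<equiv> Poly_Mapping.single x 1"

record 'b bialg =
  basis :: "'b set"
  mult :: "'b \<Rightarrow> 'b \<Rightarrow> ('b \<Rightarrow>\<^sub>0 rat)"
  unit_elt :: "'b \<Rightarrow>\<^sub>0 rat"
  comult :: "'b \<Rightarrow> ('b \<times> 'b \<Rightarrow>\<^sub>0 rat)"
  counit :: "'b \<Rightarrow> rat"

definition space :: "'b bialg \<Rightarrow> ('b \<Rightarrow>\<^sub>0 rat) set" where
  "space A = {p. Poly_Mapping.keys p \<subseteq> basis A}"

definition mul :: "'b bialg \<Rightarrow> ('b \<Rightarrow>\<^sub>0 rat) \<Rightarrow> ('b \<Rightarrow>\<^sub>0 rat) \<Rightarrow> ('b \<Rightarrow>\<^sub>0 rat)" where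
  "mul A p q = lin (\<lambda>(x, y). mult A x y) (tens p q)"

definition comul :: "'b bialg \<Rightarrow> ('b \<Rightarrow>\<^sub>0 rat) \<Rightarrow> ('b \<times> 'b \<Rightarrow>\<^sub>0 rat)" where
  "comul A p = lin (comult A) p"

definition coun :: "'b bialg \<Rightarrow> ('b \<Rightarrow>\<^sub>0 rat) \<Rightarrow> rat" where
  "coun A p = (\<Sum>x \<in> Poly_Mapping.keys p. Poly_Mapping.lookup p x * counit A x)"

definition tens_mul :: "'b bialg \<Rightarrow> ('b \<times> 'b \<Rightarrow>\<^sub>0 rat) \<Rightarrow> ('b \<times> 'b \<Rightarrow>\<^sub>0 rat) \<Rightarrow> ('b \<times> 'b \<Rightarrow>\<^sub>0 rat)" where
  "tens_mul A s t = lin (\<lambda>((x, y), (x', y')). tens (mult A x x') (mult A y y')) (tens s t)"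

definition bialgebra :: "'b bialg \<Rightarrow> bool" where
  "bialgebra A \<longleftrightarrow>
     unit_elt A \<in> space A \<and>
     (\<forall>p \<in> space A. \<forall>q \<in> space A. mul A p q \<in> space A) \<and>
     (\<forall>p \<in> space A. Poly_Mapping.keys (comul A p) \<subseteq> basis A \<times> basis A) \<and>
     (\<forall>p \<in> space A. \<forall>q \<in> space A. \<forall>r \<in> space A. mul A (mul A p q) r = mul A p (mul A q r)) \<and>
     (\<forall>p \<in> space A. mul A (unit_elt A) p = p \<and> mul A p (unit_elt A) = p) \<and>
     (\<forall>p \<in> space A.
        lin (\<lambda>(x, y). lin (\<lambda>(u, v). basis_elt (u, v, y)) (comult A x)) (comul A p) =
        lin (\<lambda>(x, y). lin (\<lambda>(u, v). basis_elt (x, u, v)) (comult A y)) (comul A p)) \<and>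
     (\<forall>p \<in> space A.
        lin (\<lambda>(x, y). scale (counit A x) (basis_elt y)) (comul A p) = p \<and>
        lin (\<lambda>(x, y). scale (counit A y) (basis_elt x)) (comul A p) = p) \<and>
     (\<forall>p \<in> space A. \<forall>q \<in> space A.
        comul A (mul A p q) = tens_mul A (comul A p) (comul A q) \<and>
        coun A (mul A p q) = coun A p * coun A q) \<and>
     comul A (unit_elt A) = tens (unit_elt A) (unit_elt A) \<and>
     coun A (unit_elt A) = 1"

definition bialgebra_iso :: "'b bialg \<Rightarrow> 'c bialg \<Rightarrow> (('b \<Rightarrow>\<^sub>0 rat) \<Rightarrow> ('c \<Rightarrow>\<^sub>0 rat)) \<Rightarrow> bool" where
  "bialgebra_iso A B \<phi> \<longleftrightarrow>
     bij_betw \<phi> (space A) (space B) \<and>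
     (\<forall>p \<in> space A. \<forall>q \<in> space A. \<phi> (p + q) = \<phi> p + \<phi> q) \<and>
     (\<forall>c. \<forall>p \<in> space A. \<phi> (scale c p) = scale c (\<phi> p)) \<and>
     (\<forall>p \<in> space A. \<forall>q \<in> space A. \<phi> (mul A p q) = mul B (\<phi> p) (\<phi> q)) \<and>
     \<phi> (unit_elt A) = unit_elt B \<and>
     (\<forall>p \<in> space A. comul B (\<phi> p) =
        lin (\<lambda>(x, y). tens (\<phi> (basis_elt x)) (\<phi> (basis_elt y))) (comul A p)) \<and>
     (\<forall>p \<in> space A. coun B (\<phi> p) = coun A p)"

definition isomorphic_bialgebras :: "'b bialg \<Rightarrow> 'c bialg \<Rightarrow> bool" where
  "isomorphic_bialgebras A B \<longleftrightarrow> bialgebra A \<and> bialgebra B \<and> (\<exists>\<phi>. bialgebra_iso A B \<phi>)"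


section \<open>Homotopy cardinality of the incidence bialgebra\<close>

definition Phi :: "('o, 'a) sgrpd \<Rightarrow> 'o \<Rightarrow> 'o \<Rightarrow> 'o \<Rightarrow>
    (('o \<times> 'a) \<times> ('a \<times> 'a), ('a \<times> 'a) \<times> ('a \<times> 'a)) grpd" where
  "Phi X f a b =
     hfib (hfib (Lvl X 2) (Lvl X 1) (Fc X 2 1) f) (prod_grpd (Lvl X 1) (Lvl X 1))
       (pair_ftor (Fc X 2 2 \<circ>\<^sub>F hfib_proj) (Fc X 2 0 \<circ>\<^sub>F hfib_proj)) (a, b)"

definition incidence_coeff :: "('o, 'a) sgrpd \<Rightarrow> 'o \<Rightarrow> 'o \<Rightarrow> 'o \<Rightarrow> rat" where
  "incidence_coeff X f a b = hcard (Phi X f a b) /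
     (of_nat (card (Aut (Lvl X 1) a)) * of_nat (card (Aut (Lvl X 1) b)))"

definition incidence_counit :: "('o, 'a) sgrpd \<Rightarrow> 'o \<Rightarrow> rat" where
  "incidence_counit X f = hcard (hfib (Lvl X 0) (Lvl X 1) (Dg X 0 0) f)"

text \<open>
  Every cardinality occurring below is that of a homotopy finite groupoid, and the sums defining the
  comultiplication are finite.
\<close>

definition incidence_finite :: "('o, 'a) sgrpd \<Rightarrow> bool" where
  "incidence_finite X \<longleftrightarrow>
     (\<forall>f \<in> Obj (Lvl X 1).
        finite (Aut (Lvl X 1) f) \<and>
        hfinite (hfib (Lvl X 0) (Lvl X 1) (Dg X 0 0) f) \<and>
        (\<forall>a \<in> Obj (Lvl X 1). \<forall>b \<in> Obj (Lvl X 1). hfinite (Phi X f a b)) \<and>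
        finite {(a, b). a \<in> pi0 (Lvl X 1) \<and> b \<in> pi0 (Lvl X 1) \<and>
                        incidence_coeff X f (rep a) (rep b) \<noteq> 0})"

text \<open>
  The product is induced by an operation \<open>j\<close> on the objects of \<open>X\<^sub>1\<close> (juxtaposition); \<open>None\<close> is the
  adjoined unit.  The comultiplication is determined by \<open>Abs_poly_mapping\<close> only when
  \<open>incidence_finite X\<close> holds.
\<close>

definition incidence_bialgebra :: "('o, 'a) sgrpd \<Rightarrow> ('o \<Rightarrow> 'o \<Rightarrow> 'o) \<Rightarrow> 'o set option bialg" where
  "incidence_bialgebra X j = \<lparr>
     basis = insert None (Some ` pi0 (Lvl X 1)),
     mult = (\<lambda>u v. case (u, v) of
         (None, _) \<Rightarrow> basis_elt v
       | (_, None) \<Rightarrow> basis_elt u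
       | (Some a, Some b) \<Rightarrow> basis_elt (Some (iso_class (Lvl X 1) (j (rep a) (rep b))))),
     unit_elt = basis_elt None,
     comult = (\<lambda>u. case u of
         None \<Rightarrow> basis_elt (None, None)
       | Some f \<Rightarrow> Abs_poly_mapping (\<lambda>w. case w of
             (Some a, Some b) \<Rightarrow>
               (if a \<in> pi0 (Lvl X 1) \<and> b \<in> pi0 (Lvl X 1)
                then incidence_coeff X (rep f) (rep a) (rep b) else 0)
           | _ \<Rightarrow> 0)),
     counit = (\<lambda>u. case u of None \<Rightarrow> 1 | Some f \<Rightarrow> incidence_counit X (rep f))\<rparr>"


section \<open>The linear plethystic bialgebra with noncommuting variables\<close>

definition Words :: "nat list set" where
  "Words = {w. w \<noteq> [] \<and> (\<forall>k \<in> set w. 0 < k)}"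

text \<open>
  A power series in noncommuting variables is its coefficient function on words, the empty word
  giving the constant term.
\<close>

type_synonym ncseries = "nat list \<Rightarrow> rat"

definition series :: "ncseries set" where
  "series = {F. \<forall>w. w \<notin> Words \<longrightarrow> F w = 0}"

definition nc_var :: "nat \<Rightarrow> ncseries" where
  "nc_var k = (\<lambda>w. if w = [k] then 1 else 0)"

definition nc_one :: ncseries where
  "nc_one = (\<lambda>w. if w = [] then 1 else 0)"

definition nc_times :: "ncseries \<Rightarrow> ncseries \<Rightarrow> ncseries" where
  "nc_times F G = (\<lambda>w. \<Sum>i\<le>length w. F (take i w) * G (drop i w))"

text \<open>\<open>rescale k F\<close> is \<open>F\<^sub>k = F(x\<^sub>k, x\<^sub>2\<^sub>k, \<dots>)\<close>.\<close>

definition rescale :: "nat \<Rightarrow> ncseries \<Rightarrow> ncseries" where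
  "rescale k F = (\<lambda>w. Sum_any (\<lambda>v. if map ((*) k) v = w then F v else 0))"

text \<open>
  \<open>pleth G F\<close> is \<open>G(F\<^sub>1, F\<^sub>2, \<dots>)\<close>.  For series without constant term, only finitely many \<open>v\<close>
  contribute to each coefficient.
\<close>

definition pleth :: "ncseries \<Rightarrow> ncseries \<Rightarrow> ncseries" where
  "pleth G F = (\<lambda>w. Sum_any (\<lambda>v. G v * foldr nc_times (map (\<lambda>k. rescale k F) v) nc_one w))"

text \<open>
  A monomial in the \<open>a\<^sub>\<omega>\<close> is given by its exponents.  The element \<open>t\<close> of the tensor square has the
  value \<open>t(F, G)\<close> with its first factor evaluated at \<open>F\<close> and its second at \<open>G\<close>.
\<close>

type_synonym monomial = "nat list \<Rightarrow>\<^sub>0 nat"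

definition monomials :: "monomial set" where
  "monomials = {m. Poly_Mapping.keys m \<subseteq> Words}"

definition eval_mon :: "monomial \<Rightarrow> ncseries \<Rightarrow> rat" where
  "eval_mon m F = (\<Prod>w \<in> Poly_Mapping.keys m. F w ^ Poly_Mapping.lookup m w)"

definition eval_tens :: "(monomial \<times> monomial \<Rightarrow>\<^sub>0 rat) \<Rightarrow> ncseries \<Rightarrow> ncseries \<Rightarrow> rat" where
  "eval_tens t F G = (\<Sum>(m, n) \<in> Poly_Mapping.keys t.
     Poly_Mapping.lookup t (m, n) * eval_mon m F * eval_mon n G)"

definition pleth_comult_gen :: "nat list \<Rightarrow> (monomial \<times> monomial \<Rightarrow>\<^sub>0 rat)" where
  "pleth_comult_gen w = (THE t. Poly_Mapping.keys t \<subseteq> monomials \<times> monomials \<and>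
     (\<forall>F \<in> series. \<forall>G \<in> series. eval_tens t F G = pleth G F w))"

text \<open>
  The comultiplication is multiplicative; products are taken in the convolution ring of the monoid
  of pairs of monomials, which is the tensor square of the polynomial ring.
\<close>

definition plethystic_bialgebra :: "monomial bialg" where
  "plethystic_bialgebra = \<lparr>
     basis = monomials,
     mult = (\<lambda>m n. basis_elt (m + n)),
     unit_elt = basis_elt 0,
     comult = (\<lambda>m. \<Prod>w \<in> Poly_Mapping.keys m. pleth_comult_gen w ^ Poly_Mapping.lookup m w),
     counit = (\<lambda>m. eval_mon m (nc_var 1))\<rparr>"

end

theory Submission
  imports Defs "HOL-Combinatorics.Permutations" "HOL-Combinatorics.Multiset_Permutations"
begin

text \<open>
  The operations of \<open>T_Mr Ass\<close> are words of positive integers, and all its groupoids are discrete.  Hence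
  the homotopy fibres of the bar construction reduce to counting: the coefficient of \<open>a \<otimes> b\<close> in
  \<open>\<Delta>(f)\<close> is the number of ways to write each letter \<open>w\<close> of \<open>f\<close> as a composite of a root word
  \<open>om\<close> with words \<open>vs\<close> such that the words above form \<open>a\<close> and the roots form \<open>b\<close>.  The same composites
  index the coefficient of \<open>w\<close> in \<open>G(F\<^sub>1, F\<^sub>2, \<dots>)\<close>, so that
  \<open>\<Delta>(a\<^sub>w) = \<Sum> a\<^sub>v\<^sub>1 \<cdots> a\<^sub>v\<^sub>k \<otimes> a\<^sub>o\<^sub>m\<close>.  The bialgebra laws
  are checked for the polynomial algebra and transported along the bijection of bases that sends a monomial
  to the isomorphism class of the corresponding list of operations.
\<close>

section \<open>Linear extensions and tensor products\<close>

text \<open>Discreteness holds for the levels \<open>bar_level\<close>, not for the groupoids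
  \<open>Sr\<close> built on them, so every fibre carries weights. They are controlled by counting
  all arrows that leave an object: over a discrete groupoid a list of length n has n! of them,
  whatever its repetitions, and passing to a homotopy fibre preserves this number. A cardinality
  becomes a sum over objects of inverse arrow counts, with no representatives to choose. A second
  obstacle is that the comultiplication of a generator is specified only by its values on pairs of
  series; a formula for it needs uniqueness, which is a statement of linear independence. Lists link
  the two sides: a list of words is both an object over the first level and, up to order, a
  monomial, and the lists of two-level trees composing to it also index the expanded product of the
  comultiplications of its words. The coalgebra laws are proved for polynomials because there all
  maps involved are multiplicative, so that each law needs checking on a single generator
  only.\<close>

lemma lookup_scale [simp]: "Poly_Mapping.lookup (scale c p) x = c * Poly_Mapping.lookup p x"
  unfolding scale_def by (transfer fixing: c) (simp add: when_def)

lemma scale_single [simp]: "scale c (Poly_Mapping.single x d) = Poly_Mapping.single x (c * d)"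
  by (rule poly_mapping_eqI) (simp add: lookup_single when_def)

lemma scale_zero_left [simp]: "scale 0 p = 0"
  and scale_zero_right [simp]: "scale c 0 = 0"
  and scale_one [simp]: "scale 1 p = p"
  and scale_scale [simp]: "scale c (scale d p) = scale (c * d) p"
  and scale_add_left: "scale (c + d) p = scale c p + scale d p"
  and scale_add_right: "scale c (p + q) = scale c p + scale c q"
  and scale_sum: "scale c (\<Sum>i\<in>I. f i) = (\<Sum>i\<in>I. scale c (f i))"
  by (rule poly_mapping_eqI;
      simp add: lookup_add lookup_sum algebra_simps sum_distrib_left)+

lemma mult_scale:
  fixes p q :: "'b::comm_monoid_add \<Rightarrow>\<^sub>0 rat"
  shows "scale c p * q = scale c (p * q)" "p * scale c q = scale c (p * q)"
  by (simp_all add: scale_def mult_map_scale_conv_mult mult_ac)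

lemma keys_scale: "Poly_Mapping.keys (scale c p) \<subseteq> Poly_Mapping.keys p"
  by (auto simp: in_keys_iff)

lemma keys_sum: "Poly_Mapping.keys (\<Sum>i\<in>I. f i) \<subseteq> (\<Union>i\<in>I. Poly_Mapping.keys (f i))"
proof
  fix x assume "x \<in> Poly_Mapping.keys (\<Sum>i\<in>I. f i)"
  then have "(\<Sum>i\<in>I. Poly_Mapping.lookup (f i) x) \<noteq> 0"
    by (simp add: in_keys_iff lookup_sum)
  then obtain i where "i \<in> I" "Poly_Mapping.lookup (f i) x \<noteq> 0"
    by (meson sum.neutral)
  then show "x \<in> (\<Union>i\<in>I. Poly_Mapping.keys (f i))"
    by (auto simp: in_keys_iff)
qed

lemma lin_superset:
  assumes "finite S" "Poly_Mapping.keys p \<subseteq> S"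
  shows "lin h p = (\<Sum>x\<in>S. scale (Poly_Mapping.lookup p x) (h x))"
  unfolding lin_def using assms by (intro sum.mono_neutral_left) (auto simp: in_keys_iff)

lemma lin_zero [simp]: "lin h 0 = 0"
  by (simp add: lin_def)

lemma lin_single [simp]: "lin h (Poly_Mapping.single x c) = scale c (h x)"
  by (subst lin_superset[of "{x}"]) auto

lemma lin_add: "lin h (p + q) = lin h p + lin h q"
proof -
  let ?S = "Poly_Mapping.keys p \<union> Poly_Mapping.keys q"
  have "Poly_Mapping.keys (p + q) \<subseteq> ?S"
    by (rule keys_add)
  then show ?thesis
    by (simp add: lin_superset[of ?S] lookup_add scale_add_left sum.distrib)
qed

lemma lin_sum: "lin h (\<Sum>i\<in>I. f i) = (\<Sum>i\<in>I. lin h (f i))"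
  by (induction I rule: infinite_finite_induct) (auto simp: lin_add)

lemma lin_scale: "lin h (scale c p) = scale c (lin h p)"
proof -
  have "lin h (scale c p) =
      (\<Sum>x\<in>Poly_Mapping.keys p. scale (Poly_Mapping.lookup (scale c p) x) (h x))"
    by (rule lin_superset) (use keys_scale[of c p] in auto)
  then show ?thesis by (simp add: lin_def scale_sum)
qed

lemma lin_cong: "(\<And>x. x \<in> Poly_Mapping.keys p \<Longrightarrow> h x = g x) \<Longrightarrow> lin h p = lin g p"
  by (simp add: lin_def)

lemma lin_lin: "lin h (lin g p) = lin (\<lambda>x. lin h (g x)) p"
  by (simp add: lin_def[of _ p] lin_sum lin_scale)

lemma lin_basis_elt [simp]: "lin basis_elt p = p"
proof (rule poly_mapping_eqI)
  fix k
  have "Poly_Mapping.lookup (lin basis_elt p) k =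
      (\<Sum>x\<in>Poly_Mapping.keys p. if x = k then Poly_Mapping.lookup p x else 0)"
    by (auto simp: lin_def lookup_sum lookup_single when_def intro!: sum.cong)
  also have "\<dots> = Poly_Mapping.lookup p k"
    by (simp add: in_keys_iff)
  finally show "Poly_Mapping.lookup (lin basis_elt p) k = Poly_Mapping.lookup p k" .
qed

lemma keys_lin: "Poly_Mapping.keys (lin h p) \<subseteq> (\<Union>x\<in>Poly_Mapping.keys p. Poly_Mapping.keys (h x))"
  unfolding lin_def by (rule order.trans[OF keys_sum UN_mono[OF subset_refl keys_scale]])

text \<open>As nested linear extensions, tensors are subject to \<open>lin_lin\<close>, which fuses
  any composite of structure maps into one iterated \<open>lin\<close>; laws are then compared on
  basis elements.\<close>

lemma tens_eq_lin: "tens p q = lin (\<lambda>x. lin (\<lambda>y. basis_elt (x, y)) q) p"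
  by (simp add: tens_def lin_def scale_sum)

lemma tens_single [simp]:
  "tens (Poly_Mapping.single x c) (Poly_Mapping.single y d) = Poly_Mapping.single (x, y) (c * d)"
  by (simp add: tens_eq_lin)

lemma lin_tens: "lin h (tens p q) = lin (\<lambda>x. lin (\<lambda>y. h (x, y)) q) p"
  by (simp add: tens_eq_lin lin_lin)

lemma mul_eq_lin: "mul A p q = lin (\<lambda>x. lin (bialg.mult A x) q) p"
  by (simp add: mul_def lin_tens)

lemma tens_mul_eq_lin:
  "tens_mul A s t = lin (\<lambda>(x, y). lin (\<lambda>(x', y'). tens (bialg.mult A x x') (bialg.mult A y y')) t) s"
  by (simp add: tens_mul_def lin_tens split_def)

text \<open>The built-in product is convolution, the bilinear extension of addition of indices. This
  identifies it with \<open>mul\<close> and \<open>tens_mul\<close> when basis elements multiply by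
  adding exponents.\<close>

lemma times_eq_lin:
  fixes p q :: "'b::comm_monoid_add \<Rightarrow>\<^sub>0 rat"
  shows "p * q = lin (\<lambda>x. lin (\<lambda>y. basis_elt (x + y)) q) p"
proof -
  have "p * q = lin basis_elt p * lin basis_elt q" by simp
  also have "\<dots> = lin (\<lambda>x. lin (\<lambda>y. basis_elt (x + y)) q) p"
    unfolding lin_def sum_product scale_sum
    by (simp add: mult_single mult_scale)
  finally show ?thesis .
qed

text \<open>A map turning sums of exponents into products extends to a multiplicative map on
  polynomials; this is what reduces the coalgebra laws to generators.\<close>

lemma lin_mult:
  fixes p q :: "'b::comm_monoid_add \<Rightarrow>\<^sub>0 rat" and h :: "'b \<Rightarrow> ('c::comm_monoid_add \<Rightarrow>\<^sub>0 rat)"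
  assumes "\<And>x y. x \<in> Poly_Mapping.keys p \<Longrightarrow> y \<in> Poly_Mapping.keys q \<Longrightarrow> h (x + y) = h x * h y"
  shows "lin h (p * q) = lin h p * lin h q"
proof -
  have "lin h (p * q) = lin (\<lambda>x. lin (\<lambda>y. h (x + y)) q) p"
    by (simp add: times_eq_lin lin_lin)
  also have "\<dots> = lin (\<lambda>x. lin (\<lambda>y. h x * h y) q) p"
    using assms by (intro lin_cong) auto
  also have "\<dots> = lin h p * lin h q"
    unfolding lin_def sum_product scale_sum
    by (simp add: mult_scale mult.commute)
  finally show ?thesis .
qed

text \<open>The scalar-valued counterpart of \<open>lin\<close>; its rules are inherited by viewing
  scalars as polynomials over a one-point index set.\<close>

definition wsum :: "('b \<Rightarrow> rat) \<Rightarrow> ('b \<Rightarrow>\<^sub>0 rat) \<Rightarrow> rat" where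
  "wsum f p = (\<Sum>x\<in>Poly_Mapping.keys p. Poly_Mapping.lookup p x * f x)"

lemma wsum_conv_lin: "wsum f p = Poly_Mapping.lookup (lin (\<lambda>x. Poly_Mapping.single () (f x)) p) ()"
  by (simp add: wsum_def lin_def lookup_sum)

lemma coun_eq_wsum: "coun A p = wsum (counit A) p"
  by (simp add: coun_def wsum_def)

lemma wsum_zero [simp]: "wsum f 0 = 0"
  and wsum_add: "wsum f (p + q) = wsum f p + wsum f q"
  and wsum_single [simp]: "wsum f (Poly_Mapping.single x c) = c * f x"
  and wsum_sum: "wsum f (\<Sum>i\<in>I. k i) = (\<Sum>i\<in>I. wsum f (k i))"
  and wsum_scale: "wsum f (scale c p) = c * wsum f p"
  by (simp_all add: wsum_conv_lin lin_add lookup_add lin_sum lookup_sum lin_scale)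

lemma wsum_lin: "wsum f (lin h p) = wsum (\<lambda>x. wsum f (h x)) p"
  by (simp add: lin_def wsum_def[of _ p] wsum_sum wsum_scale)

lemma wsum_cong: "(\<And>x. x \<in> Poly_Mapping.keys p \<Longrightarrow> h x = g x) \<Longrightarrow> wsum h p = wsum g p"
  by (simp add: wsum_def)

lemma wsum_mult:
  fixes p q :: "'b::comm_monoid_add \<Rightarrow>\<^sub>0 rat"
  assumes "\<And>x y. x \<in> Poly_Mapping.keys p \<Longrightarrow> y \<in> Poly_Mapping.keys q \<Longrightarrow> h (x + y) = h x * h y"
  shows "wsum h (p * q) = wsum h p * wsum h q"
proof -
  have "wsum h (p * q) = wsum (\<lambda>x. wsum (\<lambda>y. h (x + y)) q) p"
    by (simp add: times_eq_lin wsum_lin)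
  also have "\<dots> = wsum (\<lambda>x. wsum (\<lambda>y. h x * h y) q) p"
    using assms by (intro wsum_cong) auto
  also have "\<dots> = wsum h p * wsum h q"
    unfolding wsum_def sum_product by (simp add: sum_distrib_left mult_ac)
  finally show ?thesis .
qed

lemma in_spaceD: "p \<in> space A \<Longrightarrow> x \<in> Poly_Mapping.keys p \<Longrightarrow> x \<in> basis A"
  by (auto simp: space_def)

lemma space_lin:
  assumes "p \<in> space A" "\<And>x. x \<in> basis A \<Longrightarrow> h x \<in> space B"
  shows "lin h p \<in> space B"
  using keys_lin[of h p] assms unfolding space_def by blast

lemma basis_elt_in_space [simp]: "basis_elt x \<in> space A \<longleftrightarrow> x \<in> basis A"
  by (simp add: space_def)

section \<open>Transport of bialgebra structures\<close>

text \<open>The linear extension of \<open>h\<close> is bijective and intertwines all structure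
  maps. Each element of \<open>space B\<close> is thus an image, and the laws of \<open>A\<close>
  are carried over by the maps \<open>\<phi>\<close>, \<open>\<phi>2\<close>, \<open>\<phi>3\<close>
  induced on the first three tensor powers.\<close>

lemma bialgebra_transport:
  fixes A :: "'b bialg" and B :: "'c bialg" and h :: "'b \<Rightarrow> 'c"
  assumes A: "bialgebra A"
    and bij: "bij_betw h (basis A) (basis B)"
    and mult: "\<And>x y. x \<in> basis A \<Longrightarrow> y \<in> basis A \<Longrightarrow>
      bialg.mult B (h x) (h y) = lin (\<lambda>z. basis_elt (h z)) (bialg.mult A x y)"
    and unit: "unit_elt B = lin (\<lambda>z. basis_elt (h z)) (unit_elt A)"
    and comult: "\<And>x. x \<in> basis A \<Longrightarrow>
      comult B (h x) = lin (\<lambda>(y, z). basis_elt (h y, h z)) (comult A x)"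
    and counit: "\<And>x. x \<in> basis A \<Longrightarrow> counit B (h x) = counit A x"
  shows "isomorphic_bialgebras A B"
proof -
  define \<phi> where "\<phi> = lin (\<lambda>z. basis_elt (h z))"
  define \<phi>2 where "\<phi>2 = lin (\<lambda>(y, z). basis_elt (h y, h z))"
  define \<phi>3 where "\<phi>3 = lin (\<lambda>(x, y, z). basis_elt (h x, h y, h z))"
  define \<psi> where "\<psi> = lin (\<lambda>z. basis_elt (inv_into (basis A) h z))"
  let ?A2 = "basis A \<times> basis A"
  have hB: "h x \<in> basis B" if "x \<in> basis A" for x
    using bij that by (auto simp: bij_betw_def)
  have \<phi>_space: "\<phi> p \<in> space B" if "p \<in> space A" for p
    unfolding \<phi>_def using that hB by (intro space_lin) auto
  have \<psi>_space: "\<psi> p \<in> space A" if "p \<in> space B" for p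
    unfolding \<psi>_def using that bij
    by (intro space_lin[of _ B]) (auto simp: bij_betw_def inv_into_into)
  have \<psi>\<phi>: "\<psi> (\<phi> p) = p" if "p \<in> space A" for p
  proof -
    have "\<psi> (\<phi> p) = lin (\<lambda>x. basis_elt (inv_into (basis A) h (h x))) p"
      by (simp add: \<phi>_def \<psi>_def lin_lin)
    also have "\<dots> = lin basis_elt p"
      using that bij by (intro lin_cong) (auto dest: in_spaceD simp: bij_betw_def)
    finally show ?thesis by simp
  qed
  have \<phi>\<psi>: "\<phi> (\<psi> p) = p" if "p \<in> space B" for p
  proof -
    have "\<phi> (\<psi> p) = lin (\<lambda>x. basis_elt (h (inv_into (basis A) h x))) p"
      by (simp add: \<phi>_def \<psi>_def lin_lin)
    also have "\<dots> = lin basis_elt p"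
      using that by (intro lin_cong) (metis bij bij_betw_inv_into_right in_spaceD)
    finally show ?thesis by simp
  qed
  have ex: "\<exists>p'\<in>space A. p = \<phi> p'" if "p \<in> space B" for p
    using that \<phi>\<psi> \<psi>_space by metis
  have mul: "mul B (\<phi> p) (\<phi> q) = \<phi> (mul A p q)" if "p \<in> space A" "q \<in> space A" for p q
    unfolding mul_eq_lin \<phi>_def lin_lin
    using that mult by (simp add: lin_lin) (intro lin_cong; force dest: in_spaceD)
  have comul: "comul B (\<phi> p) = \<phi>2 (comul A p)" if "p \<in> space A" for p
    unfolding comul_def \<phi>_def \<phi>2_def lin_lin
    using that comult by (intro lin_cong) (auto dest: in_spaceD)
  have coun: "coun B (\<phi> p) = coun A p" if "p \<in> space A" for p
    unfolding coun_eq_wsum \<phi>_def wsum_lin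
    using that counit by (intro wsum_cong) (auto dest: in_spaceD)
  have tens: "tens (\<phi> p) (\<phi> q) = \<phi>2 (tens p q)" for p q
    by (simp add: tens_eq_lin \<phi>_def \<phi>2_def lin_lin)
  \<comment> \<open>The product of \<open>B\<close> is known only on images of basis elements of
    \<open>A\<close>, hence the restriction on supports.\<close>
  have tens_mul: "tens_mul B (\<phi>2 s) (\<phi>2 t) = \<phi>2 (tens_mul A s t)"
    if "Poly_Mapping.keys s \<subseteq> ?A2" "Poly_Mapping.keys t \<subseteq> ?A2" for s t
  proof -
    have "tens_mul B (\<phi>2 s) (\<phi>2 t) =
        lin (\<lambda>(x, y). lin (\<lambda>(x', y'). tens (bialg.mult B (h x) (h x')) (bialg.mult B (h y) (h y'))) t) s"
      by (simp add: tens_mul_eq_lin \<phi>2_def lin_lin split_def)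
    also have "\<dots> = lin (\<lambda>(x, y). lin (\<lambda>(x', y'). \<phi>2 (tens (bialg.mult A x x') (bialg.mult A y y'))) t) s"
    proof (intro lin_cong, clarify, intro lin_cong, clarify)
      fix x y x' y'
      assume "(x, y) \<in> Poly_Mapping.keys s" "(x', y') \<in> Poly_Mapping.keys t"
      then have "x \<in> basis A" "y \<in> basis A" "x' \<in> basis A" "y' \<in> basis A"
        using that by auto
      then show "tens (bialg.mult B (h x) (h x')) (bialg.mult B (h y) (h y')) =
          \<phi>2 (tens (bialg.mult A x x') (bialg.mult A y y'))"
        by (simp add: mult flip: tens \<phi>_def)
    qed
    also have "\<dots> = \<phi>2 (tens_mul A s t)"
      by (simp add: tens_mul_eq_lin \<phi>2_def lin_lin split_def)
    finally show ?thesis .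
  qed
  have keys_comul: "Poly_Mapping.keys (comul A p) \<subseteq> ?A2" if "p \<in> space A" for p
    using A that by (simp add: bialgebra_def)
  have comul_cases: "x \<in> basis A \<and> y \<in> basis A"
    if "(x, y) \<in> Poly_Mapping.keys (comul A p)" "p \<in> space A" for x y p
    using keys_comul[OF that(2)] that(1) by auto
  have coassoc_left: "lin (\<lambda>(x, y). lin (\<lambda>(u, v). basis_elt (u, v, y)) (comult B x)) (comul B (\<phi> p)) =
      \<phi>3 (lin (\<lambda>(x, y). lin (\<lambda>(u, v). basis_elt (u, v, y)) (comult A x)) (comul A p))"
    if "p \<in> space A" for p
    unfolding comul[OF that] unfolding \<phi>2_def \<phi>3_def lin_lin split_def
    using comult comul_cases[OF _ that]
    by (intro lin_cong) (auto simp: lin_lin split_def)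
  have coassoc_right: "lin (\<lambda>(x, y). lin (\<lambda>(u, v). basis_elt (x, u, v)) (comult B y)) (comul B (\<phi> p)) =
      \<phi>3 (lin (\<lambda>(x, y). lin (\<lambda>(u, v). basis_elt (x, u, v)) (comult A y)) (comul A p))"
    if "p \<in> space A" for p
    unfolding comul[OF that] unfolding \<phi>2_def \<phi>3_def lin_lin split_def
    using comult comul_cases[OF _ that]
    by (intro lin_cong) (auto simp: lin_lin split_def)
  have counit_left: "lin (\<lambda>(x, y). scale (counit B x) (basis_elt y)) (comul B (\<phi> p)) =
      \<phi> (lin (\<lambda>(x, y). scale (counit A x) (basis_elt y)) (comul A p))" if "p \<in> space A" for p
    unfolding comul[OF that] unfolding \<phi>2_def \<phi>_def lin_lin split_def
    using counit comul_cases[OF _ that] by (intro lin_cong) auto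
  have counit_right: "lin (\<lambda>(x, y). scale (counit B y) (basis_elt x)) (comul B (\<phi> p)) =
      \<phi> (lin (\<lambda>(x, y). scale (counit A y) (basis_elt x)) (comul A p))" if "p \<in> space A" for p
    unfolding comul[OF that] unfolding \<phi>2_def \<phi>_def lin_lin split_def
    using counit comul_cases[OF _ that] by (intro lin_cong) auto
  have unit': "unit_elt B = \<phi> (unit_elt A)"
    using unit by (simp add: \<phi>_def)
  have mul_space: "mul A p q \<in> space A" if "p \<in> space A" "q \<in> space A" for p q
    using A that by (simp add: bialgebra_def)
  have unit_space: "unit_elt A \<in> space A"
    using A by (simp add: bialgebra_def)
  have keys_\<phi>2: "Poly_Mapping.keys (\<phi>2 s) \<subseteq> basis B \<times> basis B"
    if "Poly_Mapping.keys s \<subseteq> ?A2" for s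
    unfolding \<phi>2_def using that hB
    by (intro order.trans[OF keys_lin]) auto
  have "bialgebra B"
    unfolding bialgebra_def
  proof (intro conjI ballI)
    show "unit_elt B \<in> space B"
      by (simp add: unit' \<phi>_space unit_space)
    show "comul B (unit_elt B) = tens (unit_elt B) (unit_elt B)"
      using A by (simp add: unit' comul unit_space tens bialgebra_def)
    show "coun B (unit_elt B) = 1"
      using A by (simp add: unit' coun unit_space bialgebra_def)
  next
    fix p assume "p \<in> space B"
    then obtain p' where p: "p' \<in> space A" "p = \<phi> p'" using ex by blast
    show "Poly_Mapping.keys (comul B p) \<subseteq> basis B \<times> basis B"
      using p by (simp add: comul keys_\<phi>2 keys_comul)
    show "mul B (unit_elt B) p = p" "mul B p (unit_elt B) = p"
      using p A unit_space by (simp_all add: unit' mul bialgebra_def)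
    show "lin (\<lambda>(x, y). lin (\<lambda>(u, v). basis_elt (u, v, y)) (comult B x)) (comul B p) =
      lin (\<lambda>(x, y). lin (\<lambda>(u, v). basis_elt (x, u, v)) (comult B y)) (comul B p)"
      unfolding p(2) coassoc_left[OF p(1)] coassoc_right[OF p(1)]
      using A p(1) by (simp add: bialgebra_def)
    show "lin (\<lambda>(x, y). scale (counit B x) (basis_elt y)) (comul B p) = p"
      unfolding p(2) counit_left[OF p(1)] using A p(1) unfolding bialgebra_def by metis
    show "lin (\<lambda>(x, y). scale (counit B y) (basis_elt x)) (comul B p) = p"
      unfolding p(2) counit_right[OF p(1)] using A p(1) unfolding bialgebra_def by metis
    fix q assume "q \<in> space B"
    then obtain q' where q: "q' \<in> space A" "q = \<phi> q'" using ex by blast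
    show "mul B p q \<in> space B"
      using p q by (simp add: mul \<phi>_space mul_space)
    show "comul B (mul B p q) = tens_mul B (comul B p) (comul B q)"
      using p q A by (simp add: mul comul mul_space tens_mul keys_comul bialgebra_def)
    show "coun B (mul B p q) = coun B p * coun B q"
      using p q A by (simp add: mul coun mul_space bialgebra_def)
    fix r assume "r \<in> space B"
    then obtain r' where r: "r' \<in> space A" "r = \<phi> r'" using ex by blast
    show "mul B (mul B p q) r = mul B p (mul B q r)"
      using p q r A by (simp add: mul mul_space bialgebra_def)
  qed
  moreover have "bialgebra_iso A B \<phi>"
    unfolding bialgebra_iso_def
  proof (intro conjI ballI allI)
    show "bij_betw \<phi> (space A) (space B)"
      by (rule bij_betw_byWitness[of _ \<psi>]) (use \<psi>\<phi> \<phi>\<psi> \<phi>_space \<psi>_space in auto)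
    show "\<phi> (unit_elt A) = unit_elt B" by (simp add: unit')
  next
    fix p assume p: "p \<in> space A"
    show "comul B (\<phi> p) = lin (\<lambda>(x, y). tens (\<phi> (basis_elt x)) (\<phi> (basis_elt y))) (comul A p)"
      using p by (simp add: comul \<phi>2_def) (simp add: \<phi>_def)
    show "coun B (\<phi> p) = coun A p" using p by (rule coun)
    show "\<phi> (scale c p) = scale c (\<phi> p)" for c by (simp add: \<phi>_def lin_scale)
    fix q assume q: "q \<in> space A"
    show "\<phi> (p + q) = \<phi> p + \<phi> q" by (simp add: \<phi>_def lin_add)
    show "\<phi> (mul A p q) = mul B (\<phi> p) (\<phi> q)" using p q by (simp add: mul)
  qed
  ultimately show ?thesis
    using A by (auto simp: isomorphic_bialgebras_def)
qed


section \<open>Monomials as characters\<close>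

definition mon_prod :: "('w \<Rightarrow> 'a::comm_monoid_mult) \<Rightarrow> ('w \<Rightarrow>\<^sub>0 nat) \<Rightarrow> 'a" where
  "mon_prod g m = (\<Prod>w\<in>Poly_Mapping.keys m. g w ^ Poly_Mapping.lookup m w)"

text \<open>Lists serve as handles on monomials: induction on the list replaces induction on
  exponents, and the same list describes an object of the bar construction.\<close>

definition mon :: "'w list \<Rightarrow> ('w \<Rightarrow>\<^sub>0 nat)" where
  "mon ws = (\<Sum>w\<leftarrow>ws. Poly_Mapping.single w 1)"

lemma mon_simps [simp]:
  "mon [] = 0" "mon (w # ws) = Poly_Mapping.single w 1 + mon ws" "mon (ws @ vs) = mon ws + mon vs"
  by (simp_all add: mon_def)

lemma lookup_mon: "Poly_Mapping.lookup (mon ws) w = count (mset ws) w"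
  by (induction ws) (auto simp: lookup_add lookup_single when_def)

lemma mon_eq_iff: "mon ws = mon vs \<longleftrightarrow> mset ws = mset vs"
  by (metis lookup_mon multiset_eqI poly_mapping_eqI)

lemma mon_eq_0_iff [simp]: "mon ws = 0 \<longleftrightarrow> ws = []"
  using mon_eq_iff[of ws "[]"] by simp

lemma keys_mon [simp]: "Poly_Mapping.keys (mon ws) = set ws"
  by (auto simp: in_keys_iff lookup_mon)

text \<open>A finitely supported exponent function counts a multiset, and any enumeration of that
  multiset will do.\<close>

lemma ex_mon: "\<exists>ws. mon ws = m"
proof -
  have "finite {w. 0 < Poly_Mapping.lookup m w}"
    by (rule finite_subset[of _ "Poly_Mapping.keys m"]) (auto simp: in_keys_iff)
  then have count: "count (Abs_multiset (Poly_Mapping.lookup m)) = Poly_Mapping.lookup m"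
    by (rule count_Abs_multiset)
  obtain ws where "mset ws = Abs_multiset (Poly_Mapping.lookup m)"
    using ex_mset by blast
  then have "mon ws = m"
    by (intro poly_mapping_eqI) (simp add: lookup_mon count)
  then show ?thesis ..
qed

lemma mon_prod_superset:
  assumes "finite S" "Poly_Mapping.keys m \<subseteq> S"
  shows "mon_prod g m = (\<Prod>w\<in>S. g w ^ Poly_Mapping.lookup m w)"
  unfolding mon_prod_def using assms by (intro prod.mono_neutral_left) (auto simp: in_keys_iff)

lemma mon_prod_add [simp]: "mon_prod g (m + n) = mon_prod g m * mon_prod g n"
proof -
  let ?S = "Poly_Mapping.keys m \<union> Poly_Mapping.keys n"
  have "Poly_Mapping.keys (m + n) \<subseteq> ?S" by (rule keys_add)
  then show ?thesis
    by (simp add: mon_prod_superset[of ?S] lookup_add power_add prod.distrib)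
qed

lemma mon_prod_zero [simp]: "mon_prod g 0 = 1"
  and mon_prod_single [simp]: "mon_prod g (Poly_Mapping.single w 1) = g w"
  by (simp_all add: mon_prod_def)

lemma mon_prod_mon [simp]: "mon_prod g (mon ws) = prod_list (map g ws)"
  by (induction ws) (simp_all add: mon_prod_single[unfolded One_nat_def])

lemma mon_prod_mult: "mon_prod (\<lambda>w. g w * h w) m = mon_prod g m * mon_prod h m"
  by (simp add: mon_prod_def power_mult_distrib prod.distrib)

lemma eval_mon_eq: "eval_mon m F = mon_prod F m"
  by (simp add: eval_mon_def mon_prod_def)

lemma eval_tens_eq: "eval_tens t F G = wsum (\<lambda>(m, n). mon_prod F m * mon_prod G n) t"
  by (simp add: eval_tens_def wsum_def eval_mon_eq split_def mult.assoc)

text \<open>Artin's argument: subtracting \<open>\<chi> j y\<close> times the relation at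
  \<open>x\<close> from the relation at \<open>prd x y\<close> removes the term of \<open>j\<close>
  and multiplies the coefficient of each other \<open>k\<close> by
  \<open>\<chi> k y - \<chi> j y\<close>. Choosing \<open>y\<close> to separate \<open>i\<close>
  from \<open>j\<close> forces \<open>c i = 0\<close>.\<close>

lemma characters_independent:
  fixes \<chi> :: "'i \<Rightarrow> 'm \<Rightarrow> 'k::idom" and prd :: "'m \<Rightarrow> 'm \<Rightarrow> 'm"
  assumes "finite I"
    and "\<And>x y. x \<in> S \<Longrightarrow> y \<in> S \<Longrightarrow> prd x y \<in> S"
    and "\<And>i x y. i \<in> I \<Longrightarrow> x \<in> S \<Longrightarrow> y \<in> S \<Longrightarrow> \<chi> i (prd x y) = \<chi> i x * \<chi> i y"
    and "\<And>i. i \<in> I \<Longrightarrow> \<exists>x\<in>S. \<chi> i x \<noteq> 0"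
    and "\<And>i j. i \<in> I \<Longrightarrow> j \<in> I \<Longrightarrow> i \<noteq> j \<Longrightarrow> \<exists>x\<in>S. \<chi> i x \<noteq> \<chi> j x"
    and "\<And>x. x \<in> S \<Longrightarrow> (\<Sum>i\<in>I. c i * \<chi> i x) = 0"
  shows "\<forall>i\<in>I. c i = 0"
  using assms
proof (induction I arbitrary: c rule: finite_induct)
  case empty
  show ?case by simp
next
  case (insert j I)
  have zero: "c i = 0" if i: "i \<in> I" for i
  proof -
    have "i \<noteq> j" using i insert.hyps by auto
    then obtain y where y: "y \<in> S" "\<chi> i y \<noteq> \<chi> j y"
      using insert.prems(4)[of i j] i by auto
    have "\<forall>k\<in>I. c k * (\<chi> k y - \<chi> j y) = 0"
    proof (rule insert.IH)
      fix x assume x: "x \<in> S"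
      have "(\<Sum>k\<in>insert j I. c k * \<chi> k (prd x y)) - \<chi> j y * (\<Sum>k\<in>insert j I. c k * \<chi> k x) = 0"
        using insert.prems(1,5) x y by simp
      also have "(\<Sum>k\<in>insert j I. c k * \<chi> k (prd x y)) = (\<Sum>k\<in>insert j I. c k * (\<chi> k x * \<chi> k y))"
        using insert.prems(2) x y by (intro sum.cong) auto
      finally show "(\<Sum>k\<in>I. c k * (\<chi> k y - \<chi> j y) * \<chi> k x) = 0"
        using insert.hyps by (simp add: algebra_simps sum_distrib_left sum_subtractf)
    qed (use insert.prems in auto)
    with i y show ?thesis by auto
  qed
  obtain x where x: "x \<in> S" "\<chi> j x \<noteq> 0"
    using insert.prems(3) by auto
  have "c j * \<chi> j x = 0"
    using insert.prems(5)[OF x(1)] insert.hyps zero by simp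
  with x zero show ?case by auto
qed

text \<open>
  Monomials in the values of \<open>F\<close> and \<open>G\<close> are characters of the monoid of pairs \<open>(F, G)\<close> under the
  coefficientwise product, so Artin's independence of characters applies.
\<close>

lemma eval_tens_inj:
  assumes t: "Poly_Mapping.keys t \<subseteq> monomials \<times> monomials"
    and u: "Poly_Mapping.keys u \<subseteq> monomials \<times> monomials"
    and eq: "\<And>F G. F \<in> series \<Longrightarrow> G \<in> series \<Longrightarrow> eval_tens t F G = eval_tens u F G"
  shows "t = u"
proof (rule poly_mapping_eqI)
  fix p
  let ?I = "Poly_Mapping.keys t \<union> Poly_Mapping.keys u"
  let ?c = "\<lambda>i. Poly_Mapping.lookup t i - Poly_Mapping.lookup u i"
  define \<chi> :: "monomial \<times> monomial \<Rightarrow> ncseries \<times> ncseries \<Rightarrow> rat" where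
    "\<chi> = (\<lambda>(m, n) (F, G). mon_prod F m * mon_prod G n)"
  define pw :: "ncseries \<times> ncseries \<Rightarrow> ncseries \<times> ncseries \<Rightarrow> ncseries \<times> ncseries" where
    "pw = (\<lambda>(F, G) (F', G'). (\<lambda>w. F w * F' w, \<lambda>w. G w * G' w))"
  \<comment> \<open>With the value 2 at \<open>w\<close> and 1 at the other words, a monomial
    evaluates to 2 to the power of its exponent at \<open>w\<close>; this recovers the exponent and
    never vanishes.\<close>
  define probe :: "nat list \<Rightarrow> ncseries" where
    "probe = (\<lambda>w v. if v = w then 2 else if v \<in> Words then 1 else 0)"
  have probe_series: "probe w \<in> series" if "w \<in> Words" for w
    using that by (auto simp: probe_def series_def)
  have probe: "mon_prod (probe w) m = 2 ^ Poly_Mapping.lookup m w" if "m \<in> monomials" for m w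
  proof -
    have "mon_prod (probe w) m = (\<Prod>v\<in>Poly_Mapping.keys m. if v = w then 2 ^ Poly_Mapping.lookup m w else 1)"
      unfolding mon_prod_def using that
      by (intro prod.cong) (auto simp: probe_def monomials_def)
    also have "\<dots> = 2 ^ Poly_Mapping.lookup m w"
      by (auto simp: in_keys_iff)
    finally show ?thesis .
  qed
  have one: "[1] \<in> Words" by (simp add: Words_def)
  have differ: "\<exists>w\<in>Words. Poly_Mapping.lookup m w \<noteq> Poly_Mapping.lookup n w"
    if "m \<noteq> n" "m \<in> monomials" "n \<in> monomials" for m n
  proof -
    obtain w where w: "Poly_Mapping.lookup m w \<noteq> Poly_Mapping.lookup n w"
      using \<open>m \<noteq> n\<close> by (meson poly_mapping_eqI)
    then have "w \<in> Poly_Mapping.keys m \<union> Poly_Mapping.keys n"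
      by (auto simp: in_keys_iff)
    with w that show ?thesis by (auto simp: monomials_def)
  qed
  have "\<forall>i\<in>?I. ?c i = 0"
  proof (rule characters_independent[where prd = pw and S = "series \<times> series" and \<chi> = \<chi>])
    show "pw x y \<in> series \<times> series" if "x \<in> series \<times> series" "y \<in> series \<times> series" for x y
      using that by (auto simp: pw_def series_def)
    show "\<chi> i (pw x y) = \<chi> i x * \<chi> i y" for i x y
      by (simp add: \<chi>_def pw_def split_def mon_prod_mult)
    show "\<exists>x\<in>series \<times> series. \<chi> i x \<noteq> 0" if "i \<in> ?I" for i
      using that t u one probe_series[of "[1]"]
      by (intro bexI[of _ "(probe [1], probe [1])"]) (auto simp: \<chi>_def probe)
    show "\<exists>x\<in>series \<times> series. \<chi> i x \<noteq> \<chi> j x" if ij: "i \<in> ?I" "j \<in> ?I" "i \<noteq> j" for i j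
    proof -
      obtain m n m' n' where [simp]: "i = (m, n)" "j = (m', n')" by fastforce
      have mem: "m \<in> monomials" "n \<in> monomials" "m' \<in> monomials" "n' \<in> monomials"
        using ij t u by auto
      \<comment> \<open>The all-ones series evaluates every monomial to 1, which isolates the
        component in which the two pairs differ.\<close>
      have one_series: "(\<lambda>v. if v \<in> Words then 1 else 0) \<in> series"
        by (simp add: series_def)
      have one_prod: "mon_prod (\<lambda>v. if v \<in> Words then 1 else 0 :: rat) k = 1" if "k \<in> monomials" for k
        unfolding mon_prod_def using that by (intro prod.neutral) (auto simp: monomials_def)
      show ?thesis
      proof (cases "m = m'")
        case False
        then obtain w where "w \<in> Words" "Poly_Mapping.lookup m w \<noteq> Poly_Mapping.lookup m' w"
          using differ mem by blast
        then show ?thesis using mem probe_series one_series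
          by (intro bexI[of _ "(probe w, \<lambda>v. if v \<in> Words then 1 else 0)"])
             (auto simp: \<chi>_def probe one_prod)
      next
        case True
        then obtain w where "w \<in> Words" "Poly_Mapping.lookup n w \<noteq> Poly_Mapping.lookup n' w"
          using differ mem \<open>i \<noteq> j\<close> by auto
        then show ?thesis using mem probe_series one_series
          by (intro bexI[of _ "(\<lambda>v. if v \<in> Words then 1 else 0, probe w)"])
             (auto simp: \<chi>_def probe one_prod)
      qed
    qed
    show "(\<Sum>i\<in>?I. ?c i * \<chi> i x) = 0" if "x \<in> series \<times> series" for x
    proof -
      obtain F G where x: "x = (F, G)" "F \<in> series" "G \<in> series"
        using \<open>x \<in> series \<times> series\<close> by blast
      have ev: "eval_tens v F G = (\<Sum>i\<in>?I. Poly_Mapping.lookup v i * \<chi> i (F, G))"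
        if "v = t \<or> v = u" for v
        unfolding eval_tens_eq wsum_def \<chi>_def using that
        by (intro sum.mono_neutral_cong_left) (auto simp: in_keys_iff)
      have "(\<Sum>i\<in>?I. ?c i * \<chi> i x) = eval_tens t F G - eval_tens u F G"
        unfolding x(1) left_diff_distrib sum_subtractf
        by (simp only: ev[OF disjI1[OF refl]] ev[OF disjI2[OF refl]])
      with eq[OF x(2,3)] show ?thesis by simp
    qed
  qed simp
  then show "Poly_Mapping.lookup t p = Poly_Mapping.lookup u p"
    by (metis Un_iff eq_iff_diff_eq_0 in_keys_iff)
qed


section \<open>Plethystic substitution on words\<close>

text \<open>Composition in the operad of words. A letter stands for an arrow of the category
  obtained from \<open>Ass\<close>, where composition is multiplication, so a root letter
  \<open>k\<close> multiplies all letters of the word grafted onto it. On the other side, it is the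
  word of a product of monomials taken from the rescaled series.\<close>

definition subst_word :: "nat list \<Rightarrow> nat list list \<Rightarrow> nat list" where
  "subst_word om vs = concat (map2 (\<lambda>k v. map ((*) k) v) om vs)"

text \<open>The condition on lengths excludes lists that \<open>map2\<close> would silently
  truncate.\<close>

definition word_fib :: "nat list \<Rightarrow> nat list \<Rightarrow> nat list list set" where
  "word_fib om w = {vs. set vs \<subseteq> Words \<and> length vs = length om \<and> subst_word om vs = w}"

definition decomp :: "nat list \<Rightarrow> (nat list \<times> nat list list) set" where
  "decomp w = (SIGMA om:Words. word_fib om w)"

lemma subst_word_simps [simp]:
  "subst_word [] vs = []" "subst_word om [] = []"
  "subst_word (k # om) (v # vs) = map ((*) k) v @ subst_word om vs"
  by (simp_all add: subst_word_def)

lemma subst_word_append: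
  "length om = length vs \<Longrightarrow>
    subst_word (om @ om') (vs @ vs') = subst_word om vs @ subst_word om' vs'"
  by (simp add: subst_word_def)

lemma subst_word_map: "subst_word (map ((*) k) om) vs = map ((*) k) (subst_word om vs)"
proof (induction om arbitrary: vs)
  case (Cons a om)
  then show ?case by (cases vs) (auto simp: mult.assoc)
qed simp

lemma subst_word_Words:
  assumes "om \<in> Words" "vs \<in> word_fib om w"
  shows "w \<in> Words"
proof -
  have "subst_word om vs \<in> Words \<or> om = []"
    if "length vs = length om" "set vs \<subseteq> Words" "\<forall>k\<in>set om. 0 < k"
    using that
  proof (induction vs om rule: list_induct2)
    case (Cons v vs k om)
    then show ?case by (auto simp: Words_def)
  qed simp
  with assms show ?thesis by (auto simp: word_fib_def Words_def)
qed

text \<open>Letters are positive and blocks nonempty: each letter of \<open>w\<close> is a product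
  \<open>k * j\<close> and bounds both factors, and each root letter uses up at least one position
  of \<open>w\<close>. The bounds are crude but yield finiteness.\<close>

lemma word_fib_bounds:
  assumes "vs \<in> word_fib om w" "\<forall>k\<in>set om. 0 < k"
  shows "length om \<le> length w" "length vs \<le> length w" "set om \<subseteq> {..sum_list w}"
    "set vs \<subseteq> {v. set v \<subseteq> {..sum_list w} \<and> length v \<le> length w}"
proof -
  have "length om \<le> length (subst_word om vs) \<and> set om \<subseteq> {..sum_list (subst_word om vs)} \<and>
      set vs \<subseteq> {v. set v \<subseteq> {..sum_list (subst_word om vs)} \<and> length v \<le> length (subst_word om vs)}"
    if "length vs = length om" "set vs \<subseteq> Words" "\<forall>k\<in>set om. 0 < k"
    using that
  proof (induction vs om rule: list_induct2)
    case (Cons v vs k om)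
    have k: "0 < k" and v: "v \<noteq> []" "\<forall>j\<in>set v. 0 < j"
      using Cons.prems by (auto simp: Words_def)
    have "0 < sum_list v"
      using v by (cases v) auto
    then have le: "k \<le> k * sum_list v" "sum_list v \<le> k * sum_list v"
      using k by auto
    have "\<forall>j\<in>set v. j \<le> sum_list v"
      by (simp add: member_le_sum_list)
    with le have elem: "\<forall>j\<in>set v. j \<le> k * sum_list v"
      using order_trans by blast
    have "sum_list (subst_word (k # om) (v # vs)) = k * sum_list v + sum_list (subst_word om vs)"
      by (simp add: sum_list_const_mult)
    moreover have "length (subst_word (k # om) (v # vs)) = length v + length (subst_word om vs)"
      by simp
    moreover have "length om \<le> length (subst_word om vs)" "set om \<subseteq> {..sum_list (subst_word om vs)}"
      "set vs \<subseteq> {v. set v \<subseteq> {..sum_list (subst_word om vs)} \<and> length v \<le> length (subst_word om vs)}"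
      using Cons by auto
    moreover from this(1) have "Suc (length om) \<le> length v + length (subst_word om vs)"
      using v by (cases v) auto
    ultimately show ?case
      using le elem by (auto simp del: subst_word_simps simp: subset_iff trans_le_add2 trans_le_add1)
  qed simp
  with assms show "length om \<le> length w" "length vs \<le> length w" "set om \<subseteq> {..sum_list w}"
    "set vs \<subseteq> {v. set v \<subseteq> {..sum_list w} \<and> length v \<le> length w}"
    by (auto simp: word_fib_def)
qed

lemma finite_word_fib:
  assumes "\<forall>k\<in>set om. 0 < k"
  shows "finite (word_fib om w)"
proof (rule finite_subset)
  show "word_fib om w \<subseteq>
      {vs. set vs \<subseteq> {v. set v \<subseteq> {..sum_list w} \<and> length v \<le> length w} \<and> length vs \<le> length w}"
    using word_fib_bounds assms by blast
qed (intro finite_lists_length_le finite_atMost)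

lemma finite_decomp: "finite (decomp w)"
proof (rule finite_subset)
  let ?B = "\<lambda>A. {xs. set xs \<subseteq> A \<and> length xs \<le> length w}"
  show "decomp w \<subseteq> ?B {..sum_list w} \<times> ?B (?B {..sum_list w})"
  proof (rule subrelI)
    fix om vs assume "(om, vs) \<in> decomp w"
    then have "vs \<in> word_fib om w" "\<forall>k\<in>set om. 0 < k"
      by (auto simp: decomp_def Words_def)
    then show "(om, vs) \<in> ?B {..sum_list w} \<times> ?B (?B {..sum_list w})"
      using word_fib_bounds[of vs om w] by simp
  qed
qed (intro finite_cartesian_product finite_lists_length_le finite_atMost)

text \<open>Multiplication by a positive \<open>k\<close> is injective on words, so at most one word
  contributes and \<open>Sum_any\<close> does not fall back to the value 0 that it takes on infinite
  supports.\<close>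

lemma rescale_eq:
  assumes "0 < k" "F \<in> series"
  shows "rescale k F u = (\<Sum>v | v \<in> Words \<and> map ((*) k) v = u. F v)"
    and "finite {v. v \<in> Words \<and> map ((*) k) v = u}"
proof -
  have inj: "inj (map ((*) k))"
    using assms by (intro inj_mapI) (simp add: inj_def)
  show fin: "finite {v. v \<in> Words \<and> map ((*) k) v = u}"
    by (rule finite_subset[OF _ finite_vimageI[OF _ inj, of "{u}"]]) auto
  have "rescale k F u = (\<Sum>v | v \<in> Words \<and> map ((*) k) v = u. if map ((*) k) v = u then F v else 0)"
    unfolding rescale_def using assms fin
    by (intro Sum_any.expand_superset) (auto simp: series_def)
  then show "rescale k F u = (\<Sum>v | v \<in> Words \<and> map ((*) k) v = u. F v)"
    by simp
qed

text \<open>Induction on the root word: a cut position in \<open>nc_times\<close> separates the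
  block of the first root letter from the rest of \<open>w\<close>.\<close>

lemma foldr_rescale:
  assumes F: "F \<in> series" and "\<forall>k\<in>set om. 0 < k"
  shows "foldr nc_times (map (\<lambda>k. rescale k F) om) nc_one w =
    (\<Sum>vs\<in>word_fib om w. prod_list (map F vs))"
  using assms(2)
proof (induction om arbitrary: w)
  case Nil
  have "word_fib [] w = (if w = [] then {[]} else {})"
    by (auto simp: word_fib_def)
  then show ?case by (simp add: nc_one_def)
next
  case (Cons k om)
  let ?V = "\<lambda>i. {v. v \<in> Words \<and> map ((*) k) v = take i w}"
  let ?S = "SIGMA i:{..length w}. ?V i \<times> word_fib om (drop i w)"
  have k: "0 < k" and om: "\<forall>k\<in>set om. 0 < k" using Cons.prems by auto
  have "foldr nc_times (map (\<lambda>k. rescale k F) (k # om)) nc_one w =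
      (\<Sum>i\<le>length w. (\<Sum>v\<in>?V i. F v) * (\<Sum>vs\<in>word_fib om (drop i w). prod_list (map F vs)))"
    by (simp add: nc_times_def[of "rescale k F"] Cons.IH[OF om] rescale_eq(1)[OF k F])
  also have "\<dots> = (\<Sum>i\<le>length w. \<Sum>(v, vs)\<in>?V i \<times> word_fib om (drop i w). F v * prod_list (map F vs))"
    by (simp add: sum_product sum.cartesian_product)
  also have "\<dots> = (\<Sum>(i, v, vs)\<in>?S. F v * prod_list (map F vs))"
    by (subst sum.Sigma)
       (auto intro!: rescale_eq(2)[OF k F] finite_cartesian_product finite_word_fib[OF om])
  \<comment> \<open>The cut position is no extra datum: scaling preserves length, so it is the
    length of the first word.\<close>
  also have "\<dots> = (\<Sum>vs\<in>word_fib (k # om) w. prod_list (map F vs))"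
    by (rule sum.reindex_bij_witness[where i = "\<lambda>vs. (length (hd vs), hd vs, tl vs)"
          and j = "\<lambda>(i, v, vs). v # vs"])
       (auto simp: word_fib_def Suc_length_conv length_Suc_conv dest: arg_cong[of _ _ length])
  finally show ?case .
qed

lemma pleth_eq:
  assumes "F \<in> series" "G \<in> series"
  shows "pleth G F w = (\<Sum>(om, vs)\<in>decomp w. G om * prod_list (map F vs))"
proof -
  let ?g = "\<lambda>om. G om * foldr nc_times (map (\<lambda>k. rescale k F) om) nc_one w"
  have g: "?g om = (\<Sum>vs\<in>word_fib om w. G om * prod_list (map F vs))" if "om \<in> Words" for om
    using that assms by (simp add: foldr_rescale sum_distrib_left Words_def)
  have "pleth G F w = (\<Sum>om\<in>fst ` decomp w. ?g om)"
    unfolding pleth_def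
  proof (rule Sum_any.expand_superset)
    show "{om. ?g om \<noteq> 0} \<subseteq> fst ` decomp w"
    proof clarify
      fix om assume nz: "?g om \<noteq> 0"
      then have om: "om \<in> Words" using assms by (auto simp: series_def)
      with nz have "word_fib om w \<noteq> {}" by (auto simp: g)
      with om show "om \<in> fst ` decomp w" by (force simp: decomp_def)
    qed
  qed (simp add: finite_decomp)
  also have "\<dots> = (\<Sum>om\<in>fst ` decomp w. \<Sum>vs\<in>word_fib om w. G om * prod_list (map F vs))"
    by (intro sum.cong) (auto simp: g decomp_def)
  also have "\<dots> = (\<Sum>(om, vs)\<in>(SIGMA om:fst ` decomp w. word_fib om w). G om * prod_list (map F vs))"
    by (rule sum.Sigma)
       (auto simp: decomp_def Words_def intro!: finite_word_fib finite_imageI finite_decomp[unfolded decomp_def Words_def])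
  also have "(SIGMA om:fst ` decomp w. word_fib om w) = decomp w"
    by (force simp: decomp_def)
  finally show ?thesis .
qed

text \<open>The first tensor factor is evaluated at the inner series \<open>F\<close>: the upper
  words stand on the left, and the root word, which names a coefficient of \<open>G\<close>, on the
  right.\<close>

definition decomp_tens :: "nat list \<times> nat list list \<Rightarrow> (monomial \<times> monomial \<Rightarrow>\<^sub>0 rat)" where
  "decomp_tens = (\<lambda>(om, vs). basis_elt (mon vs, Poly_Mapping.single om 1))"

text \<open>By \<open>pleth_eq\<close> the sum has the required values, and by
  \<open>eval_tens_inj\<close> nothing else does, so the definite description is settled.\<close>

lemma pleth_comult_gen_eq: "pleth_comult_gen w = (\<Sum>y\<in>decomp w. decomp_tens y)"
  unfolding pleth_comult_gen_def
proof (rule the_equality)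
  let ?t = "\<Sum>y\<in>decomp w. decomp_tens y"
  have keys: "Poly_Mapping.keys ?t \<subseteq> monomials \<times> monomials"
    by (rule order.trans[OF keys_sum])
       (auto simp: decomp_tens_def decomp_def word_fib_def monomials_def split_def)
  have eval: "eval_tens ?t F G = pleth G F w" if "F \<in> series" "G \<in> series" for F G
    using that by (simp add: eval_tens_eq wsum_sum pleth_eq decomp_tens_def split_def
        mon_prod_single[unfolded One_nat_def] mult.commute)
  show "Poly_Mapping.keys ?t \<subseteq> monomials \<times> monomials \<and>
      (\<forall>F\<in>series. \<forall>G\<in>series. eval_tens ?t F G = pleth G F w)"
    using keys eval by blast
  show "t = ?t"
    if "Poly_Mapping.keys t \<subseteq> monomials \<times> monomials \<and>
      (\<forall>F\<in>series. \<forall>G\<in>series. eval_tens t F G = pleth G F w)" for t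
    using that keys eval by (intro eval_tens_inj) auto
qed

section \<open>Expansion of the comultiplication of a monomial\<close>

lemma listset_Cons: "listset (A # As) = (\<lambda>(x, xs). x # xs) ` (A \<times> listset As)"
  by (auto simp: set_Cons_def)

lemma finite_listset: "(\<And>A. A \<in> set As \<Longrightarrow> finite A) \<Longrightarrow> finite (listset As)"
  by (induction As) (auto simp: listset_Cons simp del: listset.simps(2))

text \<open>Distributivity: expanding the product means choosing one summand per factor, and
  \<open>listset\<close> is the set of these choices.\<close>

lemma prod_list_sum:
  fixes f :: "'b \<Rightarrow> 'a::comm_semiring_1"
  assumes "\<And>w. finite (A w)"
  shows "(\<Prod>w\<leftarrow>ws. \<Sum>y\<in>A w. f y) = (\<Sum>ys\<in>listset (map A ws). prod_list (map f ys))"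
proof (induction ws)
  case (Cons w ws)
  have "(\<Sum>ys\<in>listset (map A (w # ws)). prod_list (map f ys)) =
      (\<Sum>(y, ys)\<in>A w \<times> listset (map A ws). f y * prod_list (map f ys))"
    unfolding list.map(2) listset_Cons
    by (subst sum.reindex) (auto simp: inj_on_def split_def)
  with Cons show ?case
    by (simp add: sum_product sum.cartesian_product)
qed simp

definition word_comult :: "monomial \<Rightarrow> (monomial \<times> monomial \<Rightarrow>\<^sub>0 rat)" where
  "word_comult = mon_prod pleth_comult_gen"

lemma prod_list_decomp_tens:
  "prod_list (map decomp_tens ys) = basis_elt (mon (concat (map snd ys)), mon (map fst ys))"
proof (induction ys)
  case Nil
  show ?case by (simp flip: zero_prod_def single_one)
next
  case (Cons y ys)
  then show ?case by (simp add: decomp_tens_def split_def mult_single)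
qed

text \<open>The sum runs over lists of two-level trees, one tree for each word of \<open>ws\<close>.
  The same lists describe the part of the second bar level that composes to \<open>ws\<close>; this
  is where the two bialgebras meet.\<close>

lemma word_comult_mon:
  "word_comult (mon ws) = (\<Sum>ys\<in>listset (map decomp ws).
     basis_elt (mon (concat (map snd ys)), mon (map fst ys)))"
  by (simp add: word_comult_def pleth_comult_gen_eq[abs_def] prod_list_sum finite_decomp
      prod_list_decomp_tens del: single_one)

lemma word_comult_add [simp]: "word_comult (m + n) = word_comult m * word_comult n"
  by (simp add: word_comult_def)

lemma word_comult_zero [simp]: "word_comult 0 = 1"
  by (simp add: word_comult_def)

lemma word_comult_zero_pair: "word_comult 0 = basis_elt (0, 0)"
  by (simp flip: zero_prod_def)

lemma word_comult_single [simp]: "word_comult (Poly_Mapping.single w 1) = (\<Sum>y\<in>decomp w. decomp_tens y)"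
  unfolding word_comult_def mon_prod_single by (rule pleth_comult_gen_eq)


section \<open>The plethystic bialgebra\<close>

text \<open>Validity of a two-level tree without reference to its composite; these pairs will
  parametrise the second level of the bar construction.\<close>

definition decomp_pair :: "nat list \<times> nat list list \<Rightarrow> bool" where
  "decomp_pair y \<longleftrightarrow> fst y \<in> Words \<and> set (snd y) \<subseteq> Words \<and> length (snd y) = length (fst y)"

lemma in_decomp_iff: "y \<in> decomp w \<longleftrightarrow> decomp_pair y \<and> case_prod subst_word y = w"
  by (cases y) (auto simp: decomp_def word_fib_def decomp_pair_def)

lemma in_listset_decomp:
  "ys \<in> listset (map decomp vs) \<longleftrightarrow> (\<forall>y\<in>set ys. decomp_pair y) \<and> map (case_prod subst_word) ys = vs"
proof (induction ys arbitrary: vs)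
  case Nil
  show ?case by (cases vs) (auto simp: set_Cons_def)
next
  case (Cons y ys)
  show ?case using Cons[of "tl vs"] by (cases vs; cases y) (auto simp: set_Cons_def in_decomp_iff)
qed

lemma decomp_pair_Words: "decomp_pair y \<Longrightarrow> case_prod subst_word y \<in> Words"
  using subst_word_Words by (auto simp: decomp_pair_def word_fib_def split_def)

text \<open>A root letter multiplies the composite of the levels above it, which commutes with
  grafting by \<open>subst_word_map\<close>; matching lengths inside each pair let the grafting
  split along blocks.\<close>

lemma subst_word_assoc:
  assumes "\<forall>y\<in>set ys. decomp_pair y"
  shows "subst_word t (map (case_prod subst_word) ys) =
    subst_word (subst_word t (map fst ys)) (concat (map snd ys))"
  using assms
proof (induction ys arbitrary: t)
  case (Cons y ys)
  obtain u s where [simp]: "y = (u, s)" by fastforce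
  show ?case using Cons
    by (cases t) (simp_all add: subst_word_append subst_word_map decomp_pair_def)
qed simp

lemma length_subst_word:
  "length t = length vs \<Longrightarrow> length (subst_word t vs) = sum_list (map length vs)"
  by (induction t vs rule: list_induct2) auto

text \<open>Regrouping a three-level tree forgets the blocks of its top level. Cutting along known
  lengths restores them, uniquely by \<open>concat_eq_lengths\<close>.\<close>

lemma split_list_lengths:
  "length ss = sum_list ns \<Longrightarrow> \<exists>sss. map length sss = ns \<and> concat sss = ss"
proof (induction ns arbitrary: ss)
  case (Cons n ns)
  have "length (drop n ss) = sum_list ns" using Cons.prems by simp
  then obtain sss where "map length sss = ns" "concat sss = drop n ss"
    using Cons.IH by blast
  then show ?case using Cons.prems by (intro exI[of _ "take n ss # sss"]) simp
qed simp

lemma concat_eq_lengths: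
  "map length xss = map length yss \<Longrightarrow> concat xss = concat yss \<Longrightarrow> xss = yss"
proof (induction xss arbitrary: yss)
  case (Cons xs xss)
  then show ?case by (cases yss) auto
qed simp

text \<open>
  Both sides of the coassociativity law for a letter run over three-level trees: a root word \<open>t\<close>, words
  \<open>us\<close> above it, and words above those.  The bijection regroups such a tree by associativity of
  composition.
\<close>

lemma bij_betw_three_level:
  "bij_betw (\<lambda>((t, vs), ys). ((subst_word t (map fst ys), concat (map snd ys)), (t, map fst ys)))
     (SIGMA y:decomp w. listset (map decomp (snd y)))
     (SIGMA y:decomp w. decomp (fst y))"
  (is "bij_betw ?f ?L ?R")
proof -
  \<comment> \<open>The component \<open>vs\<close> is redundant, being the list of composites of
    \<open>ys\<close>; eliminating it leaves plain conditions on \<open>t\<close> and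
    \<open>ys\<close>.\<close>
  have mem_L: "((t, vs), ys) \<in> ?L \<longleftrightarrow> t \<in> Words \<and> length ys = length t \<and>
      (\<forall>y\<in>set ys. decomp_pair y) \<and> vs = map (case_prod subst_word) ys \<and> subst_word t vs = w" for t vs ys
  proof -
    have "set (map (case_prod subst_word) ys) \<subseteq> Words" if "\<forall>y\<in>set ys. decomp_pair y"
      using that decomp_pair_Words by (simp add: image_subset_iff)
    moreover have "decomp_pair (t, vs) \<longleftrightarrow> t \<in> Words \<and> set vs \<subseteq> Words \<and> length vs = length t"
      by (simp add: decomp_pair_def)
    ultimately show ?thesis
      unfolding mem_Sigma_iff in_listset_decomp in_decomp_iff snd_conv prod.case by (metis length_map)
  qed
  have lengths: "map length (map snd ys) = map length (map fst ys)" if "\<forall>y\<in>set ys. decomp_pair y" for ys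
    using that by (auto simp: decomp_pair_def)
  have "inj_on ?f ?L"
  proof (rule inj_onI)
    fix x x' assume mem: "x \<in> ?L" "x' \<in> ?L" and eq: "?f x = ?f x'"
    obtain t vs ys t' vs' ys' where x: "x = ((t, vs), ys)" "x' = ((t', vs'), ys')"
      by (metis surj_pair)
    note L = mem[unfolded x]
    from eq x have t: "t = t'" and us: "map fst ys = map fst ys'"
      and ss: "concat (map snd ys) = concat (map snd ys')"
      by auto
    have valid: "\<forall>y\<in>set ys. decomp_pair y" "\<forall>y\<in>set ys'. decomp_pair y"
      using L unfolding mem_L by blast+
    \<comment> \<open>Block lengths are those of the middle words, so the flattened top level
      determines its blocks.\<close>
    have "map snd ys = map snd ys'"
      by (rule concat_eq_lengths) (simp_all only: lengths[OF valid(1)] lengths[OF valid(2)] us ss)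
    with us have "ys = ys'"
      by (rule pair_list_eqI)
    with t L show "x = x'"
      unfolding x mem_L by simp
  qed
  moreover have "?f ` ?L = ?R"
  proof (intro equalityI subsetI)
    fix r assume "r \<in> ?f ` ?L"
    then obtain x where x: "r = ?f x" "x \<in> ?L" by blast
    obtain t vs ys where xs: "x = ((t, vs), ys)"
      by (metis surj_pair)
    note r = x(1)[unfolded xs]
    from x(2) have t: "t \<in> Words" "length ys = length t" and ys: "\<forall>y\<in>set ys. decomp_pair y"
      and w: "subst_word t (map (case_prod subst_word) ys) = w"
      unfolding xs mem_L by auto
    have fst: "set (map fst ys) \<subseteq> Words" and snd: "set (concat (map snd ys)) \<subseteq> Words"
      using ys by (fastforce simp: decomp_pair_def)+
    have "length (concat (map snd ys)) = length (subst_word t (map fst ys))"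
      using arg_cong[OF lengths[OF ys], of sum_list] t by (simp add: length_subst_word length_concat)
    moreover have "subst_word t (map fst ys) \<in> Words"
      using decomp_pair_Words[of "(t, map fst ys)"] t fst by (simp add: decomp_pair_def)
    ultimately show "r \<in> ?R"
      using t fst snd w by (simp add: r in_decomp_iff decomp_pair_def flip: subst_word_assoc[OF ys])
  next
    fix r assume "r \<in> ?R"
    then obtain om ss t us where r: "r = ((om, ss), (t, us))"
      and ss: "decomp_pair (om, ss)" "subst_word om ss = w"
      and us: "decomp_pair (t, us)" "subst_word t us = om"
      by (auto simp: in_decomp_iff)
    \<comment> \<open>The word \<open>om\<close> has one letter for each letter of the words in
      \<open>us\<close>, so \<open>ss\<close> can be distributed over \<open>us\<close>.\<close>
    have "length ss = sum_list (map length us)"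
      using ss us by (auto simp: decomp_pair_def length_subst_word)
    then obtain sss where sss: "map length sss = map length us" "concat sss = ss"
      using split_list_lengths by blast
    from sss(1) have len: "length sss = length us" by (rule map_eq_imp_length_eq)
    define ys where "ys = zip us sss"
    have ys_maps: "map fst ys = us" "map snd ys = sss"
      using len by (simp_all add: ys_def)
    have "decomp_pair y" if y: "y \<in> set ys" for y
    proof -
      obtain i where i: "i < length us" "y = (us ! i, sss ! i)"
        using y len by (auto simp: ys_def in_set_zip prod_eq_iff)
      have "us ! i \<in> Words" using us i by (auto simp: decomp_pair_def)
      moreover have "set (sss ! i) \<subseteq> set (concat sss)" using i len by (auto intro!: bexI[of _ "sss ! i"])
      moreover have "length (sss ! i) = length (us ! i)"
        using arg_cong[OF sss(1), of "\<lambda>l. l ! i"] i len by simp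
      ultimately show ?thesis using i ss sss by (auto simp: decomp_pair_def)
    qed
    then have valid: "\<forall>y\<in>set ys. decomp_pair y" by blast
    have "((t, map (case_prod subst_word) ys), ys) \<in> ?L"
      unfolding mem_L using us valid subst_word_assoc[OF valid, of t] ys_maps sss ss len
      by (auto simp: decomp_pair_def ys_def)
    then show "r \<in> ?f ` ?L"
      by (rule rev_image_eqI) (use ys_maps sss us r in simp)
  qed
  ultimately show ?thesis by (simp add: bij_betw_def)
qed

text \<open>Both sides are multiplicative, so a generator suffices; there both sums run over
  three-level trees, and \<open>bij_betw_three_level\<close> matches the terms.\<close>

lemma word_comult_coassoc:
  "lin (\<lambda>(x, y). lin (\<lambda>(u, v). basis_elt (u, v, y)) (word_comult x)) (word_comult m) =
   lin (\<lambda>(x, y). lin (\<lambda>(u, v). basis_elt (x, u, v)) (word_comult y)) (word_comult m)"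
  (is "lin ?l _ = lin ?r _")
proof -
  \<comment> \<open>Writing the untouched tensor factor as multiplication by a basis element places
    everything in the commutative ring over triples, where multiplicativity can be read off.\<close>
  have l: "?l p = lin (\<lambda>(u, v). basis_elt (u, v, 0)) (word_comult (fst p)) * basis_elt (0, 0, snd p)"
    and r: "?r p = lin (\<lambda>(u, v). basis_elt (0, u, v)) (word_comult (snd p)) * basis_elt (fst p, 0, 0)" for p
    by (simp_all add: times_eq_lin[of "lin _ _"] lin_lin split_def plus_prod_def)
  have l_mult: "?l (p + q) = ?l p * ?l q" for p q
  proof -
    have "lin (\<lambda>(u, v). basis_elt (u, v, 0::monomial)) (word_comult (fst p + fst q)) =
        lin (\<lambda>(u, v). basis_elt (u, v, 0)) (word_comult (fst p)) *
        lin (\<lambda>(u, v). basis_elt (u, v, 0)) (word_comult (fst q))"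
      unfolding word_comult_add by (rule lin_mult) (simp add: split_def mult_single)
    moreover have "basis_elt (0::monomial, 0::monomial, snd (p + q)) =
        basis_elt (0, 0, snd p) * basis_elt (0, 0, snd q)"
      by (simp add: mult_single)
    ultimately show ?thesis unfolding l by (simp add: mult_ac)
  qed
  have r_mult: "?r (p + q) = ?r p * ?r q" for p q
  proof -
    have "lin (\<lambda>(u, v). basis_elt (0::monomial, u, v)) (word_comult (snd p + snd q)) =
        lin (\<lambda>(u, v). basis_elt (0, u, v)) (word_comult (snd p)) *
        lin (\<lambda>(u, v). basis_elt (0, u, v)) (word_comult (snd q))"
      unfolding word_comult_add by (rule lin_mult) (simp add: split_def mult_single)
    moreover have "basis_elt (fst (p + q), 0::monomial, 0::monomial) =
        basis_elt (fst p, 0, 0) * basis_elt (fst q, 0, 0)"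
      by (simp add: mult_single)
    ultimately show ?thesis unfolding r by (simp add: mult_ac)
  qed
  obtain ws where m: "m = mon ws" using ex_mon by metis
  show ?thesis unfolding m
  proof (induction ws)
    case Nil
    show ?case by (simp add: word_comult_zero_pair del: word_comult_zero)
  next
    case (Cons w ws)
    have fin: "finite (listset (map decomp vs))" for vs
      by (rule finite_listset) (auto simp: finite_decomp)
    have "lin ?l (\<Sum>y\<in>decomp w. decomp_tens y) =
        (\<Sum>(y, ys)\<in>(SIGMA y:decomp w. listset (map decomp (snd y))).
          basis_elt (mon (concat (map snd ys)), mon (map fst ys), Poly_Mapping.single (fst y) 1))"
      using fin
      by (subst sum.Sigma[symmetric])
         (simp_all add: finite_decomp lin_sum decomp_tens_def split_def word_comult_mon)
    also have "\<dots> = (\<Sum>(y, z)\<in>(SIGMA y:decomp w. decomp (fst y)).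
          basis_elt (mon (snd y), mon (snd z), Poly_Mapping.single (fst z) 1))"
      using sum.reindex_bij_betw[OF bij_betw_three_level[of w], of "\<lambda>(y, z).
          basis_elt (mon (snd y), mon (snd z), Poly_Mapping.single (fst z) 1)"]
      by (simp add: split_def del: One_nat_def)
    also have "\<dots> = lin ?r (\<Sum>y\<in>decomp w. decomp_tens y)"
      by (subst sum.Sigma[symmetric])
         (simp_all add: finite_decomp lin_sum decomp_tens_def split_def word_comult_single[unfolded One_nat_def])
    finally show ?case
      by (simp only: mon_simps word_comult_add word_comult_single Cons
          lin_mult[of _ _ ?l, OF l_mult] lin_mult[of _ _ ?r, OF r_mult])
  qed
qed

section \<open>The counit laws\<close>

lemma eval_mon_nc_var_mon:
  "eval_mon (mon vs) (nc_var 1) = (if set vs \<subseteq> {[1]} then 1 else 0)"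
  by (induction vs) (auto simp: eval_mon_eq nc_var_def mon_prod_single[unfolded One_nat_def])

lemma subst_word_units [simp]: "subst_word om (replicate (length om) [1]) = om"
  by (induction om) simp_all

text \<open>The counit kills every generator but that of the word [1]. Only the decomposition of
  \<open>w\<close> with all upper words equal to [1] survives, and its root is \<open>w\<close>
  itself.\<close>

lemma word_comult_counit_left:
  assumes "m \<in> monomials"
  shows "lin (\<lambda>(x, y). scale (eval_mon x (nc_var 1)) (basis_elt y)) (word_comult m) = basis_elt m"
    (is "lin ?e _ = _")
proof -
  have e_mult: "?e (p + q) = ?e p * ?e q" for p q
    by (simp add: split_def eval_mon_eq mult_single)
  obtain ws where m: "m = mon ws" using ex_mon by metis
  with assms have "set ws \<subseteq> Words" by (simp add: monomials_def)
  then show ?thesis unfolding m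
  proof (induction ws)
    case Nil
    show ?case by (simp add: word_comult_zero_pair eval_mon_eq del: word_comult_zero)
  next
    case (Cons w ws)
    have "(om, vs) = (w, replicate (length w) [1])"
      if "(om, vs) \<in> decomp w" "set vs \<subseteq> {[1]}" for om vs
    proof -
      have "vs = replicate (length om) [1]"
        using that by (intro replicate_eqI) (auto simp: decomp_def word_fib_def)
      with that show ?thesis
        using subst_word_units[of om] by (auto simp: decomp_def word_fib_def)
    qed
    then have "lin ?e (decomp_tens y) = 0"
      if "y \<in> decomp w - {(w, replicate (length w) [1])}" for y
      using that by (cases y) (auto simp: decomp_tens_def eval_mon_nc_var_mon simp del: One_nat_def)
    moreover have "(w, replicate (length w) [1]) \<in> decomp w"
      using Cons.prems by (auto simp: in_decomp_iff decomp_pair_def Words_def simp del: One_nat_def)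
    ultimately have "lin ?e (\<Sum>y\<in>decomp w. decomp_tens y) =
        (\<Sum>y\<in>{(w, replicate (length w) [1])}. lin ?e (decomp_tens y))"
      unfolding lin_sum by (intro sum.mono_neutral_right finite_decomp) auto
    also have "\<dots> = basis_elt (Poly_Mapping.single w 1)"
      by (auto simp add: decomp_tens_def eval_mon_nc_var_mon simp del: One_nat_def)
    finally have "lin ?e (\<Sum>y\<in>decomp w. decomp_tens y) = basis_elt (Poly_Mapping.single w 1)" .
    moreover have "lin ?e (word_comult (mon ws)) = basis_elt (mon ws)"
      using Cons by simp
    ultimately show ?case
      by (simp only: mon_simps word_comult_add word_comult_single lin_mult[of _ _ ?e, OF e_mult]
          mult_single mult_1)
  qed
qed

text \<open>Here the root must be [1], and the single word grafted onto it is then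
  \<open>w\<close>.\<close>

lemma word_comult_counit_right:
  assumes "m \<in> monomials"
  shows "lin (\<lambda>(x, y). scale (eval_mon y (nc_var 1)) (basis_elt x)) (word_comult m) = basis_elt m"
    (is "lin ?e _ = _")
proof -
  have e_mult: "?e (p + q) = ?e p * ?e q" for p q
    by (simp add: split_def eval_mon_eq mult_single)
  obtain ws where m: "m = mon ws" using ex_mon by metis
  with assms have "set ws \<subseteq> Words" by (simp add: monomials_def)
  then show ?thesis unfolding m
  proof (induction ws)
    case Nil
    show ?case by (simp add: word_comult_zero_pair eval_mon_eq del: word_comult_zero)
  next
    case (Cons w ws)
    have eval: "eval_mon (Poly_Mapping.single om 1) (nc_var 1) = (if om = [1] then 1 else 0)" for om
      using eval_mon_nc_var_mon[of "[om]"] by simp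
    have "(om, vs) = ([1], [w])" if "(om, vs) \<in> decomp w" "om = [1]" for om vs
      using that by (cases vs) (auto simp: decomp_def word_fib_def map_idI)
    then have "lin ?e (decomp_tens y) = 0" if "y \<in> decomp w - {([1], [w])}" for y
      using that by (cases y) (auto simp: decomp_tens_def eval simp del: One_nat_def)
    moreover have "([1], [w]) \<in> decomp w"
      using Cons.prems by (auto simp: in_decomp_iff decomp_pair_def Words_def map_idI)
    ultimately have "lin ?e (\<Sum>y\<in>decomp w. decomp_tens y) = (\<Sum>y\<in>{([1], [w])}. lin ?e (decomp_tens y))"
      unfolding lin_sum by (intro sum.mono_neutral_right finite_decomp) auto
    also have "\<dots> = basis_elt (Poly_Mapping.single w 1)"
      by (simp add: decomp_tens_def eval del: One_nat_def)
    finally have "lin ?e (\<Sum>y\<in>decomp w. decomp_tens y) = basis_elt (Poly_Mapping.single w 1)" .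
    moreover have "lin ?e (word_comult (mon ws)) = basis_elt (mon ws)"
      using Cons by simp
    ultimately show ?case
      by (simp only: mon_simps word_comult_add word_comult_single lin_mult[of _ _ ?e, OF e_mult]
          mult_single mult_1)
  qed
qed

lemma keys_word_comult: "Poly_Mapping.keys (word_comult m) \<subseteq> monomials \<times> monomials"
proof -
  obtain ws where m: "m = mon ws" using ex_mon by metis
  show ?thesis
    unfolding m word_comult_mon
  proof (rule order.trans[OF keys_sum UN_least])
    fix ys assume "ys \<in> listset (map decomp ws)"
    then have "set (map fst ys) \<subseteq> Words" "set (concat (map snd ys)) \<subseteq> Words"
      unfolding in_listset_decomp decomp_pair_def by fastforce+
    then show "Poly_Mapping.keys (basis_elt (mon (concat (map snd ys)), mon (map fst ys)))
        \<subseteq> monomials \<times> monomials"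
      unfolding monomials_def by simp
  qed
qed

lemma plethystic_bialgebra_simps [simp]:
  "basis plethystic_bialgebra = monomials"
  "bialg.mult plethystic_bialgebra = (\<lambda>m n. basis_elt (m + n))"
  "unit_elt plethystic_bialgebra = 1"
  "comult plethystic_bialgebra = word_comult"
  "counit plethystic_bialgebra = (\<lambda>m. eval_mon m (nc_var 1))"
  by (simp_all add: plethystic_bialgebra_def word_comult_def mon_prod_def[abs_def])

text \<open>The products \<open>mul\<close> and \<open>tens_mul\<close> are ring products of
  polynomials, so the algebra laws are ring laws, and compatibility says that the linear extensions
  of \<open>word_comult\<close> and of the counit are multiplicative.\<close>

lemma bialgebra_plethystic: "bialgebra plethystic_bialgebra"
proof -
  let ?A = plethystic_bialgebra
  have mul: "mul ?A p q = p * q" for p q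
    by (simp add: mul_eq_lin times_eq_lin)
  have tens_mul: "tens_mul ?A s t = s * t" for s t
    by (simp add: tens_mul_eq_lin times_eq_lin split_def plus_prod_def)
  have comul_mult: "comul ?A (p * q) = comul ?A p * comul ?A q" for p q
    unfolding comul_def by (rule lin_mult) simp
  have space: "p \<in> space ?A \<longleftrightarrow> Poly_Mapping.keys p \<subseteq> monomials" for p
    by (simp add: space_def)
  show ?thesis
    unfolding bialgebra_def mul tens_mul
  proof (intro conjI ballI)
    show "unit_elt ?A \<in> space ?A"
      by (simp add: space monomials_def)
    show "comul ?A (unit_elt ?A) = tens (unit_elt ?A) (unit_elt ?A)"
      by (simp add: comul_def flip: single_one) (simp flip: zero_prod_def)
    show "coun ?A (unit_elt ?A) = 1"
      by (simp add: coun_eq_wsum eval_mon_eq flip: single_one)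
  next
    fix p assume p: "p \<in> space ?A"
    show "Poly_Mapping.keys (comul ?A p) \<subseteq> basis ?A \<times> basis ?A"
      unfolding comul_def by (rule order.trans[OF keys_lin]) (use keys_word_comult in auto)
    show "unit_elt ?A * p = p" "p * unit_elt ?A = p" by simp_all
    show "lin (\<lambda>(x, y). lin (\<lambda>(u, v). basis_elt (u, v, y)) (comult ?A x)) (comul ?A p) =
        lin (\<lambda>(x, y). lin (\<lambda>(u, v). basis_elt (x, u, v)) (comult ?A y)) (comul ?A p)"
      by (simp add: comul_def lin_lin word_comult_coassoc)
    have "lin (\<lambda>(x, y). scale (counit ?A x) (basis_elt y)) (comul ?A p) = lin basis_elt p"
      unfolding comul_def lin_lin plethystic_bialgebra_simps
      by (intro lin_cong word_comult_counit_left) (use p space in auto)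
    then show "lin (\<lambda>(x, y). scale (counit ?A x) (basis_elt y)) (comul ?A p) = p"
      by simp
    have "lin (\<lambda>(x, y). scale (counit ?A y) (basis_elt x)) (comul ?A p) = lin basis_elt p"
      unfolding comul_def lin_lin plethystic_bialgebra_simps
      by (intro lin_cong word_comult_counit_right) (use p space in auto)
    then show "lin (\<lambda>(x, y). scale (counit ?A y) (basis_elt x)) (comul ?A p) = p"
      by simp
    fix q assume q: "q \<in> space ?A"
    show "p * q \<in> space ?A"
    proof -
      have "a + b \<in> monomials" if "a \<in> monomials" "b \<in> monomials" for a b
        using that keys_add[of a b] by (auto simp: monomials_def)
      then show ?thesis
        using p q keys_mult[of p q] unfolding space by blast
    qed
    show "comul ?A (p * q) = comul ?A p * comul ?A q" by (rule comul_mult)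
    show "coun ?A (p * q) = coun ?A p * coun ?A q"
      unfolding coun_eq_wsum by (rule wsum_mult) (simp add: eval_mon_eq)
    fix r
    show "p * q * r = p * (q * r)" by (rule mult.assoc)
  qed
qed


section \<open>Groupoids and homotopy fibres\<close>

definition hom :: "('o, 'a) grpd \<Rightarrow> 'o \<Rightarrow> 'o \<Rightarrow> 'a set" where
  "hom G x y = {f \<in> Arr G. Dom G f = x \<and> Cod G f = y}"

text \<open>Outgoing arrows are counted in place of automorphisms: their number is the size of the
  class times the order of the automorphism group, so its inverse is the weight with which a single
  object enters the cardinality.\<close>

definition outs :: "('o, 'a) grpd \<Rightarrow> 'o \<Rightarrow> 'a set" where
  "outs G x = {f \<in> Arr G. Dom G f = x}"

lemma Aut_eq_hom: "Aut G x = hom G x x"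
  by (simp add: Aut_def hom_def)

locale groupoid =
  fixes G :: "('o, 'a) grpd"
  assumes Dom_in [simp]: "f \<in> Arr G \<Longrightarrow> Dom G f \<in> Obj G"
    and Cod_in [simp]: "f \<in> Arr G \<Longrightarrow> Cod G f \<in> Obj G"
    and Idn [simp]: "x \<in> Obj G \<Longrightarrow> Idn G x \<in> Arr G \<and> Dom G (Idn G x) = x \<and> Cod G (Idn G x) = x"
    and Cmp [simp]: "f \<in> Arr G \<Longrightarrow> g \<in> Arr G \<Longrightarrow> Cod G f = Dom G g \<Longrightarrow>
      Cmp G g f \<in> Arr G \<and> Dom G (Cmp G g f) = Dom G f \<and> Cod G (Cmp G g f) = Cod G g"
    and Cmp_assoc: "f \<in> Arr G \<Longrightarrow> g \<in> Arr G \<Longrightarrow> h \<in> Arr G \<Longrightarrow> Cod G f = Dom G g \<Longrightarrow>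
      Cod G g = Dom G h \<Longrightarrow> Cmp G (Cmp G h g) f = Cmp G h (Cmp G g f)"
    and Cmp_Idn [simp]: "f \<in> Arr G \<Longrightarrow> Cmp G f (Idn G (Dom G f)) = f"
    and Idn_Cmp [simp]: "f \<in> Arr G \<Longrightarrow> Cmp G (Idn G (Cod G f)) f = f"
    and ex_inverse: "f \<in> Arr G \<Longrightarrow> \<exists>g\<in>Arr G. Dom G g = Cod G f \<and> Cod G g = Dom G f \<and>
      Cmp G g f = Idn G (Dom G f) \<and> Cmp G f g = Idn G (Cod G f)"
begin

lemma Cmp_Idn' [simp]: "f \<in> Arr G \<Longrightarrow> Dom G f = x \<Longrightarrow> Cmp G f (Idn G x) = f"
  and Idn_Cmp' [simp]: "f \<in> Arr G \<Longrightarrow> Cod G f = x \<Longrightarrow> Cmp G (Idn G x) f = f"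
  by auto

lemma Idn_in_hom: "x \<in> Obj G \<Longrightarrow> Idn G x \<in> hom G x x"
  by (simp add: hom_def)

lemma Cmp_in_hom: "f \<in> hom G x y \<Longrightarrow> g \<in> hom G y z \<Longrightarrow> Cmp G g f \<in> hom G x z"
  by (simp add: hom_def)

lemma hom_sym: "hom G x y \<noteq> {} \<Longrightarrow> hom G y x \<noteq> {}"
  using ex_inverse by (fastforce simp: hom_def)

lemma inj_on_Cmp_left: "g \<in> hom G y z \<Longrightarrow> inj_on (Cmp G g) {f \<in> Arr G. Cod G f = y}"
proof (rule inj_onI)
  fix f f' assume g: "g \<in> hom G y z" and f: "f \<in> {f \<in> Arr G. Cod G f = y}" "f' \<in> {f \<in> Arr G. Cod G f = y}"
    and eq: "Cmp G g f = Cmp G g f'"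
  obtain g' where g': "g' \<in> Arr G" "Dom G g' = Cod G g" "Cmp G g' g = Idn G (Dom G g)"
    using ex_inverse g by (auto simp: hom_def)
  have cancel: "Cmp G g' (Cmp G g h) = h" if "h \<in> Arr G" "Cod G h = y" for h
    using Cmp_assoc[of h g g'] Idn_Cmp[of h] g g' that by (auto simp: hom_def)
  then show "f = f'"
    using f eq by (metis (mono_tags, lifting) mem_Collect_eq)
qed

lemma Cmp_right_cancel:
  assumes "g \<in> Arr G" "h \<in> Arr G" "f \<in> Arr G" "Cod G f = Dom G g" "Cod G f = Dom G h"
    and eq: "Cmp G g f = Cmp G h f"
  shows "g = h"
proof -
  obtain f' where f': "f' \<in> Arr G" "Cod G f' = Dom G f" "Dom G f' = Cod G f" "Cmp G f f' = Idn G (Cod G f)"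
    using ex_inverse assms by blast
  have "Cmp G g (Cmp G f f') = Cmp G h (Cmp G f f')"
    using assms f' by (metis Cmp_assoc)
  with assms f' show ?thesis by (metis Cmp_Idn)
qed

lemma card_hom_eq_source:
  assumes "x \<in> Obj G" "hom G x y \<noteq> {}"
  shows "card (hom G x y) = card (Aut G x)"
proof -
  obtain g where g: "g \<in> hom G x y" using assms by auto
  then obtain g' where g': "g' \<in> hom G y x" "Cmp G g g' = Idn G y"
    using ex_inverse by (fastforce simp: hom_def)
  have "Cmp G g ` hom G x x = hom G x y"
  proof (intro equalityI subsetI)
    fix f assume f: "f \<in> hom G x y"
    then have "f = Cmp G g (Cmp G g' f)"
      using g g' by (metis (mono_tags, lifting) Cmp_assoc Idn_Cmp hom_def mem_Collect_eq)
    with f g' show "f \<in> Cmp G g ` hom G x x"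
      using Cmp_in_hom by blast
  qed (use g Cmp_in_hom in blast)
  moreover have "inj_on (Cmp G g) (hom G x x)"
    by (rule inj_on_subset[OF inj_on_Cmp_left[OF g]]) (auto simp: hom_def)
  ultimately show ?thesis
    by (metis Aut_eq_hom card_image)
qed

lemma hom_trans: "hom G x y \<noteq> {} \<Longrightarrow> hom G y z \<noteq> {} \<Longrightarrow> hom G x z \<noteq> {}"
  using Cmp_in_hom by blast

lemma iso_class_eq: "x \<in> Obj G \<Longrightarrow> iso_class G x = {y \<in> Obj G. hom G x y \<noteq> {}}"
  by (auto simp: iso_class_def hom_def)

lemma iso_class_eq_iff:
  assumes "x \<in> Obj G" "y \<in> Obj G"
  shows "iso_class G x = iso_class G y \<longleftrightarrow> hom G x y \<noteq> {}"
proof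
  assume "iso_class G x = iso_class G y"
  moreover have "y \<in> iso_class G y" using assms Idn_in_hom by (auto simp: iso_class_eq)
  ultimately show "hom G x y \<noteq> {}" using assms by (auto simp: iso_class_eq)
next
  assume "hom G x y \<noteq> {}"
  then have "hom G x z \<noteq> {} \<longleftrightarrow> hom G y z \<noteq> {}" for z
    using hom_trans hom_sym by metis
  then show "iso_class G x = iso_class G y"
    by (simp add: iso_class_eq assms)
qed

text \<open>Conjugation by an arrow, in both directions. Finiteness is transferred separately, since
  \<open>card\<close> is 0 on infinite sets and an injection bounds it only for a finite
  target.\<close>

lemma card_Aut_eq:
  assumes "x \<in> Obj G" "y \<in> Obj G" "hom G x y \<noteq> {}"
  shows "card (Aut G x) = card (Aut G y)"
proof -
  obtain g where g: "g \<in> hom G x y" using assms by auto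
  then obtain g' where g': "g' \<in> hom G y x" "Cmp G g' g = Idn G x" "Cmp G g g' = Idn G y"
    using ex_inverse by (fastforce simp: hom_def)
  have le: "card (hom G a a) \<le> card (hom G b b)"
    if "g \<in> hom G a b" "g' \<in> hom G b a" "finite (hom G b b)" for a b g g'
  proof (rule card_inj_on_le[OF _ _ that(3)])
    show "(\<lambda>f. Cmp G g (Cmp G f g')) ` hom G a a \<subseteq> hom G b b"
      using that Cmp_in_hom by blast
    show "inj_on (\<lambda>f. Cmp G g (Cmp G f g')) (hom G a a)"
    proof (rule inj_onI)
      fix f f' assume f: "f \<in> hom G a a" "f' \<in> hom G a a"
        and eq: "Cmp G g (Cmp G f g') = Cmp G g (Cmp G f' g')"
      have "Cmp G f g' = Cmp G f' g'"
        using inj_onD[OF inj_on_Cmp_left[OF that(1)] eq] f that(2) by (auto simp: hom_def)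
      then show "f = f'"
        using Cmp_right_cancel[of f f' g'] f that(2) by (auto simp: hom_def)
    qed
  qed
  have fin: "finite (hom G b b)" if "finite (hom G a a)" "g \<in> hom G a b" "g' \<in> hom G b a" for a b g g'
  proof (rule inj_on_finite[OF _ _ that(1)])
    show "(\<lambda>f. Cmp G g' (Cmp G f g)) ` hom G b b \<subseteq> hom G a a"
      using that Cmp_in_hom by blast
    show "inj_on (\<lambda>f. Cmp G g' (Cmp G f g)) (hom G b b)"
    proof (rule inj_onI)
      fix f f' assume f: "f \<in> hom G b b" "f' \<in> hom G b b"
        and eq: "Cmp G g' (Cmp G f g) = Cmp G g' (Cmp G f' g)"
      have "Cmp G f g = Cmp G f' g"
        using inj_onD[OF inj_on_Cmp_left[OF that(3)] eq] f that(2) by (auto simp: hom_def)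
      then show "f = f'"
        using Cmp_right_cancel[of f f' g] f that(2) by (auto simp: hom_def)
    qed
  qed
  show ?thesis
    unfolding Aut_eq_hom
    using le[OF g g'(1)] le[OF g'(1) g] fin[OF _ g g'(1)] fin[OF _ g'(1) g]
    by (metis card.infinite le_antisym)
qed

lemma iso_class_eq_image: "x \<in> Obj G \<Longrightarrow> iso_class G x = Cod G ` outs G x"
  by (auto simp: iso_class_def outs_def)

text \<open>Arrows are sorted by target; each object of the class receives as many as
  \<open>x\<close> has automorphisms.\<close>

lemma card_outs:
  assumes "x \<in> Obj G" "finite (outs G x)"
  shows "card (outs G x) = card (iso_class G x) * card (Aut G x)"
proof -
  have fin: "finite (hom G x y)" for y
    by (rule finite_subset[OF _ assms(2)]) (auto simp: hom_def outs_def)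
  have "outs G x = (\<Union>y\<in>iso_class G x. hom G x y)"
    by (auto simp: outs_def hom_def iso_class_def)
  moreover have "card (\<Union>y\<in>iso_class G x. hom G x y) = (\<Sum>y\<in>iso_class G x. card (hom G x y))"
    using assms fin by (intro card_UN_disjoint) (auto simp: iso_class_eq_image hom_def)
  ultimately have "card (outs G x) = (\<Sum>y\<in>iso_class G x. card (hom G x y))"
    by simp
  also have "\<dots> = (\<Sum>y\<in>iso_class G x. card (Aut G x))"
    using assms(1) by (intro sum.cong card_hom_eq_source) (auto simp: iso_class_eq)
  finally show ?thesis by simp
qed

text \<open>A class \<open>c\<close> contributes \<open>card c\<close> equal terms, each the inverse
  of \<open>card c\<close> times the order of the automorphism group; together they give its term in
  \<open>hcard\<close>.\<close>

lemma hcard_eq_sum: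
  assumes fin: "finite (Obj G)" "\<And>x. x \<in> Obj G \<Longrightarrow> finite (outs G x)"
  shows "hfinite G" "hcard G = (\<Sum>x\<in>Obj G. 1 / of_nat (card (outs G x)))"
proof -
  have finAut: "finite (Aut G x)" if "x \<in> Obj G" for x
    by (rule finite_subset[OF _ fin(2)[OF that]]) (auto simp: Aut_def outs_def)
  then show "hfinite G" using fin by (simp add: hfinite_def pi0_def)
  have "(\<Sum>x\<in>Obj G. 1 / of_nat (card (outs G x)) :: rat) =
      (\<Sum>c\<in>pi0 G. \<Sum>x | x \<in> Obj G \<and> iso_class G x = c. 1 / of_nat (card (outs G x)))"
    unfolding pi0_def by (rule sum.image_gen[OF fin(1)])
  also have "\<dots> = (\<Sum>c\<in>pi0 G. 1 / of_nat (card (Aut G (rep c))))"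
  proof (rule sum.cong)
    fix c assume "c \<in> pi0 G"
    then obtain z where z: "z \<in> Obj G" "c = iso_class G z" by (auto simp: pi0_def)
    have c_eq: "{x. x \<in> Obj G \<and> iso_class G x = c} = c"
    proof (intro equalityI subsetI CollectI)
      fix x assume "x \<in> c"
      then have x: "x \<in> Obj G" "hom G z x \<noteq> {}" using z by (auto simp: iso_class_eq)
      with z show "x \<in> Obj G \<and> iso_class G x = c"
        by (metis iso_class_eq_iff)
    next
      fix x assume "x \<in> {x. x \<in> Obj G \<and> iso_class G x = c}"
      with Idn_in_hom[of x] show "x \<in> c" by (auto simp: iso_class_eq)
    qed
    then have "z \<in> c" using z by auto
    then have rep: "rep c \<in> c" unfolding rep_def by (rule someI)
    have c: "x \<in> Obj G" "iso_class G x = c" if "x \<in> c" for x using that c_eq by auto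
    have "finite c" using c fin(1) by (meson finite_subset subsetI)
    with \<open>z \<in> c\<close> have "card c \<noteq> 0" by auto
    have "card (outs G x) = card c * card (Aut G (rep c))" if x: "x \<in> c" for x
      using card_outs[OF c(1)[OF x] fin(2)[OF c(1)[OF x]]] c(2)[OF x] c[OF rep] c(1)[OF x]
        card_Aut_eq[of x "rep c"] iso_class_eq_iff[of x "rep c"] by simp
    then have "(\<Sum>x\<in>c. 1 / of_nat (card (outs G x)) :: rat) =
        (\<Sum>x\<in>c. 1 / (of_nat (card c) * of_nat (card (Aut G (rep c)))))"
      by (intro sum.cong) auto
    also have "\<dots> = 1 / of_nat (card (Aut G (rep c)))"
      using \<open>card c \<noteq> 0\<close> by simp
    finally show "(\<Sum>x | x \<in> Obj G \<and> iso_class G x = c. 1 / of_nat (card (outs G x)) :: rat) =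
        1 / of_nat (card (Aut G (rep c)))"
      unfolding c_eq .
  qed simp
  finally show "hcard G = (\<Sum>x\<in>Obj G. 1 / of_nat (card (outs G x)))"
    by (simp add: hcard_def)
qed

end

section \<open>Functors and the cardinality of homotopy fibres\<close>

locale grpd_functor = A: groupoid A + B: groupoid B
  for A :: "('o, 'a) grpd" and B :: "('p, 'b) grpd" and F :: "('o, 'a, 'p, 'b) ftor" +
  assumes ob_in [simp]: "x \<in> Obj A \<Longrightarrow> ob F x \<in> Obj B"
    and ar_in [simp]: "f \<in> Arr A \<Longrightarrow> ar F f \<in> Arr B \<and> Dom B (ar F f) = ob F (Dom A f) \<and>
      Cod B (ar F f) = ob F (Cod A f)"
    and ar_Cmp: "f \<in> Arr A \<Longrightarrow> g \<in> Arr A \<Longrightarrow> Cod A f = Dom A g \<Longrightarrow>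
      ar F (Cmp A g f) = Cmp B (ar F g) (ar F f)"
begin

text \<open>The image of an identity is idempotent, and in a groupoid an idempotent cancels to an
  identity.\<close>

lemma ar_Idn: "x \<in> Obj A \<Longrightarrow> ar F (Idn A x) = Idn B (ob F x)"
proof -
  assume x: "x \<in> Obj A"
  let ?i = "ar F (Idn A x)"
  have "Cmp B ?i ?i = ?i"
    using x A.Cmp_Idn[of "Idn A x"] ar_Cmp[of "Idn A x" "Idn A x"] by simp
  also have "\<dots> = Cmp B (Idn B (ob F x)) ?i"
    using x B.Idn_Cmp[of ?i] by simp
  finally show ?thesis
    using x B.Cmp_right_cancel[of ?i "Idn B (ob F x)" ?i] by simp
qed

lemma hfib_simps:
  "Obj (hfib A B F b) = {(x, \<beta>). x \<in> Obj A \<and> \<beta> \<in> Arr B \<and> Dom B \<beta> = ob F x \<and> Cod B \<beta> = b}"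
  "Arr (hfib A B F b) = {(\<alpha>, \<beta>'). \<alpha> \<in> Arr A \<and> \<beta>' \<in> Arr B \<and> Dom B \<beta>' = ob F (Cod A \<alpha>) \<and> Cod B \<beta>' = b}"
  "Dom (hfib A B F b) (\<alpha>, \<beta>) = (Dom A \<alpha>, Cmp B \<beta> (ar F \<alpha>))"
  "Cod (hfib A B F b) (\<alpha>, \<beta>) = (Cod A \<alpha>, \<beta>)"
  "Idn (hfib A B F b) (x, \<beta>) = (Idn A x, \<beta>)"
  "Cmp (hfib A B F b) (\<alpha>, \<beta>) (\<alpha>', \<beta>') = (Cmp A \<alpha> \<alpha>', \<beta>)"
  by (simp_all add: hfib_def)

lemma groupoid_hfib: "groupoid (hfib A B F b)"
proof
  let ?H = "hfib A B F b"
  fix f assume "f \<in> Arr ?H"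
  then obtain \<alpha> \<beta> where f: "f = (\<alpha>, \<beta>)" "\<alpha> \<in> Arr A" "\<beta> \<in> Arr B" "Dom B \<beta> = ob F (Cod A \<alpha>)" "Cod B \<beta> = b"
    by (auto simp: hfib_simps)
  then show "Dom ?H f \<in> Obj ?H" "Cod ?H f \<in> Obj ?H"
    by (auto simp: hfib_simps)
  show "Cmp ?H f (Idn ?H (Dom ?H f)) = f" "Cmp ?H (Idn ?H (Cod ?H f)) f = f"
    using f by (auto simp: hfib_simps)
  obtain \<alpha>' where \<alpha>': "\<alpha>' \<in> Arr A" "Dom A \<alpha>' = Cod A \<alpha>" "Cod A \<alpha>' = Dom A \<alpha>"
    "Cmp A \<alpha>' \<alpha> = Idn A (Dom A \<alpha>)" "Cmp A \<alpha> \<alpha>' = Idn A (Cod A \<alpha>)"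
    using A.ex_inverse f by blast
  \<comment> \<open>An arrow is encoded with the label of its target. The inverse of
    \<open>f\<close> therefore carries the label of the source of \<open>f\<close>, and this
    identity says that it starts at the target of \<open>f\<close>.\<close>
  have "Cmp B (Cmp B \<beta> (ar F \<alpha>)) (ar F \<alpha>') = \<beta>"
    using f \<alpha>' B.Cmp_Idn[of \<beta>] by (simp add: B.Cmp_assoc ar_Idn flip: ar_Cmp)
  then show "\<exists>g\<in>Arr ?H. Dom ?H g = Cod ?H f \<and> Cod ?H g = Dom ?H f \<and>
      Cmp ?H g f = Idn ?H (Dom ?H f) \<and> Cmp ?H f g = Idn ?H (Cod ?H f)"
    using f \<alpha>' by (intro bexI[of _ "(\<alpha>', Cmp B \<beta> (ar F \<alpha>))"]) (auto simp: hfib_simps)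
  fix g assume "g \<in> Arr ?H" and fg: "Cod ?H f = Dom ?H g"
  then obtain \<alpha>2 \<beta>2 where g: "g = (\<alpha>2, \<beta>2)" "\<alpha>2 \<in> Arr A" "\<beta>2 \<in> Arr B" "Dom B \<beta>2 = ob F (Cod A \<alpha>2)" "Cod B \<beta>2 = b"
    by (auto simp: hfib_simps)
  with f fg have fg': "Cod A \<alpha> = Dom A \<alpha>2" "\<beta> = Cmp B \<beta>2 (ar F \<alpha>2)"
    by (auto simp: hfib_simps)
  show "Cmp ?H g f \<in> Arr ?H \<and> Dom ?H (Cmp ?H g f) = Dom ?H f \<and> Cod ?H (Cmp ?H g f) = Cod ?H g"
    using f g fg' by (auto simp: hfib_simps ar_Cmp B.Cmp_assoc)
  fix h assume h: "h \<in> Arr ?H" "Cod ?H g = Dom ?H h"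
  obtain \<alpha>3 \<beta>3 where h': "h = (\<alpha>3, \<beta>3)" by (cases h)
  have "\<alpha>3 \<in> Arr A" "Cod A \<alpha>2 = Dom A \<alpha>3"
    using h unfolding g(1) h' by (simp_all add: hfib_simps)
  then show "Cmp ?H (Cmp ?H h g) f = Cmp ?H h (Cmp ?H g f)"
    using f(2) g(2) fg'(1) unfolding f(1) g(1) h' by (simp add: hfib_simps A.Cmp_assoc)
next
  let ?H = "hfib A B F b"
  fix x assume "x \<in> Obj ?H"
  then show "Idn ?H x \<in> Arr ?H \<and> Dom ?H (Idn ?H x) = x \<and> Cod ?H (Idn ?H x) = x"
    using B.Cmp_Idn[of "snd x"] by (auto simp: hfib_simps ar_Idn)
qed

text \<open>Arrows lift uniquely along the projection: the label at the target must be
  \<open>\<beta>\<close> composed with the image of the inverse arrow. Hence arrow counts survive in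
  a fibre, even an iterated one.\<close>

lemma outs_hfib:
  assumes "(x, \<beta>) \<in> Obj (hfib A B F b)"
  shows "bij_betw fst (outs (hfib A B F b) (x, \<beta>)) (outs A x)"
  unfolding bij_betw_def
proof
  let ?H = "hfib A B F b"
  show "inj_on fst (outs ?H (x, \<beta>))"
  proof (rule inj_onI)
    fix f g assume f: "f \<in> outs ?H (x, \<beta>)" and g: "g \<in> outs ?H (x, \<beta>)" and "fst f = fst g"
    then obtain \<alpha> \<beta>1 \<beta>2 where [simp]: "f = (\<alpha>, \<beta>1)" "g = (\<alpha>, \<beta>2)"
      by (metis prod.collapse)
    have "\<beta>1 = \<beta>2"
      using f g B.Cmp_right_cancel[of \<beta>1 \<beta>2 "ar F \<alpha>"] by (auto simp: outs_def hfib_simps)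
    then show "f = g" by simp
  qed
  show "fst ` outs ?H (x, \<beta>) = outs A x"
  proof (intro equalityI subsetI)
    fix \<alpha> assume \<alpha>: "\<alpha> \<in> outs A x"
    then obtain \<alpha>' where \<alpha>': "\<alpha>' \<in> Arr A" "Dom A \<alpha>' = Cod A \<alpha>" "Cod A \<alpha>' = x"
      "Cmp A \<alpha>' \<alpha> = Idn A x"
      using A.ex_inverse by (auto simp: outs_def)
    have "Cmp B (Cmp B \<beta> (ar F \<alpha>')) (ar F \<alpha>) = \<beta>"
      using assms \<alpha> \<alpha>' B.Cmp_Idn[of \<beta>]
      by (auto simp: outs_def hfib_simps B.Cmp_assoc ar_Idn simp flip: ar_Cmp)
    then have "(\<alpha>, Cmp B \<beta> (ar F \<alpha>')) \<in> outs ?H (x, \<beta>)"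
      using assms \<alpha> \<alpha>' by (auto simp: outs_def hfib_simps)
    then show "\<alpha> \<in> fst ` outs ?H (x, \<beta>)"
      by (rule rev_image_eqI) simp
  qed (auto simp: outs_def hfib_simps)
qed

text \<open>\<open>S\<close> contains every object whose image admits an arrow to \<open>b\<close>.
  Each arrow gives one object of the fibre, with as many outgoing arrows as the object below
  it.\<close>

lemma hcard_hfib:
  assumes S: "finite S" "S \<subseteq> Obj A" "\<And>x. x \<in> Obj A - S \<Longrightarrow> hom B (ob F x) b = {}"
    and fin: "\<And>x. x \<in> S \<Longrightarrow> finite (outs A x)" "\<And>x. x \<in> S \<Longrightarrow> finite (hom B (ob F x) b)"
  shows "Obj (hfib A B F b) = (SIGMA x:S. hom B (ob F x) b)"
    and "hfinite (hfib A B F b)"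
    and "hcard (hfib A B F b) = (\<Sum>x\<in>S. of_nat (card (hom B (ob F x) b)) / of_nat (card (outs A x)))"
proof -
  let ?H = "hfib A B F b"
  interpret H: groupoid ?H by (rule groupoid_hfib)
  show obj: "Obj ?H = (SIGMA x:S. hom B (ob F x) b)"
    using S(2,3) by (auto simp: hfib_simps hom_def)
  then have finH: "finite (Obj ?H)"
    using S fin by auto
  have "finite (outs ?H y)" if y: "y \<in> Obj ?H" for y
    using outs_hfib[of "fst y" "snd y" b] y fin(1)[of "fst y"] obj bij_betw_finite by fastforce
  note H = H.hcard_eq_sum[OF finH this]
  show "hfinite ?H" by (rule H(1))
  have "hcard ?H = (\<Sum>y\<in>Obj ?H. 1 / of_nat (card (outs ?H y)))"
    by (rule H(2))
  also have "\<dots> = (\<Sum>(x, \<beta>)\<in>(SIGMA x:S. hom B (ob F x) b). 1 / of_nat (card (outs A x)))"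
    using bij_betw_same_card[OF outs_hfib, of _ _ b]
    by (intro sum.cong obj) (auto simp: obj)
  also have "\<dots> = (\<Sum>x\<in>S. \<Sum>\<beta>\<in>hom B (ob F x) b. 1 / of_nat (card (outs A x)))"
    using S fin by (subst sum.Sigma) auto
  finally show "hcard ?H = (\<Sum>x\<in>S. of_nat (card (hom B (ob F x) b)) / of_nat (card (outs A x)))"
    by simp
qed

lemma functor_hfib_proj: "grpd_functor (hfib A B F b) A hfib_proj"
proof -
  interpret H: groupoid "hfib A B F b" by (rule groupoid_hfib)
  show ?thesis
    by unfold_locales (simp_all add: hfib_def hfib_proj_def split_def)
qed

end

lemma groupoid_prod:
  assumes "groupoid A" "groupoid B"
  shows "groupoid (prod_grpd A B)"
proof -
  interpret A: groupoid A by fact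
  interpret B: groupoid B by fact
  show ?thesis
  proof
    fix f assume "f \<in> Arr (prod_grpd A B)"
    then obtain a b where f: "f = (a, b)" "a \<in> Arr A" "b \<in> Arr B" by (auto simp: prod_grpd_def)
    obtain a' where "a'\<in>Arr A" "Dom A a' = Cod A a" "Cod A a' = Dom A a"
      "Cmp A a' a = Idn A (Dom A a)" "Cmp A a a' = Idn A (Cod A a)"
      using A.ex_inverse f by blast
    moreover obtain b' where "b'\<in>Arr B" "Dom B b' = Cod B b" "Cod B b' = Dom B b"
      "Cmp B b' b = Idn B (Dom B b)" "Cmp B b b' = Idn B (Cod B b)"
      using B.ex_inverse f by blast
    ultimately show "\<exists>g\<in>Arr (prod_grpd A B). Dom (prod_grpd A B) g = Cod (prod_grpd A B) f \<and>
       Cod (prod_grpd A B) g = Dom (prod_grpd A B) f \<and>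
       Cmp (prod_grpd A B) g f = Idn (prod_grpd A B) (Dom (prod_grpd A B) f) \<and>
       Cmp (prod_grpd A B) f g = Idn (prod_grpd A B) (Cod (prod_grpd A B) f)"
      by (intro bexI[of _ "(a', b')"]) (auto simp: f prod_grpd_def)
  qed (auto simp: prod_grpd_def A.Cmp_assoc B.Cmp_assoc)
qed

lemma hom_prod: "hom (prod_grpd A B) (a, b) (a', b') = hom A a a' \<times> hom B b b'"
  by (auto simp: hom_def prod_grpd_def)

lemma functor_pair:
  assumes "grpd_functor A B F" "grpd_functor A C H"
  shows "grpd_functor A (prod_grpd B C) (pair_ftor F H)"
proof -
  interpret F: grpd_functor A B F by fact
  interpret H: grpd_functor A C H by fact
  interpret P: groupoid "prod_grpd B C" by (rule groupoid_prod) unfold_locales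
  show ?thesis
    by unfold_locales (auto simp: prod_grpd_def pair_ftor_def F.ar_Cmp H.ar_Cmp)
qed

lemma functor_comp:
  assumes "grpd_functor A B F" "grpd_functor B C H"
  shows "grpd_functor A C (H \<circ>\<^sub>F F)"
proof -
  interpret F: grpd_functor A B F by fact
  interpret H: grpd_functor B C H by fact
  show ?thesis
    by unfold_locales (auto simp: comp_ftor_def F.ar_Cmp H.ar_Cmp)
qed

lemma ob_simps [simp]:
  "ob (pair_ftor F H) x = (ob F x, ob H x)"
  "ob (H' \<circ>\<^sub>F F) x = ob H' (ob F x)"
  "ob hfib_proj p = fst p"
  by (simp_all add: pair_ftor_def comp_ftor_def hfib_proj_def)


section \<open>The symmetric monad on discrete groupoids\<close>

text \<open>Arrows are the same elements as objects, so a list of objects can be read as a list of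
  identity arrows.\<close>

definition discrete :: "('o, 'o) grpd \<Rightarrow> bool" where
  "discrete G \<longleftrightarrow> Arr G = Obj G \<and>
     (\<forall>x\<in>Obj G. Dom G x = x \<and> Cod G x = x \<and> Idn G x = x \<and> Cmp G x x = x)"

abbreviation Perms :: "nat \<Rightarrow> nat list set" where
  "Perms n \<equiv> permutations_of_set {..<n}"

text \<open>
  Over a discrete groupoid a morphism of \<open>Sr G\<close> is determined by its source \<open>xs\<close> and its permutation
  \<open>ns\<close>; this is its encoding.
\<close>

definition sarr :: "'o list \<Rightarrow> nat list \<Rightarrow> (nat \<times> 'o) list" where
  "sarr xs ns = map (\<lambda>k. (k, xs ! k)) ns"

lemma in_Perms_iff: "ns \<in> Perms n \<longleftrightarrow> distinct ns \<and> set ns = {..<n}"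
  by (auto simp: permutations_of_set_def)

lemma Perms_length: "ns \<in> Perms n \<Longrightarrow> length ns = n"
  using distinct_card by (fastforce simp: in_Perms_iff)

lemma Perms_nth: "ns \<in> Perms n \<Longrightarrow> i < n \<Longrightarrow> ns ! i < n"
  using Perms_length[of ns n] nth_mem[of i ns] by (auto simp: in_Perms_iff)

lemma Perms_lessI: "ns \<in> Perms n \<Longrightarrow> k \<in> set ns \<Longrightarrow> k < n"
  by (auto simp: in_Perms_iff)

lemma upt_in_Perms: "[0..<n] \<in> Perms n"
  by (auto simp: in_Perms_iff)

lemma map_nth_Perms:
  assumes "ns \<in> Perms n" "ms \<in> Perms n"
  shows "map ((!) ns) ms \<in> Perms n"
proof -
  have "set (map ((!) ns) ms) = (!) ns ` {..<length ns}"
    using assms Perms_length[OF assms(1)] by (simp add: in_Perms_iff)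
  also have "\<dots> = set ns" by (simp add: nth_image flip: atLeast0LessThan)
  finally have "set (map ((!) ns) ms) = {..<n}" using assms by (simp add: in_Perms_iff)
  moreover have "distinct (map ((!) ns) ms)"
    using assms Perms_length[OF assms(1)]
    by (auto simp: distinct_map in_Perms_iff inj_on_def nth_eq_iff_index_eq)
  ultimately show ?thesis by (simp add: in_Perms_iff)
qed

text \<open>In one-line notation the inverse lists, for each \<open>i\<close>, the position of
  \<open>i\<close> in \<open>ns\<close>.\<close>

lemma Perms_inverse:
  assumes "ns \<in> Perms n"
  obtains ms where "ms \<in> Perms n" "map ((!) ns) ms = [0..<n]" "map ((!) ms) ns = [0..<n]"
proof -
  note len = Perms_length[OF assms]
  have "\<exists>g. \<forall>i<n. g i < n \<and> ns ! g i = i"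
    using assms len by (intro choice) (metis in_Perms_iff in_set_conv_nth lessThan_iff)
  then obtain g where g: "\<And>i. i < n \<Longrightarrow> g i < n" "\<And>i. i < n \<Longrightarrow> ns ! g i = i"
    by blast
  have inj: "inj_on g {..<n}"
    using g(2) by (metis inj_onI lessThan_iff)
  have "g ` {..<n} = {..<n}"
    by (rule endo_inj_surj) (use inj g(1) in auto)
  then have "map g [0..<n] \<in> Perms n"
    using inj by (simp add: in_Perms_iff distinct_map atLeast0LessThan)
  moreover have "map ((!) ns) (map g [0..<n]) = [0..<n]"
    using g by (intro nth_equalityI) auto
  moreover have "map ((!) (map g [0..<n])) ns = [0..<n]"
  proof (rule nth_equalityI)
    fix j assume "j < length (map ((!) (map g [0..<n])) ns)"
    then have j: "j < n" using len by simp
    then have "ns ! g (ns ! j) = ns ! j" "g (ns ! j) < n"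
      using g Perms_nth[OF assms j] by auto
    then have "g (ns ! j) = j"
      using assms j len by (simp add: in_Perms_iff nth_eq_iff_index_eq)
    then show "map ((!) (map g [0..<n])) ns ! j = [0..<n] ! j"
      using j len Perms_nth[OF assms j] by simp
  qed (simp add: len)
  ultimately show ?thesis by (rule that)
qed

lemma length_sarr [simp]: "length (sarr xs ns) = length ns"
  by (simp add: sarr_def)

lemma map_fst_sarr [simp]: "map fst (sarr xs ns) = ns"
  by (simp add: sarr_def comp_def)

lemma inj_sarr: "inj_on (sarr xs) A"
  by (metis inj_onI map_fst_sarr)

lemma map_of_sarr: "k \<in> set ns \<Longrightarrow> map_of (sarr xs ns) k = Some (xs ! k)"
  unfolding sarr_def by (induction ns) auto

lemma Obj_Sr: "Obj (Sr G) = {xs. xs \<noteq> [] \<and> set xs \<subseteq> Obj G}"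
  by (simp add: Sr_def)

context
  fixes G :: "('o, 'o) grpd"
  assumes G: "discrete G"
begin

lemma sarr_in_Arr:
  assumes "xs \<in> Obj (Sr G)" "ns \<in> Perms (length xs)"
  shows "sarr xs ns \<in> Arr (Sr G)" "Dom (Sr G) (sarr xs ns) = xs"
    "Cod (Sr G) (sarr xs ns) = map ((!) xs) ns"
proof -
  note len = Perms_length[OF assms(2)]
  have xs: "xs ! k \<in> Obj G" if "k < length xs" for k
    using assms(1) that by (auto simp: Obj_Sr)
  have "ns \<noteq> []" using assms len by (auto simp: Obj_Sr)
  then show "sarr xs ns \<in> Arr (Sr G)"
    using assms(2) G len xs by (auto simp: Sr_def sarr_def in_Perms_iff comp_def discrete_def image_image)
  have map_of: "map_of (sarr xs ns) k = Some (xs ! k)" if "k < length xs" for k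
    using assms(2) that by (intro map_of_sarr) (simp add: in_Perms_iff)
  show "Dom (Sr G) (sarr xs ns) = xs"
    by (rule nth_equalityI) (use G len xs map_of in \<open>auto simp: Sr_def discrete_def\<close>)
  show "Cod (Sr G) (sarr xs ns) = map ((!) xs) ns"
    using G xs Perms_lessI[OF assms(2)] by (auto simp: Sr_def sarr_def discrete_def)
qed

text \<open>The source is recovered by looking up each position among the recorded pairs; distinct
  first components make the lookup faithful.\<close>

lemma Arr_Sr_cases:
  assumes "ps \<in> Arr (Sr G)"
  obtains xs ns where "ps = sarr xs ns" "xs \<in> Obj (Sr G)" "ns \<in> Perms (length xs)"
proof -
  define xs where "xs = map (\<lambda>k. the (map_of ps k)) [0..<length ps]"
  have dist: "distinct (map fst ps)" and set: "fst ` set ps = {..<length ps}"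
    and ps: "ps \<noteq> []" "snd ` set ps \<subseteq> Obj G"
    using assms G by (auto simp: Sr_def discrete_def)
  have lookup: "the (map_of ps k) = f" if "(k, f) \<in> set ps" for k f
    using dist that by simp
  have less: "k < length ps" if "(k, f) \<in> set ps" for k f
    using set that by force
  have "map (\<lambda>p. (fst p, xs ! fst p)) ps = ps"
    by (rule map_idI) (use less lookup in \<open>auto simp: xs_def\<close>)
  then have "ps = sarr xs (map fst ps)"
    by (simp add: sarr_def comp_def)
  moreover have "set xs \<subseteq> Obj G"
  proof
    fix x assume "x \<in> set xs"
    then obtain k where k: "k < length ps" "x = the (map_of ps k)" by (auto simp: xs_def)
    from k(1) have "k \<in> fst ` set ps" unfolding set by simp
    then obtain f where "(k, f) \<in> set ps" by force
    with k lookup ps show "x \<in> Obj G" by force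
  qed
  then have "xs \<in> Obj (Sr G)" using ps by (simp add: Obj_Sr xs_def)
  moreover have "map fst ps \<in> Perms (length xs)"
    using dist set by (simp add: in_Perms_iff xs_def)
  ultimately show ?thesis by (rule that)
qed

lemma Idn_Sr: "xs \<in> Obj (Sr G) \<Longrightarrow> Idn (Sr G) xs = sarr xs [0..<length xs]"
  using G by (intro nth_equalityI)
    (auto simp: Obj_Sr Sr_def sarr_def discrete_def nth_enumerate_eq subset_iff)

text \<open>An entry \<open>k\<close> of \<open>ms\<close> points to slot \<open>k\<close> of the
  intermediate list, which was filled from slot \<open>ns ! k\<close> of \<open>xs\<close>;
  permutations thus compose by indexing.\<close>

lemma Cmp_Sr:
  assumes "xs \<in> Obj (Sr G)" "ns \<in> Perms (length xs)" "ms \<in> Perms (length xs)"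
  shows "Cmp (Sr G) (sarr (map ((!) xs) ns) ms) (sarr xs ns) = sarr xs (map ((!) ns) ms)"
proof -
  have "xs ! k \<in> Obj G" if "k < length xs" for k
    using assms(1) that by (auto simp: Obj_Sr)
  then show ?thesis
    using G assms Perms_lessI[OF assms(3)] Perms_length[OF assms(2)] Perms_nth[OF assms(2)]
    by (auto simp: Sr_def sarr_def discrete_def)
qed

lemma map_nth_in_Obj_Sr:
  assumes "xs \<in> Obj (Sr G)" "ns \<in> Perms (length xs)"
  shows "map ((!) xs) ns \<in> Obj (Sr G)" "length (map ((!) xs) ns) = length xs"
proof -
  have "ns \<noteq> []" "set ns = {..<length xs}"
    using assms Perms_length[OF assms(2)] by (auto simp: Obj_Sr in_Perms_iff)
  then show "map ((!) xs) ns \<in> Obj (Sr G)"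
    using assms(1) by (auto simp: Obj_Sr)
  show "length (map ((!) xs) ns) = length xs"
    using Perms_length[OF assms(2)] by simp
qed

lemma sarr_comp_cases:
  assumes "f \<in> Arr (Sr G)" "g \<in> Arr (Sr G)" "Cod (Sr G) f = Dom (Sr G) g"
  obtains xs ns ms where "xs \<in> Obj (Sr G)" "ns \<in> Perms (length xs)" "ms \<in> Perms (length xs)"
    "f = sarr xs ns" "g = sarr (map ((!) xs) ns) ms"
proof -
  obtain xs ns where f: "f = sarr xs ns" "xs \<in> Obj (Sr G)" "ns \<in> Perms (length xs)"
    using Arr_Sr_cases assms by blast
  obtain ys ms where g: "g = sarr ys ms" "ys \<in> Obj (Sr G)" "ms \<in> Perms (length ys)"
    using Arr_Sr_cases assms by blast
  have "ys = map ((!) xs) ns"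
    using assms(3) f g by (simp add: sarr_in_Arr)
  with f g map_nth_in_Obj_Sr(2)[OF f(2,3)] show ?thesis by (auto intro: that)
qed

lemma groupoid_Sr: "groupoid (Sr G)"
proof
  let ?S = "Sr G"
  fix f assume fA: "f \<in> Arr ?S"
  then obtain xs ns where f: "f = sarr xs ns" "xs \<in> Obj ?S" "ns \<in> Perms (length xs)"
    by (rule Arr_Sr_cases)
  note len = Perms_length[OF f(3)]
  let ?ys = "map ((!) xs) ns"
  note ys = map_nth_in_Obj_Sr[OF f(2,3)]
  note arr = sarr_in_Arr[OF f(2,3), folded f(1)]
  show "Dom ?S f \<in> Obj ?S" "Cod ?S f \<in> Obj ?S"
    using arr f ys by simp_all
  have nth_upt: "map ((!) ns) [0..<length xs] = ns" "map ((!) [0..<length xs]) ns = ns"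
    using len Perms_lessI[OF f(3)] map_nth[of ns] by (auto intro: map_idI)
  have xs_upt: "map ((!) xs) [0..<length xs] = xs" by (rule map_nth)
  show "Cmp ?S f (Idn ?S (Dom ?S f)) = f"
    using Cmp_Sr[OF f(2) upt_in_Perms f(3)] 
    unfolding xs_upt nth_upt by (simp add: arr Idn_Sr[OF f(2)] flip: f(1))
  show "Cmp ?S (Idn ?S (Cod ?S f)) f = f"
    using Cmp_Sr[OF f(2,3) upt_in_Perms] 
    unfolding nth_upt by (simp add: arr Idn_Sr[OF ys(1)] len flip: f(1))
  show "\<exists>g\<in>Arr ?S. Dom ?S g = Cod ?S f \<and> Cod ?S g = Dom ?S f \<and>
      Cmp ?S g f = Idn ?S (Dom ?S f) \<and> Cmp ?S f g = Idn ?S (Cod ?S f)"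
  proof -
    obtain ms where ms: "ms \<in> Perms (length xs)" "map ((!) ns) ms = [0..<length xs]"
      "map ((!) ms) ns = [0..<length xs]"
      using Perms_inverse[OF f(3)] by metis
    have ys_ms: "map ((!) ?ys) ms = xs"
    proof -
      have "map ((!) ?ys) ms = map ((!) xs) (map ((!) ns) ms)"
        using Perms_lessI[OF ms(1)] len by simp
      then show ?thesis by (simp add: ms xs_upt)
    qed
    have ms': "ms \<in> Perms (length ?ys)" and ns': "ns \<in> Perms (length ?ys)"
      using ms(1) f(3) ys(2) by simp_all
    have "Cmp ?S (sarr ?ys ms) f = Idn ?S xs"
      unfolding f(1) Cmp_Sr[OF f(2,3) ms(1)] ms(2) by (rule Idn_Sr[OF f(2), symmetric])
    moreover have "Cmp ?S f (sarr ?ys ms) = Idn ?S ?ys"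
      using Cmp_Sr[OF ys(1) ms' ns'] unfolding ys_ms f(1) ms(3) Idn_Sr[OF ys(1)] ys(2) .
    ultimately show ?thesis
      using sarr_in_Arr[OF ys(1) ms'] arr ys_ms by (intro bexI[of _ "sarr ?ys ms"]) auto
  qed
  fix g assume gA: "g \<in> Arr ?S" and fg: "Cod ?S f = Dom ?S g"
  obtain xs ns ms where g: "xs \<in> Obj ?S" "ns \<in> Perms (length xs)" "ms \<in> Perms (length xs)"
    "f = sarr xs ns" "g = sarr (map ((!) xs) ns) ms"
    using sarr_comp_cases[OF fA gA fg] by metis
  note ys = map_nth_in_Obj_Sr[OF g(1,2)]
  have ms': "ms \<in> Perms (length (map ((!) xs) ns))"
    using g(3) ys(2) by simp
  have nth: "map ((!) (map ((!) xs) ns)) ms = map ((!) xs) (map ((!) ns) ms)"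
    using Perms_lessI[OF g(3)] Perms_length[OF g(2)] by simp
  note gf = Cmp_Sr[OF g(1-3), folded g(4,5)] sarr_in_Arr[OF g(1) map_nth_Perms[OF g(2,3)]]
    sarr_in_Arr[OF g(1,2), folded g(4)] sarr_in_Arr[OF ys(1) ms', folded g(5)] nth
  then show "Cmp ?S g f \<in> Arr ?S \<and> Dom ?S (Cmp ?S g f) = Dom ?S f \<and> Cod ?S (Cmp ?S g f) = Cod ?S g"
    by simp
  fix h assume hA: "h \<in> Arr ?S" and gh: "Cod ?S g = Dom ?S h"
  obtain zs ls where h: "h = sarr zs ls" "zs \<in> Obj ?S" "ls \<in> Perms (length zs)"
    using Arr_Sr_cases[OF hA] by metis
  have zs: "zs = map ((!) (map ((!) xs) ns)) ms" "zs = map ((!) xs) (map ((!) ns) ms)"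
    using gh gf h by (simp_all add: sarr_in_Arr)
  have len: "length zs = length xs" using zs(1) Perms_length[OF g(3)] by simp
  have ls: "ls \<in> Perms (length xs)" "ls \<in> Perms (length (map ((!) xs) ns))"
    using h(3) len ys(2) by simp_all
  have "Cmp ?S (Cmp ?S h g) f = sarr xs (map ((!) ns) (map ((!) ms) ls))"
    unfolding h(1) zs(1) g(5) Cmp_Sr[OF ys(1) ms' ls(2)] unfolding g(4)
    by (rule Cmp_Sr[OF g(1,2) map_nth_Perms[OF g(3) ls(1)]])
  moreover have "Cmp ?S h (Cmp ?S g f) = sarr xs (map ((!) (map ((!) ns) ms)) ls)"
    unfolding gf(1) h(1) zs(2) by (rule Cmp_Sr[OF g(1) map_nth_Perms[OF g(2,3)] ls(1)])
  moreover have "map ((!) (map ((!) ns) ms)) ls = map ((!) ns) (map ((!) ms) ls)"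
    using Perms_lessI[OF ls(1)] Perms_length[OF g(3)] by simp
  ultimately show "Cmp ?S (Cmp ?S h g) f = Cmp ?S h (Cmp ?S g f)"
    by simp
next
  let ?S = "Sr G"
  fix xs assume "xs \<in> Obj ?S"
  then show "Idn ?S xs \<in> Arr ?S \<and> Dom ?S (Idn ?S xs) = xs \<and> Cod ?S (Idn ?S xs) = xs"
    by (simp add: Idn_Sr sarr_in_Arr upt_in_Perms map_nth)
qed

lemma outs_Sr: "xs \<in> Obj (Sr G) \<Longrightarrow> outs (Sr G) xs = sarr xs ` Perms (length xs)"
  unfolding outs_def
  by (auto simp: sarr_in_Arr elim!: Arr_Sr_cases)

text \<open>Different permutations are different arrows even when entries repeat, so the count
  depends on the length alone.\<close>

lemma card_outs_Sr:
  assumes "xs \<in> Obj (Sr G)"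
  shows "finite (outs (Sr G) xs)" "card (outs (Sr G) xs) = fact (length xs)"
  using assms by (simp_all add: outs_Sr card_image[OF inj_sarr])

lemma finite_hom_Sr: "xs \<in> Obj (Sr G) \<Longrightarrow> finite (hom (Sr G) xs ys)"
  by (rule finite_subset[OF _ card_outs_Sr(1)]) (auto simp: hom_def outs_def)

text \<open>Over a discrete groupoid arrows only rearrange entries. The components of
  \<open>Sr G\<close> are therefore multisets of objects, the shape of monomials.\<close>

lemma hom_Sr_nonempty_iff:
  assumes "xs \<in> Obj (Sr G)"
  shows "hom (Sr G) xs ys \<noteq> {} \<longleftrightarrow> mset xs = mset ys"
proof
  assume "hom (Sr G) xs ys \<noteq> {}"
  then obtain ns where ns: "ns \<in> Perms (length xs)" "ys = map ((!) xs) ns"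
    using assms by (auto simp: hom_def sarr_in_Arr elim!: Arr_Sr_cases)
  then have "mset ns = mset [0..<length xs]"
    by (intro iffD1[OF set_eq_iff_mset_eq_distinct]) (auto simp: in_Perms_iff atLeast0LessThan)
  then have "mset ys = mset (map ((!) xs) [0..<length xs])"
    unfolding ns by simp
  then show "mset xs = mset ys" by (simp only: map_nth)
next
  assume eq: "mset xs = mset ys"
  then obtain p where p: "p permutes {..<length xs}" "permute_list p xs = ys"
    using mset_eq_permutation[of ys xs] by auto
  let ?ns = "map p [0..<length xs]"
  have ns: "?ns \<in> Perms (length xs)"
    using p(1) permutes_inj_on[OF p(1)]
    by (auto simp: in_Perms_iff distinct_map atLeast0LessThan permutes_image)
  have "map ((!) xs) ?ns = ys"
    using p(2) by (simp add: permute_list_def comp_def)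
  with sarr_in_Arr[OF assms ns] show "hom (Sr G) xs ys \<noteq> {}"
    by (auto simp: hom_def)
qed

lemma iso_class_Sr:
  assumes "xs \<in> Obj (Sr G)"
  shows "iso_class (Sr G) xs = {ys \<in> Obj (Sr G). mset ys = mset xs}"
proof -
  interpret groupoid "Sr G" by (rule groupoid_Sr)
  show ?thesis using hom_Sr_nonempty_iff[OF assms] assms by (auto simp: iso_class_eq)
qed

end

lemma Sr_map_sarr: "ar (Sr_map F) (sarr xs ns) = map (\<lambda>k. (k, ar F (xs ! k))) ns"
  by (simp add: Sr_map_def sarr_def)

lemma functor_Sr_map:
  assumes A: "discrete A" and B: "discrete B"
    and F: "\<And>x. x \<in> Obj A \<Longrightarrow> ob F x \<in> Obj B" "\<And>x. x \<in> Obj A \<Longrightarrow> ar F x = ob F x"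
  shows "grpd_functor (Sr A) (Sr B) (Sr_map F)"
proof -
  interpret A: groupoid "Sr A" by (rule groupoid_Sr[OF A])
  interpret B: groupoid "Sr B" by (rule groupoid_Sr[OF B])
  have ob: "ob (Sr_map F) xs = map (ob F) xs" for xs by (simp add: Sr_map_def)
  have obj: "map (ob F) xs \<in> Obj (Sr B)" if "xs \<in> Obj (Sr A)" for xs
    using that F(1) by (auto simp: Obj_Sr)
  have ar: "ar (Sr_map F) (sarr xs ns) = sarr (map (ob F) xs) ns"
    if "xs \<in> Obj (Sr A)" "ns \<in> Perms (length xs)" for xs ns
    using that F(2) Perms_lessI[OF that(2)]
    unfolding Sr_map_sarr by (auto simp: sarr_def Obj_Sr subset_iff)
  show ?thesis
  proof unfold_locales
    fix xs assume "xs \<in> Obj (Sr A)"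
    then show "ob (Sr_map F) xs \<in> Obj (Sr B)" by (simp add: ob obj)
  next
    fix f assume "f \<in> Arr (Sr A)"
    then obtain xs ns where f: "f = sarr xs ns" "xs \<in> Obj (Sr A)" "ns \<in> Perms (length xs)"
      by (rule Arr_Sr_cases[OF A])
    have "map ((!) (map (ob F) xs)) ns = map (ob F) (map ((!) xs) ns)"
      using Perms_lessI[OF f(3)] by simp
    then show "ar (Sr_map F) f \<in> Arr (Sr B) \<and> Dom (Sr B) (ar (Sr_map F) f) = ob (Sr_map F) (Dom (Sr A) f) \<and>
        Cod (Sr B) (ar (Sr_map F) f) = ob (Sr_map F) (Cod (Sr A) f)"
      using f sarr_in_Arr[OF A f(2,3)] sarr_in_Arr[OF B obj[OF f(2)], of ns] by (simp add: ar ob)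
  next
    fix f g assume "f \<in> Arr (Sr A)" "g \<in> Arr (Sr A)" "Cod (Sr A) f = Dom (Sr A) g"
    then obtain xs ns ms where g: "xs \<in> Obj (Sr A)" "ns \<in> Perms (length xs)" "ms \<in> Perms (length xs)"
      "f = sarr xs ns" "g = sarr (map ((!) xs) ns) ms"
      by (rule sarr_comp_cases[OF A])
    note ys = map_nth_in_Obj_Sr[OF A g(1,2)]
    have "ar (Sr_map F) g = sarr (map (ob F) (map ((!) xs) ns)) ms"
      unfolding g(5) using g(3) ys(2) by (intro ar ys(1)) simp
    also have "map (ob F) (map ((!) xs) ns) = map ((!) (map (ob F) xs)) ns"
      using Perms_lessI[OF g(2)] by simp
    finally have "Cmp (Sr B) (ar (Sr_map F) g) (ar (Sr_map F) f) =
        sarr (map (ob F) xs) (map ((!) ns) ms)"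
      using g Cmp_Sr[OF B obj[OF g(1)], of ns ms] by (simp add: ar)
    moreover have "ar (Sr_map F) (Cmp (Sr A) g f) = sarr (map (ob F) xs) (map ((!) ns) ms)"
      unfolding g(4,5) Cmp_Sr[OF A g(1-3)] by (intro ar g(1) map_nth_Perms g(2,3))
    ultimately show "ar (Sr_map F) (Cmp (Sr A) g f) = Cmp (Sr B) (ar (Sr_map F) g) (ar (Sr_map F) f)"
      by simp
  qed
qed


section \<open>Homotopy fibres over discrete groupoids\<close>

lemma concat_nth_block:
  assumes "k < length xss" "j < length (xss ! k)"
  shows "concat xss ! ((\<Sum>l<k. length (xss ! l)) + j) = xss ! k ! j"
  using assms
proof (induction xss arbitrary: k)
  case (Cons xs xss)
  then show ?case
    by (cases k) (auto simp: nth_append sum.lessThan_Suc_shift add.assoc simp del: sum.lessThan_Suc)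
qed simp

text \<open>The operadic block permutation: block \<open>k\<close>, of length \<open>L k\<close>,
  starts after the blocks before it, and whole blocks are listed in the order
  \<open>ns\<close>.\<close>

definition block_perm :: "(nat \<Rightarrow> nat) \<Rightarrow> nat list \<Rightarrow> nat list" where
  "block_perm L ns = concat (map (\<lambda>k. map (\<lambda>j. (\<Sum>l<k. L l) + j) [0..<L k]) ns)"

text \<open>The blocks tile an initial segment, and a list no longer than its set of entries has no
  repetitions.\<close>

lemma block_perm_in_Perms:
  assumes "ns \<in> Perms n"
  shows "block_perm L ns \<in> Perms (\<Sum>l<n. L l)"
proof -
  have blocks: "(\<Union>k<n. {\<Sum>l<k. L l..<(\<Sum>l<k. L l) + L k}) = {..<\<Sum>l<n. L l}" for n
  proof (induction n)
    case (Suc n)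
    then show ?case by (auto simp: lessThan_Suc)
  qed simp
  have "set (block_perm L ns) = (\<Union>k<n. {\<Sum>l<k. L l..<(\<Sum>l<k. L l) + L k})"
    using assms by (simp add: block_perm_def in_Perms_iff image_add_atLeastLessThan add.commute)
  then have set: "set (block_perm L ns) = {..<\<Sum>l<n. L l}"
    by (simp only: blocks)
  have "length (block_perm L ns) = (\<Sum>k\<leftarrow>ns. L k)"
    by (simp add: block_perm_def length_concat comp_def)
  also have "\<dots> = (\<Sum>l<n. L l)"
    using assms by (simp add: in_Perms_iff sum_list_distinct_conv_sum_set)
  finally have "distinct (block_perm L ns)"
    by (intro card_distinct) (simp add: set)
  with set show ?thesis by (simp add: in_Perms_iff)
qed

lemma length_concat_map: "length (concat (map q xs)) = (\<Sum>l<length xs. length (q (xs ! l)))"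
proof -
  have "length (concat (map q xs)) = (\<Sum>x\<leftarrow>xs. length (q x))"
    by (simp add: length_concat comp_def)
  also have "\<dots> = (\<Sum>l<length xs. length (q (xs ! l)))"
    by (simp add: sum_list_sum_nth atLeast0LessThan)
  finally show ?thesis .
qed

lemma concat_map_nth:
  assumes "k < length xs" "j < length (q (xs ! k))"
  shows "concat (map q xs) ! ((\<Sum>l<k. length (q (xs ! l))) + j) = q (xs ! k) ! j"
proof -
  have "(\<Sum>l<k. length (map q xs ! l)) = (\<Sum>l<k. length (q (xs ! l)))"
    using assms by (intro sum.cong) auto
  then show ?thesis
    using concat_nth_block[of k "map q xs" j] assms by simp
qed

lemma map_nth_block_perm:
  assumes "\<forall>k\<in>set ns. k < length xs"
  shows "map ((!) (concat (map q xs))) (block_perm (\<lambda>l. length (q (xs ! l))) ns) =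
    concat (map (\<lambda>k. q (xs ! k)) ns)"
proof -
  have "map ((!) (concat (map q xs))) (block_perm (\<lambda>l. length (q (xs ! l))) ns) =
      concat (map (\<lambda>k. map (\<lambda>j. concat (map q xs) ! ((\<Sum>l<k. length (q (xs ! l))) + j))
        [0..<length (q (xs ! k))]) ns)"
    by (simp add: block_perm_def map_concat comp_def)
  also have "map (\<lambda>k. map (\<lambda>j. concat (map q xs) ! ((\<Sum>l<k. length (q (xs ! l))) + j))
        [0..<length (q (xs ! k))]) ns = map (\<lambda>k. q (xs ! k)) ns"
  proof (rule map_cong[OF refl])
    fix k assume "k \<in> set ns"
    with assms have "k < length xs" by blast
    then show "map (\<lambda>j. concat (map q xs) ! ((\<Sum>l<k. length (q (xs ! l))) + j))
        [0..<length (q (xs ! k))] = q (xs ! k)"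
      by (intro nth_equalityI) (auto simp: concat_map_nth)
  qed
  finally show ?thesis .
qed

text \<open>An instance of \<open>map_nth_block_perm\<close> in which the blocks consist of the
  indices themselves.\<close>

lemma block_perm_comp:
  assumes "\<forall>k\<in>set ms. k < length ns"
  shows "map ((!) (block_perm L ns)) (block_perm (\<lambda>i. L (ns ! i)) ms) = block_perm L (map ((!) ns) ms)"
proof -
  let ?q = "\<lambda>k. map (\<lambda>j. (\<Sum>l<k. L l) + j) [0..<L k]"
  have "map ((!) (concat (map ?q ns))) (block_perm (\<lambda>l. length (?q (ns ! l))) ms) =
      concat (map (\<lambda>k. ?q (ns ! k)) ms)"
    by (rule map_nth_block_perm[OF assms])
  then show ?thesis by (simp add: block_perm_def comp_def)
qed

text \<open>Functoriality of flattening, in a form that asks only for concatenation on objects and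
  block permutation on arrows; the face that drops the root is later brought to this form.\<close>

lemma functor_concat:
  assumes A: "discrete A" and B: "discrete B"
    and q: "\<And>x. x \<in> Obj A \<Longrightarrow> q x \<noteq> [] \<and> set (q x) \<subseteq> Obj B"
    and ob: "\<And>xs. ob F xs = concat (map q xs)"
    and ar: "\<And>xs ns. xs \<in> Obj (Sr A) \<Longrightarrow> ns \<in> Perms (length xs) \<Longrightarrow>
      ar F (sarr xs ns) = sarr (concat (map q xs)) (block_perm (\<lambda>l. length (q (xs ! l))) ns)"
  shows "grpd_functor (Sr A) (Sr B) F"
proof -
  interpret A: groupoid "Sr A" by (rule groupoid_Sr[OF A])
  interpret B: groupoid "Sr B" by (rule groupoid_Sr[OF B])
  let ?Q = "\<lambda>xs. concat (map q xs)" and ?b = "\<lambda>xs. block_perm (\<lambda>l. length (q (xs ! l)))"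
  have obj: "?Q xs \<in> Obj (Sr B)" if "xs \<in> Obj (Sr A)" for xs
    using that q by (cases xs) (auto simp: Obj_Sr)
  have perm: "?b xs ns \<in> Perms (length (?Q xs))" if "ns \<in> Perms (length xs)" for xs ns
    unfolding length_concat_map by (rule block_perm_in_Perms[OF that])
  show ?thesis
  proof unfold_locales
    fix xs assume "xs \<in> Obj (Sr A)"
    then show "ob F xs \<in> Obj (Sr B)" by (simp add: ob obj)
  next
    fix f assume "f \<in> Arr (Sr A)"
    then obtain xs ns where f: "f = sarr xs ns" "xs \<in> Obj (Sr A)" "ns \<in> Perms (length xs)"
      by (rule Arr_Sr_cases[OF A])
    have "map ((!) (?Q xs)) (?b xs ns) = ?Q (map ((!) xs) ns)"
      using map_nth_block_perm[of ns xs q] Perms_lessI[OF f(3)] by (simp add: comp_def)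
    then show "ar F f \<in> Arr (Sr B) \<and> Dom (Sr B) (ar F f) = ob F (Dom (Sr A) f) \<and>
        Cod (Sr B) (ar F f) = ob F (Cod (Sr A) f)"
      using f(2,3) unfolding f(1)
      by (simp add: ar ob sarr_in_Arr[OF A] sarr_in_Arr[OF B obj perm])
  next
    fix f g assume "f \<in> Arr (Sr A)" "g \<in> Arr (Sr A)" "Cod (Sr A) f = Dom (Sr A) g"
    then obtain xs ns ms where g: "xs \<in> Obj (Sr A)" "ns \<in> Perms (length xs)" "ms \<in> Perms (length xs)"
      "f = sarr xs ns" "g = sarr (map ((!) xs) ns) ms"
      by (rule sarr_comp_cases[OF A])
    note ys = map_nth_in_Obj_Sr[OF A g(1,2)]
    have ms: "ms \<in> Perms (length (map ((!) xs) ns))" using g(3) ys(2) by simp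
    have ns: "\<forall>k\<in>set ms. k < length ns" "\<forall>k\<in>set ns. k < length xs"
      using Perms_lessI[OF g(3)] Perms_lessI[OF g(2)] Perms_length[OF g(2)] by auto
    have Q: "?Q (map ((!) xs) ns) = map ((!) (?Q xs)) (?b xs ns)"
      using map_nth_block_perm[of ns xs q] ns by (simp add: comp_def)
    have "?b (map ((!) xs) ns) ms = block_perm (\<lambda>i. length (q (xs ! (ns ! i)))) ms"
    proof -
      have "(\<Sum>l<k. length (q (map ((!) xs) ns ! l))) = (\<Sum>l<k. length (q (xs ! (ns ! l))))"
        if "k \<in> set ms" for k
        using ns that by (intro sum.cong) auto
      then show ?thesis
        using ns unfolding block_perm_def by (intro arg_cong[of _ _ concat] map_cong) auto
    qed
    then have b: "ar F g = sarr (map ((!) (?Q xs)) (?b xs ns)) (block_perm (\<lambda>i. length (q (xs ! (ns ! i)))) ms)"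
      unfolding g(5) using ar[OF ys(1) ms] Q by simp
    \<comment> \<open>Rearranging the blocks rearranges their lengths, so the total length is
      unchanged.\<close>
    have perm': "block_perm (\<lambda>i. length (q (xs ! (ns ! i)))) ms \<in> Perms (length (?Q xs))"
    proof -
      have "(\<Sum>l<length xs. length (q (xs ! (ns ! l)))) = (\<Sum>l<length xs. length (q (xs ! l)))"
        using g(2) Perms_length[OF g(2)]
        by (intro sum.reindex_bij_betw[OF bij_betw_nth]) (simp_all add: in_Perms_iff)
      then show ?thesis
        using block_perm_in_Perms[OF g(3), of "\<lambda>i. length (q (xs ! (ns ! i)))"]
        by (simp add: length_concat_map)
    qed
    have "Cmp (Sr B) (ar F g) (ar F f) = sarr (?Q xs)
        (map ((!) (?b xs ns)) (block_perm (\<lambda>i. length (q (xs ! (ns ! i)))) ms))"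
      unfolding b g(4) ar[OF g(1,2)] by (rule Cmp_Sr[OF B obj[OF g(1)] perm[OF g(2)] perm'])
    also have "\<dots> = sarr (?Q xs) (?b xs (map ((!) ns) ms))"
      by (simp only: block_perm_comp[OF ns(1), of "\<lambda>l. length (q (xs ! l))"])
    also have "\<dots> = ar F (Cmp (Sr A) g f)"
      unfolding g(4,5) Cmp_Sr[OF A g(1-3)] by (rule ar[symmetric, OF g(1) map_nth_Perms[OF g(2,3)]])
    finally show "ar F (Cmp (Sr A) g f) = Cmp (Sr B) (ar F g) (ar F f)" ..
  qed
qed

text \<open>A permutation taking \<open>f\<close> to \<open>f'\<close> maps one fibre injectively
  into the other, and \<open>P\<close> survives because it sees only the multiset; symmetry gives
  equality.\<close>

lemma card_map_fibre_mset:
  assumes "mset f' = mset f" "finite {xs \<in> Obj (Sr A). map p xs = f \<and> P (mset xs)}"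
    "finite {xs \<in> Obj (Sr A). map p xs = f' \<and> P (mset xs)}"
  shows "card {xs \<in> Obj (Sr A). map p xs = f' \<and> P (mset xs)} =
    card {xs \<in> Obj (Sr A). map p xs = f \<and> P (mset xs)}"
proof -
  have "card {xs \<in> Obj (Sr A). map p xs = f \<and> P (mset xs)} \<le>
      card {xs \<in> Obj (Sr A). map p xs = f' \<and> P (mset xs)}"
    if eq: "mset f = mset f'" and fin: "finite {xs \<in> Obj (Sr A). map p xs = f' \<and> P (mset xs)}" for f f'
  proof -
    obtain \<pi> where \<pi>: "\<pi> permutes {..<length f}" "permute_list \<pi> f = f'"
      using mset_eq_permutation[OF eq[symmetric]] by metis
    show ?thesis
    proof (rule card_inj_on_le[OF _ _ fin])
      show "inj_on (permute_list \<pi>) {xs \<in> Obj (Sr A). map p xs = f \<and> P (mset xs)}"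
      proof (rule inj_onI)
        fix xs ys assume xs: "xs \<in> {xs \<in> Obj (Sr A). map p xs = f \<and> P (mset xs)}"
          and ys: "ys \<in> {xs \<in> Obj (Sr A). map p xs = f \<and> P (mset xs)}"
          and eq: "permute_list \<pi> xs = permute_list \<pi> ys"
        have len: "length xs = length f" "length ys = length f" using xs ys by (auto dest: map_eq_imp_length_eq)
        have inv: "permute_list (inv \<pi>) (permute_list \<pi> zs) = zs" if "length zs = length f" for zs
          using permute_list_compose[of "inv \<pi>" zs \<pi>] permutes_inv[OF \<pi>(1)] permutes_inv_o(1)[OF \<pi>(1)] that
          by simp
        show "xs = ys" using inv[OF len(1)] inv[OF len(2)] eq by metis
      qed
      show "permute_list \<pi> ` {xs \<in> Obj (Sr A). map p xs = f \<and> P (mset xs)} \<subseteq>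
          {xs \<in> Obj (Sr A). map p xs = f' \<and> P (mset xs)}"
      proof clarify
        fix xs assume xs: "xs \<in> Obj (Sr A)" "P (mset xs)" "f = map p xs"
        then have \<pi>': "\<pi> permutes {..<length xs}" using \<pi>(1) by simp
        have "map p (permute_list \<pi> xs) = f'"
          using \<pi>(2) xs(3) permute_list_map[OF \<pi>', of p] by simp
        moreover have "permute_list \<pi> xs = [] \<longleftrightarrow> xs = []"
          by (metis length_0_conv length_permute_list)
        then have "permute_list \<pi> xs \<in> Obj (Sr A)"
          using xs(1) \<pi>' by (simp add: Obj_Sr)
        ultimately show "permute_list \<pi> xs \<in> Obj (Sr A) \<and> map p (permute_list \<pi> xs) = f' \<and>
            P (mset (permute_list \<pi> xs))"
          using xs(2) \<pi>' by simp
      qed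
    qed
  qed
  from this[of f f'] this[of f' f] assms show ?thesis by simp
qed

text \<open>
  The factors \<open>|Aut f|\<close> and \<open>|f|!\<close> cancel: the homotopy fibre over \<open>f\<close> sees every list over a rearrangement
  of \<open>f\<close>, and there are \<open>|f|! / |Aut f|\<close> rearrangements, with equally many lists over each.
\<close>

lemma Sr_double_fibre:
  assumes A: "discrete A" and B: "discrete B"
    and d1: "grpd_functor (Sr A) (Sr B) D1" "\<And>xs. ob D1 xs = map p xs"
    and d2: "grpd_functor (Sr A) (Sr B) D2" and d0: "grpd_functor (Sr A) (Sr B) D0"
    and fin: "\<And>y. y \<in> Obj B \<Longrightarrow> finite {x \<in> Obj A. p x = y}"
    and f: "f \<in> Obj (Sr B)" and a: "a \<in> Obj (Sr B)" and b: "b \<in> Obj (Sr B)"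
  defines "\<Phi> \<equiv> hfib (hfib (Sr A) (Sr B) D1 f) (prod_grpd (Sr B) (Sr B))
       (pair_ftor (D2 \<circ>\<^sub>F hfib_proj) (D0 \<circ>\<^sub>F hfib_proj)) (a, b)"
  shows "hfinite \<Phi>"
    and "hcard \<Phi> / (of_nat (card (Aut (Sr B) a)) * of_nat (card (Aut (Sr B) b))) =
      of_nat (card {xs \<in> Obj (Sr A). map p xs = f \<and> mset (ob D2 xs) = mset a \<and> mset (ob D0 xs) = mset b})"
proof -
  let ?A = "Sr A" and ?B = "Sr B" and ?H = "hfib (Sr A) (Sr B) D1 f" and ?n = "length f"
  interpret A: groupoid ?A by (rule groupoid_Sr[OF A])
  interpret B: groupoid ?B by (rule groupoid_Sr[OF B])
  interpret D1: grpd_functor ?A ?B D1 by (rule d1)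
  interpret D2: grpd_functor ?A ?B D2 by (rule d2)
  interpret D0: grpd_functor ?A ?B D0 by (rule d0)
  interpret H: groupoid ?H by (rule D1.groupoid_hfib)
  interpret P: grpd_functor ?H "prod_grpd ?B ?B" "pair_ftor (D2 \<circ>\<^sub>F hfib_proj) (D0 \<circ>\<^sub>F hfib_proj)"
    by (intro functor_pair functor_comp[OF D1.functor_hfib_proj] d2 d0)
  \<comment> \<open>These are the lists whose image is isomorphic to \<open>f\<close>, hence the
    ones over which the fibre of \<open>D1\<close> is inhabited.\<close>
  define S where "S = {xs \<in> Obj ?A. mset (map p xs) = mset f}"
  have finS: "finite S"
  proof (rule finite_subset)
    show "S \<subseteq> {xs. set xs \<subseteq> (\<Union>y\<in>set f. {x \<in> Obj A. p x = y}) \<and> length xs = ?n}"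
    proof
      fix xs assume "xs \<in> S"
      then have xs: "set xs \<subseteq> Obj A" "mset (map p xs) = mset f" by (auto simp: S_def Obj_Sr)
      have "p ` set xs = set f" using mset_eq_setD[OF xs(2)] by simp
      moreover have "length xs = ?n" using mset_eq_length[OF xs(2)] by simp
      ultimately show "xs \<in> {xs. set xs \<subseteq> (\<Union>y\<in>set f. {x \<in> Obj A. p x = y}) \<and> length xs = ?n}"
        using xs(1) by auto
    qed
    have "finite (\<Union>y\<in>set f. {x \<in> Obj A. p x = y})"
      using f fin by (auto simp: Obj_Sr)
    then show "finite {xs. set xs \<subseteq> (\<Union>y\<in>set f. {x \<in> Obj A. p x = y}) \<and> length xs = ?n}"
      by (rule finite_lists_length_eq)
  qed
  have S: "xs \<in> Obj ?A" "length xs = ?n" "map p xs \<in> Obj ?B" if "xs \<in> S" for xs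
    using that D1.ob_in[of xs] mset_eq_length[of "map p xs" f] by (auto simp: S_def d1(2))
  have homf: "hom ?B (map p xs) f = {}" if "xs \<in> Obj ?A - S" for xs
    using that hom_Sr_nonempty_iff[OF B, of "map p xs" f] D1.ob_in[of xs] by (auto simp: S_def d1(2))
  have obH: "Obj ?H = (SIGMA xs:S. hom ?B (map p xs) f)"
  proof (rule D1.hcard_hfib(1)[of S f, OF finS, unfolded d1(2)])
    show "S \<subseteq> Obj ?A" using S(1) by blast
    show "finite (outs ?A xs)" "finite (hom ?B (map p xs) f)" if "xs \<in> S" for xs
      using card_outs_Sr(1)[OF A S(1)[OF that]] finite_hom_Sr[OF B S(3)[OF that]] by simp_all
  qed (rule homf)
  have finH: "finite (Obj ?H)"
    unfolding obH using finS S(3) finite_hom_Sr[OF B] by auto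
  \<comment> \<open>All objects of the inner fibre have equally many outgoing arrows, so the outer
    cardinality is a number of labels divided by one factorial.\<close>
  have outsH: "finite (outs ?H y)" "card (outs ?H y) = fact ?n" if y: "y \<in> Obj ?H" for y
  proof -
    have x: "fst y \<in> S" using y obH by auto
    have bij: "bij_betw fst (outs ?H y) (outs ?A (fst y))"
      using D1.outs_hfib[of "fst y" "snd y" f] y by simp
    show "finite (outs ?H y)" using bij_betw_finite[OF bij] card_outs_Sr[OF A S(1)[OF x]] by simp
    show "card (outs ?H y) = fact ?n"
      using bij_betw_same_card[OF bij] card_outs_Sr[OF A S(1)[OF x]] S(2)[OF x] by simp
  qed
  let ?hom = "\<lambda>xs. hom ?B (ob D2 xs) a \<times> hom ?B (ob D0 xs) b"
  have hom: "hom (prod_grpd ?B ?B) (ob (pair_ftor (D2 \<circ>\<^sub>F hfib_proj) (D0 \<circ>\<^sub>F hfib_proj)) y) (a, b) = ?hom (fst y)" for y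
    by (simp add: hom_prod)
  have fin_hom: "finite (?hom (fst y))" if "y \<in> Obj ?H" for y
  proof -
    have "fst y \<in> Obj ?A" using that obH S(1) by auto
    then show ?thesis using finite_hom_Sr[OF B] by (intro finite_cartesian_product) auto
  qed
  note hc = P.hcard_hfib(2,3)[of "Obj ?H" "(a, b)", OF finH, unfolded hom, folded \<Phi>_def]
  show "hfinite \<Phi>"
    by (rule hc(1)) (use outsH fin_hom in auto)
  define T where "T = {xs \<in> S. mset (ob D2 xs) = mset a \<and> mset (ob D0 xs) = mset b}"
  have card_hom: "card (hom ?B xs ys) = (if mset xs = mset ys then card (Aut ?B ys) else 0)"
    if "xs \<in> Obj ?B" "ys \<in> Obj ?B" for xs ys
    using that B.card_hom_eq_source[of xs ys] B.card_Aut_eq[of xs ys] hom_Sr_nonempty_iff[OF B that(1), of ys]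
    by auto
  have "hcard \<Phi> = (\<Sum>y\<in>Obj ?H. of_nat (card (?hom (fst y))) / of_nat (card (outs ?H y)))"
    by (rule hc(2)) (use outsH fin_hom in auto)
  also have "\<dots> = (\<Sum>y\<in>Obj ?H. of_nat (card (?hom (fst y))) / fact ?n)"
    by (intro sum.cong) (simp_all add: outsH(2))
  also have "\<dots> = (\<Sum>(xs, \<beta>)\<in>(SIGMA xs:S. hom ?B (map p xs) f). of_nat (card (?hom xs)) / fact ?n)"
    unfolding obH by (simp add: split_def)
  also have "\<dots> = (\<Sum>xs\<in>S. \<Sum>\<beta>\<in>hom ?B (map p xs) f. of_nat (card (?hom xs)) / fact ?n)"
    using finS S(3) finite_hom_Sr[OF B] by (subst sum.Sigma) auto
  also have "\<dots> = (\<Sum>xs\<in>S. if mset (ob D2 xs) = mset a \<and> mset (ob D0 xs) = mset b then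
      of_nat (card (Aut ?B f) * (card (Aut ?B a) * card (Aut ?B b))) / fact ?n else 0)"
  proof (rule sum.cong[OF refl])
    fix xs assume xs: "xs \<in> S"
    then have "card (hom ?B (map p xs) f) = card (Aut ?B f)"
      using card_hom[OF S(3) f] by (auto simp: S_def)
    then show "(\<Sum>\<beta>\<in>hom ?B (map p xs) f. of_nat (card (?hom xs)) / fact ?n) =
        (if mset (ob D2 xs) = mset a \<and> mset (ob D0 xs) = mset b then
         of_nat (card (Aut ?B f) * (card (Aut ?B a) * card (Aut ?B b))) / fact ?n else 0 :: rat)"
      using card_hom[OF D2.ob_in[OF S(1)[OF xs]] a] card_hom[OF D0.ob_in[OF S(1)[OF xs]] b]
      by (simp add: card_cartesian_product)
  qed
  also have "\<dots> = of_nat (card T) * (of_nat (card (Aut ?B f) * (card (Aut ?B a) * card (Aut ?B b))) / fact ?n)"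
    using finS by (simp add: T_def sum.If_cases Int_def)
  finally have hcard: "hcard \<Phi> = of_nat (card T * card (Aut ?B f)) / fact ?n *
      (of_nat (card (Aut ?B a)) * of_nat (card (Aut ?B b)))"
    by simp
  let ?P = "\<lambda>xs. mset (ob D2 xs) = mset a \<and> mset (ob D0 xs) = mset b"
  let ?F = "\<lambda>f'. {xs \<in> Obj ?A. map p xs = f' \<and> ?P xs}"
  have inv: "mset (ob D xs) = mset (ob D ys)"
    if D: "grpd_functor ?A ?B D" and xy: "xs \<in> Obj ?A" "ys \<in> Obj ?A" "mset xs = mset ys" for D xs ys
  proof -
    interpret D: grpd_functor ?A ?B D by (rule D)
    obtain g where "g \<in> hom ?A xs ys"
      using hom_Sr_nonempty_iff[OF A xy(1)] xy(3) by blast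
    then have "ar D g \<in> hom ?B (ob D xs) (ob D ys)" by (auto simp: hom_def)
    then show ?thesis using hom_Sr_nonempty_iff[OF B D.ob_in[OF xy(1)]] by blast
  qed
  \<comment> \<open>Functors preserve isomorphism, so the condition on \<open>D2\<close> and
    \<open>D0\<close> depends on the list only through its multiset; \<open>R\<close> has the form
    that \<open>card_map_fibre_mset\<close> requires.\<close>
  define R where "R m \<longleftrightarrow> (\<exists>xs. xs \<in> Obj ?A \<and> mset xs = m \<and> ?P xs)" for m
  have F_eq: "?F f' = {xs \<in> Obj ?A. map p xs = f' \<and> R (mset xs)}" for f'
    unfolding R_def using inv[OF d2] inv[OF d0] by (safe; metis)
  have finF: "finite (?F f')" if "mset f' = mset f" for f'
    by (rule finite_subset[OF _ finS]) (use that in \<open>auto simp: S_def simp flip: mset_map\<close>)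
  have "T = (\<Union>f'\<in>iso_class ?B f. ?F f')"
    using D1.ob_in by (auto simp: T_def S_def iso_class_Sr[OF B f] d1(2))
  moreover have fin_iso: "finite (iso_class ?B f)"
    using card_outs_Sr(1)[OF B f] by (simp add: B.iso_class_eq_image[OF f])
  ultimately have "card T = (\<Sum>f'\<in>iso_class ?B f. card (?F f'))"
    using finF by (simp only:, intro card_UN_disjoint) (auto simp: iso_class_Sr[OF B f])
  also have "\<dots> = (\<Sum>f'\<in>iso_class ?B f. card (?F f))"
  proof (rule sum.cong[OF refl])
    fix f' assume "f' \<in> iso_class ?B f"
    then have "mset f' = mset f" by (simp add: iso_class_Sr[OF B f])
    then show "card (?F f') = card (?F f)"
      unfolding F_eq using finF[of f'] finF[of f] unfolding F_eq by (intro card_map_fibre_mset) auto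
  qed
  finally have "card T * card (Aut ?B f) = card (?F f) * (card (iso_class ?B f) * card (Aut ?B f))"
    by (simp add: mult_ac)
  also have "card (iso_class ?B f) * card (Aut ?B f) = fact ?n"
    using B.card_outs[OF f] card_outs_Sr[OF B f] by simp
  finally have "of_nat (card T * card (Aut ?B f)) / fact ?n = (of_nat (card (?F f)) :: rat)"
    by simp
  moreover have "card (Aut ?B c) \<noteq> 0" if "c \<in> Obj ?B" for c
    using finite_hom_Sr[OF B that, of c] B.Idn_in_hom[OF that] by (auto simp: Aut_eq_hom)
  ultimately show "hcard \<Phi> / (of_nat (card (Aut ?B a)) * of_nat (card (Aut ?B b))) = of_nat (card (?F f))"
    using a b unfolding hcard by simp
qed


section \<open>The operad of words\<close>

abbreviation (input) T_Ass where "T_Ass \<equiv> T_Mr Ass"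

text \<open>An arrow of \<open>T_operad Ass\<close> is a list of units, which stands for its length.\<close>

definition op_word :: "nat list \<Rightarrow> unit list list" where
  "op_word w = map (\<lambda>k. replicate k ()) w"

text \<open>With a single colour the leaves carry no information beyond their number, so words alone
  parametrise the first level.\<close>

definition tree1 :: "nat list \<Rightarrow> (unit, unit list list) otree" where
  "tree1 w = Node (map (\<lambda>_. Leaf ()) w) (op_word w)"

definition tree2 :: "nat list \<times> nat list list \<Rightarrow> (unit, unit list list) otree" where
  "tree2 y = Node (map tree1 (snd y)) (op_word (fst y))"

section \<open>Lists of units as natural numbers\<close>

lemma unit_list_eq_iff: "(xs :: unit list) = ys \<longleftrightarrow> length xs = length ys"
  by (auto intro: nth_equalityI)

lemma map_eq_map_unit_iff: "map f xs = (map g ys :: unit list) \<longleftrightarrow> length xs = length ys"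
  by (simp only: unit_list_eq_iff length_map)

lemma map_unit [simp]: "map (f :: unit \<Rightarrow> unit) = (\<lambda>xs. xs)"
  by (rule ext) (simp only: unit_list_eq_iff length_map)

lemma concat_replicate_unit: "concat (replicate m (replicate k ())) = replicate (m * k) ()"
  by (simp only: unit_list_eq_iff) (simp add: length_concat sum_list_replicate)

lemma replicate_length_unit [simp]: "replicate (length xs) () = xs"
  by (simp only: unit_list_eq_iff length_replicate)

lemma map_length_op_word [simp]: "map length (op_word w) = w"
  by (simp add: op_word_def comp_def)

lemma op_word_map_length [simp]: "op_word (map length fs) = fs"
  by (simp add: op_word_def comp_def)

lemma length_op_word [simp]: "length (op_word w) = length w"
  by (simp add: op_word_def)

lemma kids_root_tree [simp]:
  "kids (tree1 w) = replicate (length w) (Leaf ())" "root (tree1 w) = op_word w"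
  "kids (tree2 y) = map tree1 (snd y)" "root (tree2 y) = op_word (fst y)"
  by (simp_all add: tree1_def tree2_def map_replicate_const)

lemma inj_tree1: "inj tree1"
  by (metis injI kids_root_tree(2) map_length_op_word)

lemma inj_tree2: "inj tree2"
proof (rule injI)
  fix x y assume eq: "tree2 x = tree2 y"
  have "fst x = fst y"
    using arg_cong[OF eq, of root] by (metis kids_root_tree(4) map_length_op_word)
  moreover have "snd x = snd y"
    using arg_cong[OF eq, of kids] inj_tree1 by simp
  ultimately show "x = y" by (simp add: prod_eq_iff)
qed

text \<open>With one colour, conditions on common inputs and targets are vacuous. An operation is a
  nonempty list of nonempty lists of units, and composing with an arrow \<open>f\<close> repeats the
  other arrow \<open>length f\<close> times, so arities multiply. \<open>Cmp\<close> is evaluated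
  only at equal arguments, as all arrows are identities.\<close>

lemma T_simps:
  "Obj (Col T_Ass) = UNIV" "Arr (Col T_Ass) = UNIV" "Dom (Col T_Ass) = id" "Cod (Col T_Ass) = id" "Idn (Col T_Ass) = id"
  "Obj (Opn T_Ass) = {fs. fs \<noteq> [] \<and> [] \<notin> set fs}" "Arr (Opn T_Ass) = {fs. fs \<noteq> [] \<and> [] \<notin> set fs}"
  "Dom (Opn T_Ass) = id" "Cod (Opn T_Ass) = id" "Idn (Opn T_Ass) = id"
  "Cmp (Opn T_Ass) fs fs = fs"
  "ob (inp T_Ass) = map hd" "ar (inp T_Ass) = map hd"
  "ob (out T_Ass) = (\<lambda>_. ())" "ar (out T_Ass) = (\<lambda>_. ())"
  "ob (cmps T_Ass) = (\<lambda>(gss, fs). concat (map2 (\<lambda>f gs. map (\<lambda>g. concat (replicate (length f) g)) gs) fs gss))"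
  "ar (cmps T_Ass) = (\<lambda>(gss, fs). concat (map2 (\<lambda>f gs. map (\<lambda>g. concat (replicate (length f) g)) gs) fs gss))"
  "ob (unt T_Ass) = (\<lambda>c. [[c]])" "ar (unt T_Ass) = (\<lambda>c. [[c]])"
proof -
  show "Obj (Col T_Ass) = UNIV" "Arr (Col T_Ass) = UNIV" "Dom (Col T_Ass) = id" "Cod (Col T_Ass) = id" "Idn (Col T_Ass) = id"
    "Obj (Opn T_Ass) = {fs. fs \<noteq> [] \<and> [] \<notin> set fs}" "Arr (Opn T_Ass) = {fs. fs \<noteq> [] \<and> [] \<notin> set fs}"
    "Dom (Opn T_Ass) = id" "Cod (Opn T_Ass) = id" "Idn (Opn T_Ass) = id"
    "ob (inp T_Ass) = map hd" "ar (inp T_Ass) = map hd"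
    "ob (out T_Ass) = (\<lambda>_. ())" "ar (out T_Ass) = (\<lambda>_. ())"
    "ob (cmps T_Ass) = (\<lambda>(gss, fs). concat (map2 (\<lambda>f gs. map (\<lambda>g. concat (replicate (length f) g)) gs) fs gss))"
    "ar (cmps T_Ass) = (\<lambda>(gss, fs). concat (map2 (\<lambda>f gs. map (\<lambda>g. concat (replicate (length f) g)) gs) fs gss))"
    "ob (unt T_Ass) = (\<lambda>c. [[c]])" "ar (unt T_Ass) = (\<lambda>c. [[c]])"
    by (auto simp: T_Mr_def T_cat_def T_operad_def Ass_def one_grpd_def Mr_def id_ftor_def id_def fun_eq_iff)
  show "Cmp (Opn T_Ass) fs fs = fs"
    by (simp add: T_Mr_def T_cat_def T_operad_def Ass_def one_grpd_def Mr_def zip_same_conv_map comp_def)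
qed

lemma tree_map2_same:
  assumes "\<And>c. f c c = c" "\<And>q. g q q = q"
  shows "tree_map2 f g x x = x"
  by (induction x) (simp_all add: assms zip_same_conv_map comp_def map_idI)

lemma discrete_bar_level: "discrete (bar_level T_Ass n)"
  by (simp add: discrete_def bar_level_def T_simps tree_map2_same otree.map_id)

text \<open>Over one colour, matching the outputs of the children with the inputs of the root is
  equality of lengths.\<close>

lemma bar_level_Suc:
  "Obj (bar_level T_Ass (Suc n)) = {Node xs q | xs q. xs \<noteq> [] \<and> set xs \<subseteq> Obj (bar_level T_Ass n) \<and>
     [] \<notin> set q \<and> length xs = length q}"
  by (auto simp: bar_level_def T_simps map_eq_map_unit_iff)

lemma bar_level_0: "Obj (bar_level T_Ass 0) = {Leaf ()}"
  by (auto simp: bar_level_def T_simps)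

lemma Words_op_word: "w \<in> Words \<longleftrightarrow> w \<noteq> [] \<and> [] \<notin> set (op_word w)"
  by (auto simp: Words_def op_word_def)

lemma bar_level_1: "Obj (bar_level T_Ass 1) = tree1 ` Words"
proof (intro equalityI subsetI)
  fix x assume "x \<in> Obj (bar_level T_Ass 1)"
  then obtain xs q where x: "x = Node xs q" "xs \<noteq> []" "set xs \<subseteq> {Leaf ()}" "[] \<notin> set q" "length xs = length q"
    using bar_level_Suc[of 0] by (auto simp: bar_level_0)
  have "xs = replicate (length q) (Leaf ())"
    using x by (intro replicate_eqI) auto
  then have "x = tree1 (map length q)"
    by (simp add: x(1) tree1_def map_replicate_const)
  moreover have "map length q \<in> Words"
    using x by (auto simp: Words_op_word)
  ultimately show "x \<in> tree1 ` Words" by blast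
next
  fix x assume "x \<in> tree1 ` Words"
  then show "x \<in> Obj (bar_level T_Ass 1)"
    using bar_level_Suc[of 0] by (auto simp: bar_level_0 tree1_def Words_op_word)
qed

lemma subset_image_listE:
  assumes "set xs \<subseteq> f ` S"
  obtains vs where "xs = map f vs" "set vs \<subseteq> S"
proof -
  have "xs \<in> lists (f ` S)" using assms by auto
  then have "xs \<in> map f ` lists S" by (simp only: lists_image)
  then show ?thesis using that by auto
qed

lemma bar_level_2: "Obj (bar_level T_Ass 2) = tree2 ` {y. decomp_pair y}"
proof (intro equalityI subsetI)
  have two: "2 = Suc 1" by simp
  fix x assume "x \<in> Obj (bar_level T_Ass 2)"
  then obtain xs q where x: "x = Node xs q" "xs \<noteq> []" "set xs \<subseteq> tree1 ` Words" "[] \<notin> set q" "length xs = length q"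
    unfolding two bar_level_Suc bar_level_1 by blast
  from x(3) obtain vs where vs: "xs = map tree1 vs" "set vs \<subseteq> Words"
    by (rule subset_image_listE)
  have "x = tree2 (map length q, vs)" using x vs by (simp add: tree2_def)
  moreover have "decomp_pair (map length q, vs)"
    using x vs by (auto simp: decomp_pair_def Words_op_word)
  ultimately show "x \<in> tree2 ` {y. decomp_pair y}" by blast
next
  have two: "2 = Suc 1" by simp
  fix x assume "x \<in> tree2 ` {y. decomp_pair y}"
  then obtain y where x: "x = tree2 y" and y: "decomp_pair y" by blast
  then have "snd y \<noteq> []" "set (map tree1 (snd y)) \<subseteq> tree1 ` Words" "[] \<notin> set (op_word (fst y))"
    by (auto simp: decomp_pair_def Words_op_word[of "fst y"])
  then show "x \<in> Obj (bar_level T_Ass 2)"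
    unfolding two bar_level_Suc bar_level_1 x tree2_def using y by (auto simp: decomp_pair_def)
qed

section \<open>The simplicial structure in low degrees\<close>

abbreviation (input) B_T_Ass where "B_T_Ass \<equiv> bar_Sr T_Ass"

abbreviation (input) "T_Ass_level n \<equiv> bar_level T_Ass n"

lemma bar_Sr_simps:
  "Lvl B_T_Ass n = Sr (T_Ass_level n)"
  "Fc B_T_Ass 2 0 = Sr_map (inner_face T_Ass 2 0)" "Fc B_T_Ass 2 1 = Sr_map (inner_face T_Ass 2 1)"
  "Fc B_T_Ass 2 2 = Sr_mult \<circ>\<^sub>F Sr_map (Mr_to_Sr \<circ>\<^sub>F discard_root)"
  "Dg B_T_Ass 0 0 = Sr_map (degeneracy T_Ass 0 0)"
  by (simp_all add: bar_Sr_def)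

lemma ob_Sr_map: "ob (Sr_map F) xs = map (ob F) xs"
  by (simp add: Sr_map_def)

text \<open>Repeating a list of \<open>k\<close> units \<open>m\<close> times gives
  \<open>m * k\<close> units, so the operadic composite is \<open>subst_word\<close>.\<close>

lemma op_word_subst_word:
  "length om = length vs \<Longrightarrow>
    concat (map2 (\<lambda>f gs. map (\<lambda>g. concat (replicate (length f) g)) gs) (op_word om) (map op_word vs)) =
    op_word (subst_word om vs)"
  by (induction om vs rule: list_induct2)
     (auto simp: op_word_def concat_replicate_unit)

text \<open>Each upper word brings as many leaves as it has letters, and grafting keeps the number
  of letters, so the gathered leaves fit the composed word.\<close>

lemma inner_face_1:
  assumes "decomp_pair y"
  shows "ob (inner_face T_Ass 2 1) (tree2 y) = tree1 (case_prod subst_word y)"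
proof -
  have two: "2 = Suc 1" by simp
  have "concat (map (\<lambda>v. replicate (length v) (Leaf ())) (snd y)) =
      replicate (length (case_prod subst_word y)) (Leaf () :: (unit, unit list list) otree)"
  proof -
    have "concat (map (\<lambda>v. replicate (length v) c) vs) = replicate (sum_list (map length vs)) c"
      for vs :: "nat list list" and c :: "(unit, unit list list) otree"
      by (induction vs) (auto simp: replicate_add)
    then show ?thesis using assms by (simp add: split_def length_subst_word decomp_pair_def)
  qed
  then show ?thesis
    using assms op_word_subst_word[of "fst y" "snd y"]
    unfolding two by (simp add: inner_face_def T_simps comp_def split_def decomp_pair_def
        tree1_def[of "subst_word _ _"] map_replicate_const)
qed

lemma inner_face_0:
  assumes "decomp_pair y"
  shows "ob (inner_face T_Ass 2 0) (tree2 y) = tree1 (fst y)"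
proof -
  have two: "2 = Suc (Suc 0)" by simp
  show ?thesis using assms
    unfolding two by (simp add: inner_face_def T_simps tree1_def[of "fst y"] map_replicate_const decomp_pair_def comp_def)
qed

lemma functor_inner_face:
  assumes "i < 2"
  shows "grpd_functor (Sr (T_Ass_level 2)) (Sr (T_Ass_level 1)) (Sr_map (inner_face T_Ass 2 i))"
proof (rule functor_Sr_map[OF discrete_bar_level discrete_bar_level])
  fix x assume x: "x \<in> Obj (T_Ass_level 2)"
  then obtain y where y: "x = tree2 y" "decomp_pair y" by (auto simp: bar_level_2)
  have "i = 0 \<or> i = 1" using assms by auto
  then show "ob (inner_face T_Ass 2 i) x \<in> Obj (T_Ass_level 1)"
    using y decomp_pair_Words[OF y(2)]
    by (auto simp: inner_face_0 inner_face_1 bar_level_1 decomp_pair_def simp del: One_nat_def)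
  show "ar (inner_face T_Ass 2 i) x = ob (inner_face T_Ass 2 i) x"
    by (simp add: inner_face_def T_simps)
qed

lemma functor_flatten: "grpd_functor (Sr (T_Ass_level 2)) (Sr (T_Ass_level 1)) (Fc B_T_Ass 2 2)"
  unfolding bar_Sr_simps
proof (rule functor_concat[OF discrete_bar_level discrete_bar_level, where q = kids])
  let ?F = "Sr_mult \<circ>\<^sub>F Sr_map (Mr_to_Sr \<circ>\<^sub>F discard_root)"
  show "kids x \<noteq> [] \<and> set (kids x) \<subseteq> Obj (T_Ass_level 1)" if x: "x \<in> Obj (T_Ass_level 2)" for x
  proof -
    obtain y where y: "x = tree2 y" "decomp_pair y" using x by (auto simp: bar_level_2)
    then have "snd y \<noteq> []" "set (snd y) \<subseteq> Words"
      by (auto simp: decomp_pair_def Words_def)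
    then show ?thesis by (simp add: y(1) bar_level_1 image_mono del: One_nat_def)
  qed
  show "ob ?F xs = concat (map kids xs)" for xs
    by (simp add: Sr_mult_def Sr_map_def Mr_to_Sr_def discard_root_def comp_ftor_def)
  fix xs :: "(unit, unit list list) otree list" and ns
  assume xs: "xs \<in> Obj (Sr (T_Ass_level 2))" and ns: "ns \<in> Perms (length xs)"
  let ?len = "\<lambda>l. length (kids (xs ! l))"
  define pss where "pss = map (\<lambda>k. (k, enumerate 0 (kids (xs ! k)))) ns"
  \<comment> \<open>\<open>block_start\<close> looks up source lengths in the permuted list; every
    index occurs there, so the lookups return the lengths in their original order.\<close>
  have start: "block_start pss k = (\<Sum>l<k. ?len l)" if "k < length xs" for k
  proof -
    have "map_of pss l = Some (enumerate 0 (kids (xs ! l)))" if "l \<in> set ns" for l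
      using that unfolding pss_def by (induction ns) auto
    then show ?thesis
      using that ns unfolding block_start_def by (intro sum.cong) (auto simp: in_Perms_iff)
  qed
  have "ar ?F (sarr xs ns) = concat (map (\<lambda>(k, ps). map (\<lambda>(j, f). (block_start pss k + j, f)) ps) pss)"
    by (simp add: comp_ftor_def Sr_mult_def Sr_map_def Mr_to_Sr_def discard_root_def sarr_def pss_def comp_def)
  also have "\<dots> = concat (map (\<lambda>k. map (\<lambda>(j, f). (block_start pss k + j, f)) (enumerate 0 (kids (xs ! k)))) ns)"
    by (simp add: pss_def comp_def)
  also have "\<dots> = concat (map (\<lambda>k. map (\<lambda>j. ((\<Sum>l<k. ?len l) + j, concat (map kids xs) ! ((\<Sum>l<k. ?len l) + j)))
      [0..<?len k]) ns)"
    using Perms_lessI[OF ns]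
    by (intro arg_cong[of _ _ concat] map_cong nth_equalityI)
       (auto simp: start nth_enumerate_eq concat_map_nth)
  also have "\<dots> = sarr (concat (map kids xs)) (block_perm ?len ns)"
    by (simp add: sarr_def block_perm_def map_concat comp_def)
  finally show "ar ?F (sarr xs ns) = sarr (concat (map kids xs)) (block_perm ?len ns)" .
qed

lemma ob_flatten: "ob (Fc B_T_Ass 2 2) xs = concat (map kids xs)"
  by (simp add: bar_Sr_simps Sr_mult_def Sr_map_def Mr_to_Sr_def discard_root_def comp_ftor_def)

section \<open>Incidence coefficients as numbers of decompositions\<close>

lemma Obj_L1: "Obj (Sr (T_Ass_level 1)) = map tree1 ` {ws. ws \<noteq> [] \<and> set ws \<subseteq> Words}"
proof (intro equalityI subsetI)
  fix xs assume "xs \<in> Obj (Sr (T_Ass_level 1))"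
  then have "xs \<noteq> []" "set xs \<subseteq> tree1 ` Words" by (simp_all add: Obj_Sr bar_level_1 del: One_nat_def)
  moreover from this(2) obtain ws where "xs = map tree1 ws" "set ws \<subseteq> Words"
    by (rule subset_image_listE)
  ultimately show "xs \<in> map tree1 ` {ws. ws \<noteq> [] \<and> set ws \<subseteq> Words}" by auto
qed (auto simp: Obj_Sr bar_level_1 image_mono simp del: One_nat_def intro!: imageI)

lemma mset_map_tree1: "mset (map tree1 us) = mset (map tree1 vs) \<longleftrightarrow> mon us = mon vs"
proof
  assume "mset (map tree1 us) = mset (map tree1 vs)"
  then have "image_mset (inv tree1) (mset (map tree1 us)) = image_mset (inv tree1) (mset (map tree1 vs))"
    by (rule arg_cong)
  then show "mon us = mon vs"
    using inj_tree1 by (simp add: mon_eq_iff image_mset.compositionality comp_def)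
qed (simp add: mon_eq_iff)

text \<open>Each list of decompositions contributes 1 to exactly one pair of monomials, so the
  coefficient is a count, as is the output of \<open>Sr_double_fibre\<close>.\<close>

lemma lookup_word_comult:
  "Poly_Mapping.lookup (word_comult (mon ws)) (mon us, mon vs) =
    of_nat (card {ys \<in> listset (map decomp ws). mon (concat (map snd ys)) = mon us \<and> mon (map fst ys) = mon vs})"
proof -
  have "finite (listset (map decomp ws))"
    by (rule finite_listset) (auto simp: finite_decomp)
  then show ?thesis
    by (simp add: word_comult_mon lookup_sum lookup_single when_def sum.If_cases Int_def)
qed

lemma finite_fibre_L2: "y \<in> Obj (T_Ass_level 1) \<Longrightarrow> finite {x \<in> Obj (T_Ass_level 2). ob (inner_face T_Ass 2 1) x = y}"
proof -
  assume "y \<in> Obj (T_Ass_level 1)"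
  then obtain w where y: "y = tree1 w" unfolding bar_level_1 by blast
  have "{x \<in> Obj (T_Ass_level 2). ob (inner_face T_Ass 2 1) x = y} \<subseteq> tree2 ` decomp w"
    using inj_tree1
    by (auto simp: bar_level_2 y in_decomp_iff inner_face_1 inj_eq simp del: One_nat_def)
  then show ?thesis using finite_decomp finite_surj by blast
qed

text \<open>By \<open>Sr_double_fibre\<close> the coefficient counts lists of two-level trees
  composing to exactly \<open>ws\<close>, with upper words and roots prescribed up to order;
  \<open>tree2\<close> matches them with the lists in \<open>lookup_word_comult\<close>.\<close>

lemma incidence_T:
  assumes "ws \<noteq> []" "set ws \<subseteq> Words" "us \<noteq> []" "set us \<subseteq> Words" "vs \<noteq> []" "set vs \<subseteq> Words"
  shows "hfinite (Phi B_T_Ass (map tree1 ws) (map tree1 us) (map tree1 vs))"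
    and "incidence_coeff B_T_Ass (map tree1 ws) (map tree1 us) (map tree1 vs) =
      Poly_Mapping.lookup (word_comult (mon ws)) (mon us, mon vs)"
proof -
  have obj: "map tree1 ws \<in> Obj (Sr (T_Ass_level 1))" "map tree1 us \<in> Obj (Sr (T_Ass_level 1))" "map tree1 vs \<in> Obj (Sr (T_Ass_level 1))"
    using assms unfolding Obj_L1 by blast+
  note fibre = Sr_double_fibre[OF discrete_bar_level discrete_bar_level functor_inner_face ob_Sr_map
      functor_flatten[unfolded bar_Sr_simps] functor_inner_face finite_fibre_L2 obj, of 0]
  show "hfinite (Phi B_T_Ass (map tree1 ws) (map tree1 us) (map tree1 vs))"
    unfolding Phi_def bar_Sr_simps by (rule fibre(1)) simp_all
  let ?C = "{xs \<in> Obj (Sr (T_Ass_level 2)). map (ob (inner_face T_Ass 2 1)) xs = map tree1 ws \<and>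
      mset (concat (map kids xs)) = mset (map tree1 us) \<and> mset (map (ob (inner_face T_Ass 2 0)) xs) = mset (map tree1 vs)}"
  let ?D = "{ys \<in> listset (map decomp ws). mon (concat (map snd ys)) = mon us \<and> mon (map fst ys) = mon vs}"
  have ob: "map (ob (inner_face T_Ass 2 1)) (map tree2 ys) = map tree1 (map (case_prod subst_word) ys)"
    "concat (map kids (map tree2 ys)) = map tree1 (concat (map snd ys))"
    "map (ob (inner_face T_Ass 2 0)) (map tree2 ys) = map tree1 (map fst ys)"
    if "\<forall>y\<in>set ys. decomp_pair y" for ys
    using that by (simp_all add: inner_face_0 inner_face_1 map_concat comp_def del: One_nat_def)
  have "?C = map tree2 ` ?D"
  proof (intro equalityI subsetI)
    fix xs assume xs: "xs \<in> ?C"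
    then have "set xs \<subseteq> tree2 ` {y. decomp_pair y}" by (simp add: Obj_Sr bar_level_2)
    then obtain ys where ys: "xs = map tree2 ys" "set ys \<subseteq> {y. decomp_pair y}"
      by (rule subset_image_listE)
    then have valid: "\<forall>y\<in>set ys. decomp_pair y" by blast
    with xs ys ob[OF valid] have "ys \<in> ?D"
      using inj_tree1 by (simp add: in_listset_decomp mset_map_tree1 del: mset_map map_map)
    with ys show "xs \<in> map tree2 ` ?D" by blast
  next
    fix xs assume "xs \<in> map tree2 ` ?D"
    then obtain ys where ys: "xs = map tree2 ys" "ys \<in> ?D" by blast
    then have valid: "\<forall>y\<in>set ys. decomp_pair y" and ws: "map (case_prod subst_word) ys = ws"
      by (auto simp: in_listset_decomp)
    \<comment> \<open>Objects of \<open>Sr\<close> are nonempty lists, whereas the empty list of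
      decompositions lies over the empty \<open>ws\<close>.\<close>
    have "ys \<noteq> []" using ws assms by auto
    then show "xs \<in> ?C"
      using ys valid ws ob[OF valid]
      by (auto simp: Obj_Sr bar_level_2 mset_map_tree1 simp del: mset_map map_map One_nat_def)
  qed
  moreover have "inj_on (map tree2) ?D"
    using inj_tree2 by (simp add: inj_on_def)
  ultimately have "card ?C = card ?D" by (simp add: card_image)
  then show "incidence_coeff B_T_Ass (map tree1 ws) (map tree1 us) (map tree1 vs) =
      Poly_Mapping.lookup (word_comult (mon ws)) (mon us, mon vs)"
    unfolding incidence_coeff_def Phi_def bar_Sr_simps lookup_word_comult
    using fibre(2) by (simp add: ob_Sr_map ob_flatten[unfolded bar_Sr_simps] del: ob_simps One_nat_def mset_map map_map)
qed


section \<open>The isomorphism\<close>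

definition cls :: "monomial \<Rightarrow> (unit, unit list list) otree list set" where
  "cls m = map tree1 ` {ws. mon ws = m}"

text \<open>The bar construction has only nonempty lists, so the constant monomial goes to the
  adjoined unit.\<close>

definition basis_map :: "monomial \<Rightarrow> (unit, unit list list) otree list set option" where
  "basis_map m = (if m = 0 then None else Some (cls m))"

lemma iso_class_L1:
  assumes "ws \<noteq> []" "set ws \<subseteq> Words"
  shows "iso_class (Sr (T_Ass_level 1)) (map tree1 ws) = cls (mon ws)"
proof -
  have obj: "map tree1 ws \<in> Obj (Sr (T_Ass_level 1))" using assms unfolding Obj_L1 by blast
  have "vs \<noteq> [] \<and> set vs \<subseteq> Words" if "mon vs = mon ws" for vs
    using that assms by (metis keys_mon mon_eq_0_iff)
  then show ?thesis
    unfolding iso_class_Sr[OF discrete_bar_level obj] cls_def Obj_L1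
    by (auto simp: mset_map_tree1 simp del: mset_map)
qed

lemma pi0_L1: "pi0 (Sr (T_Ass_level 1)) = cls ` (monomials - {0})"
proof (intro equalityI subsetI)
  fix c assume "c \<in> pi0 (Sr (T_Ass_level 1))"
  then obtain ws where ws: "ws \<noteq> []" "set ws \<subseteq> Words" "c = iso_class (Sr (T_Ass_level 1)) (map tree1 ws)"
    unfolding pi0_def Obj_L1 by blast
  then show "c \<in> cls ` (monomials - {0})"
    unfolding ws(3) iso_class_L1[OF ws(1,2)] by (intro imageI) (simp add: monomials_def)
next
  fix c assume "c \<in> cls ` (monomials - {0})"
  then obtain m where m: "c = cls m" "m \<in> monomials" "m \<noteq> 0" by blast
  obtain ws where "mon ws = m" using ex_mon by metis
  with m have ws: "ws \<noteq> []" "set ws \<subseteq> Words" "c = cls (mon ws)"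
    by (auto simp: monomials_def)
  then have "map tree1 ws \<in> Obj (Sr (T_Ass_level 1))" unfolding Obj_L1 by blast
  then show "c \<in> pi0 (Sr (T_Ass_level 1))"
    unfolding pi0_def ws(3) iso_class_L1[OF ws(1,2), symmetric] by (rule imageI)
qed

lemma inj_cls: "inj cls"
proof (rule injI)
  fix m n assume eq: "cls m = cls n"
  obtain ws where ws: "mon ws = m" using ex_mon by metis
  then have "map tree1 ws \<in> cls m" by (simp add: cls_def)
  then have "map tree1 ws \<in> cls n" by (simp only: eq)
  then obtain vs where vs: "map tree1 ws = map tree1 vs" "mon vs = n"
    unfolding cls_def by (elim imageE) simp
  with inj_tree1 have "ws = vs" by simp
  with ws vs show "m = n" by simp
qed

lemma rep_cls:
  assumes "m \<in> monomials" "m \<noteq> 0"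
  obtains ws where "rep (cls m) = map tree1 ws" "mon ws = m" "ws \<noteq> []" "set ws \<subseteq> Words"
proof -
  obtain vs where "mon vs = m" using ex_mon by metis
  then have "map tree1 vs \<in> cls m" by (auto simp: cls_def)
  then have "rep (cls m) \<in> cls m" unfolding rep_def by (rule someI)
  then obtain ws where "rep (cls m) = map tree1 ws" "mon ws = m"
    unfolding cls_def by (elim imageE) simp
  with assms that show ?thesis by (auto simp: monomials_def)
qed

lemma inj_basis_map: "inj basis_map"
  using inj_cls by (auto simp: inj_def basis_map_def)

lemma coeff_cls:
  assumes "ws \<noteq> []" "set ws \<subseteq> Words" "m \<in> monomials" "m \<noteq> 0" "n \<in> monomials" "n \<noteq> 0"
  shows "incidence_coeff B_T_Ass (map tree1 ws) (rep (cls m)) (rep (cls n)) =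
    Poly_Mapping.lookup (word_comult (mon ws)) (m, n)"
proof -
  obtain us where "rep (cls m) = map tree1 us" "mon us = m" "us \<noteq> []" "set us \<subseteq> Words"
    using rep_cls assms by metis
  moreover obtain vs where "rep (cls n) = map tree1 vs" "mon vs = n" "vs \<noteq> []" "set vs \<subseteq> Words"
    using rep_cls assms by metis
  ultimately show ?thesis using incidence_T(2)[of ws us vs] assms by simp
qed

lemma lookup_lin_inj:
  assumes "inj g"
  shows "Poly_Mapping.lookup (lin (\<lambda>x. basis_elt (g x)) p) (g x) = Poly_Mapping.lookup p x"
proof -
  have "Poly_Mapping.lookup (lin (\<lambda>x. basis_elt (g x)) p) (g x) =
      (\<Sum>y\<in>Poly_Mapping.keys p. if y = x then Poly_Mapping.lookup p y else 0)"
    unfolding lin_def lookup_sum using assms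
    by (intro sum.cong) (auto simp: lookup_single when_def inj_eq)
  then show ?thesis by (simp add: in_keys_iff)
qed

text \<open>A decomposition has a nonempty root and at least one upper word, so no constant factor
  arises. This fits the incidence comultiplication, in which the adjoined unit appears only in its
  own coproduct.\<close>

lemma word_comult_nonzero_keys:
  assumes "m \<noteq> 0" "(y, z) \<in> Poly_Mapping.keys (word_comult m)"
  shows "y \<in> monomials - {0}" "z \<in> monomials - {0}"
proof -
  obtain ws where ws: "m = mon ws" using ex_mon by metis
  from assms(2) have "(y, z) \<in> (\<Union>ys\<in>listset (map decomp ws).
      Poly_Mapping.keys (basis_elt (mon (concat (map snd ys)), mon (map fst ys))))"
    unfolding ws word_comult_mon by (rule subsetD[OF keys_sum])
  then obtain ys where ys: "ys \<in> listset (map decomp ws)"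
    "y = mon (concat (map snd ys))" "z = mon (map fst ys)" by (elim UN_E) simp
  note valid = ys(1)[unfolded in_listset_decomp]
  have "ys \<noteq> []"
  proof
    assume "ys = []"
    with valid have "ws = []" by simp
    with ws assms(1) show False by simp
  qed
  moreover have "snd x \<noteq> []" if "x \<in> set ys" for x
  proof -
    have "decomp_pair x" using that valid by blast
    then show ?thesis by (auto simp: decomp_pair_def Words_def)
  qed
  ultimately have "concat (map snd ys) \<noteq> []" "map fst ys \<noteq> []"
    by (cases ys; simp)+
  then have "y \<noteq> 0" "z \<noteq> 0"
    unfolding ys(2,3) mon_eq_0_iff by blast+
  then show "y \<in> monomials - {0}" "z \<in> monomials - {0}"
    using assms(2) keys_word_comult[of m] by blast+
qed

text \<open>A list of equal entries has no other rearrangement, so all arrows leaving it are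
  automorphisms.\<close>

lemma hom_units:
  assumes "n > 0"
  defines "u \<equiv> replicate n (tree1 [1])"
  shows "card (hom (Sr (T_Ass_level 1)) u u) = fact n"
proof -
  interpret groupoid "Sr (T_Ass_level 1)" by (rule groupoid_Sr[OF discrete_bar_level])
  have obj: "u \<in> Obj (Sr (T_Ass_level 1))"
    using assms by (simp add: Obj_Sr bar_level_1 Words_def del: One_nat_def)
  have "ys = u" if "mset ys = mset u" for ys
  proof -
    have "set ys = set u" "length ys = n"
      using mset_eq_setD[OF that] mset_eq_length[OF that] by (auto simp: u_def)
    then show ?thesis unfolding u_def by (intro replicate_eqI) (auto simp: u_def)
  qed
  then have "iso_class (Sr (T_Ass_level 1)) u = {u}"
    unfolding iso_class_Sr[OF discrete_bar_level obj] using obj by auto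
  then show ?thesis
    using card_outs[OF obj] card_outs_Sr[OF discrete_bar_level obj]
    by (simp add: Aut_eq_hom u_def)
qed

text \<open>An object of level 0 is determined by its length and goes to a list of words [1]. The
  fibre is empty unless \<open>ws\<close> consists of such words; otherwise n! labels are weighed
  against n! arrows leaving the list of leaves, which gives 1.\<close>

lemma incidence_counit_T:
  assumes "ws \<noteq> []" "set ws \<subseteq> Words"
  shows "hfinite (hfib (Lvl B_T_Ass 0) (Lvl B_T_Ass 1) (Dg B_T_Ass 0 0) (map tree1 ws))"
    and "incidence_counit B_T_Ass (map tree1 ws) = eval_mon (mon ws) (nc_var 1)"
proof -
  let ?f = "map tree1 ws" and ?D = "Sr_map (degeneracy T_Ass 0 0)"
  have ob: "ob (degeneracy T_Ass 0 0) (Leaf ()) = tree1 [1]" "ar (degeneracy T_Ass 0 0) = ob (degeneracy T_Ass 0 0)"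
    by (simp_all add: degeneracy_def T_simps tree1_def op_word_def)
  interpret D: grpd_functor "Sr (T_Ass_level 0)" "Sr (T_Ass_level 1)" ?D
    by (rule functor_Sr_map[OF discrete_bar_level discrete_bar_level])
       (auto simp: bar_level_0 ob bar_level_1 Words_def simp del: One_nat_def)
  have obj: "?f \<in> Obj (Sr (T_Ass_level 1))" using assms unfolding Obj_L1 by blast
  define S :: "(unit, unit list list) otree list set" where
    "S = (if set ws \<subseteq> {[1]} then {replicate (length ws) (Leaf ())} else {})"
  have obD: "ob ?D xs = replicate (length xs) (tree1 [1])" if "xs \<in> Obj (Sr (T_Ass_level 0))" for xs
    using that by (intro replicate_eqI) (auto simp: ob_Sr_map Obj_Sr bar_level_0 ob)
  have empty: "hom (Sr (T_Ass_level 1)) (ob ?D xs) ?f = {}" if xs: "xs \<in> Obj (Sr (T_Ass_level 0)) - S" for xs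
  proof (rule ccontr)
    assume "hom (Sr (T_Ass_level 1)) (ob ?D xs) ?f \<noteq> {}"
    then have eq: "mset (replicate (length xs) (tree1 [1])) = mset ?f"
      using xs hom_Sr_nonempty_iff[OF discrete_bar_level D.ob_in, of xs ?f] obD[of xs] by auto
    have len: "length xs = length ws" using mset_eq_length[OF eq] by simp
    have "tree1 ` set ws \<subseteq> {tree1 [1]}" using mset_eq_setD[OF eq] by auto
    then have "set ws \<subseteq> {[1]}" using inj_tree1 by (auto simp: inj_eq simp del: One_nat_def)
    moreover have "xs = replicate (length ws) (Leaf ())"
      using xs len by (intro replicate_eqI) (auto simp: Obj_Sr bar_level_0)
    ultimately show False using xs by (simp add: S_def)
  qed
  have S: "S \<subseteq> Obj (Sr (T_Ass_level 0))" using assms by (auto simp: S_def Obj_Sr bar_level_0)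
  have fin: "finite (outs (Sr (T_Ass_level 0)) xs)" "finite (hom (Sr (T_Ass_level 1)) (ob ?D xs) ?f)" if "xs \<in> S" for xs
    using that S card_outs_Sr(1)[OF discrete_bar_level] finite_hom_Sr[OF discrete_bar_level D.ob_in] by blast+
  have "finite S" by (simp add: S_def)
  note H = D.hcard_hfib[OF this S empty fin]
  show "hfinite (hfib (Lvl B_T_Ass 0) (Lvl B_T_Ass 1) (Dg B_T_Ass 0 0) ?f)"
    unfolding bar_Sr_simps by (rule H(2))
  have "incidence_counit B_T_Ass ?f =
      (\<Sum>xs\<in>S. of_nat (card (hom (Sr (T_Ass_level 1)) (ob ?D xs) ?f)) / of_nat (card (outs (Sr (T_Ass_level 0)) xs)))"
    unfolding incidence_counit_def bar_Sr_simps by (rule H(3))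
  also have "\<dots> = (\<Sum>xs\<in>S. 1)"
  proof (rule sum.cong[OF refl])
    fix xs assume xs: "xs \<in> S"
    then have ws: "set ws \<subseteq> {[1]}" and len: "length xs = length ws"
      by (auto simp: S_def split: if_splits)
    have "?f = replicate (length ws) (tree1 [1])"
      using ws by (intro replicate_eqI) (auto simp del: One_nat_def)
    then have "card (hom (Sr (T_Ass_level 1)) (ob ?D xs) ?f) = fact (length ws)"
      using xs S obD[of xs] len hom_units[of "length ws"] assms by auto
    moreover have "card (outs (Sr (T_Ass_level 0)) xs) = fact (length ws)"
      using xs S card_outs_Sr(2)[OF discrete_bar_level] len by auto
    ultimately show "of_nat (card (hom (Sr (T_Ass_level 1)) (ob ?D xs) ?f)) / of_nat (card (outs (Sr (T_Ass_level 0)) xs)) = (1 :: rat)"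
      by simp
  qed
  also have "\<dots> = eval_mon (mon ws) (nc_var 1)"
    unfolding eval_mon_nc_var_mon by (simp add: S_def)
  finally show "incidence_counit B_T_Ass ?f = eval_mon (mon ws) (nc_var 1)" .
qed

lemma incidence_finite_T: "incidence_finite B_T_Ass"
  unfolding incidence_finite_def
proof (intro ballI conjI)
  fix f assume f: "f \<in> Obj (Lvl B_T_Ass 1)"
  then obtain ws where ws: "f = map tree1 ws" "ws \<noteq> []" "set ws \<subseteq> Words"
    unfolding bar_Sr_simps Obj_L1 by blast
  show "finite (Aut (Lvl B_T_Ass 1) f)"
    using f finite_hom_Sr[OF discrete_bar_level] by (simp add: Aut_eq_hom bar_Sr_simps)
  show "hfinite (hfib (Lvl B_T_Ass 0) (Lvl B_T_Ass 1) (Dg B_T_Ass 0 0) f)"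
    unfolding ws(1) by (rule incidence_counit_T[OF ws(2,3)])
  show "hfinite (Phi B_T_Ass f a b)" if "a \<in> Obj (Lvl B_T_Ass 1)" "b \<in> Obj (Lvl B_T_Ass 1)" for a b
  proof -
    obtain us vs where "a = map tree1 us" "us \<noteq> []" "set us \<subseteq> Words" "b = map tree1 vs" "vs \<noteq> []" "set vs \<subseteq> Words"
      using \<open>a \<in> Obj (Lvl B_T_Ass 1)\<close> \<open>b \<in> Obj (Lvl B_T_Ass 1)\<close> unfolding bar_Sr_simps Obj_L1 by blast
    then show ?thesis using incidence_T(1) ws by simp
  qed
  show "finite {(a, b). a \<in> pi0 (Lvl B_T_Ass 1) \<and> b \<in> pi0 (Lvl B_T_Ass 1) \<and> incidence_coeff B_T_Ass f (rep a) (rep b) \<noteq> 0}"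
  proof (rule finite_surj)
    show "{(a, b). a \<in> pi0 (Lvl B_T_Ass 1) \<and> b \<in> pi0 (Lvl B_T_Ass 1) \<and> incidence_coeff B_T_Ass f (rep a) (rep b) \<noteq> 0}
        \<subseteq> map_prod cls cls ` Poly_Mapping.keys (word_comult (mon ws))"
    proof (rule subrelI)
      fix a b assume "(a, b) \<in> {(a, b). a \<in> pi0 (Lvl B_T_Ass 1) \<and> b \<in> pi0 (Lvl B_T_Ass 1) \<and>
        incidence_coeff B_T_Ass f (rep a) (rep b) \<noteq> 0}"
      then obtain m n where "a = cls m" "m \<in> monomials" "m \<noteq> 0" "b = cls n" "n \<in> monomials" "n \<noteq> 0"
        "incidence_coeff B_T_Ass f (rep a) (rep b) \<noteq> 0"
        unfolding bar_Sr_simps pi0_L1 by blast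
      then show "(a, b) \<in> map_prod cls cls ` Poly_Mapping.keys (word_comult (mon ws))"
        using coeff_cls[OF ws(2,3)] by (force simp: ws(1) in_keys_iff)
    qed
  qed simp
qed

text \<open>Juxtaposing representatives concatenates lists of words, which \<open>mon\<close> turns
  into the product of monomials.\<close>

lemma mult_basis_map:
  assumes "m \<in> monomials" "n \<in> monomials"
  shows "bialg.mult (incidence_bialgebra B_T_Ass (@)) (basis_map m) (basis_map n) = basis_elt (basis_map (m + n))"
proof (cases "m = 0 \<or> n = 0")
  case True
  then show ?thesis by (auto simp: incidence_bialgebra_def basis_map_def split: option.split)
next
  case False
  obtain ws where ws: "rep (cls m) = map tree1 ws" "mon ws = m" "ws \<noteq> []" "set ws \<subseteq> Words"
    using rep_cls assms False by metis
  obtain vs where vs: "rep (cls n) = map tree1 vs" "mon vs = n" "vs \<noteq> []" "set vs \<subseteq> Words"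
    using rep_cls assms False by metis
  have "iso_class (Sr (T_Ass_level 1)) (map tree1 (ws @ vs)) = cls (m + n)"
    using iso_class_L1[of "ws @ vs"] ws vs by simp
  moreover have "m + n \<noteq> 0"
    using ws vs mon_eq_0_iff[of "ws @ vs"] by auto
  ultimately show ?thesis
    using False ws(1) vs(1) by (simp add: incidence_bialgebra_def basis_map_def bar_Sr_simps)
qed

text \<open>The coefficient function is shown to be that of a given polynomial, so inverting
  \<open>Abs_poly_mapping\<close> needs no separate proof of finite support.\<close>

lemma comult_basis_map:
  assumes "m \<in> monomials"
  shows "comult (incidence_bialgebra B_T_Ass (@)) (basis_map m) =
    lin (\<lambda>(y, z). basis_elt (basis_map y, basis_map z)) (word_comult m)"
proof (cases "m = 0")
  case True
  then show ?thesis
    by (simp add: incidence_bialgebra_def basis_map_def word_comult_zero_pair del: word_comult_zero)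
next
  case False
  obtain ws where ws: "rep (cls m) = map tree1 ws" "mon ws = m" "ws \<noteq> []" "set ws \<subseteq> Words"
    using rep_cls assms False by metis
  let ?g = "\<lambda>y. (basis_map (fst y), basis_map (snd y))"
  let ?R = "lin (\<lambda>y. basis_elt (?g y)) (word_comult m)"
  have "inj ?g" using inj_basis_map by (auto simp: inj_def)
  note lookup_g = lookup_lin_inj[OF this, of "word_comult m"]
  have keys_R: "w \<in> ?g ` Poly_Mapping.keys (word_comult m)" if "Poly_Mapping.lookup ?R w \<noteq> 0" for w
    using that keys_lin[of "\<lambda>y. basis_elt (?g y)" "word_comult m"] by (auto simp: in_keys_iff)
  let ?C = "\<lambda>w. case w of (Some a, Some b) \<Rightarrow>
      (if a \<in> pi0 (Lvl B_T_Ass 1) \<and> b \<in> pi0 (Lvl B_T_Ass 1) then incidence_coeff B_T_Ass (rep (cls m)) (rep a) (rep b) else 0)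
    | _ \<Rightarrow> 0"
  have "?C w = Poly_Mapping.lookup ?R w" for w
  proof (cases "\<exists>y z. y \<in> monomials - {0} \<and> z \<in> monomials - {0} \<and> w = ?g (y, z)")
    case True
    then obtain y z where w: "y \<in> monomials - {0}" "z \<in> monomials - {0}" "w = ?g (y, z)" by blast
    then have "cls y \<in> pi0 (Lvl B_T_Ass 1)" "cls z \<in> pi0 (Lvl B_T_Ass 1)"
      unfolding bar_Sr_simps pi0_L1 by blast+
    then have "?C w = Poly_Mapping.lookup (word_comult m) (y, z)"
      using w coeff_cls[OF ws(3,4), folded ws(1)] ws(2) by (simp add: basis_map_def)
    then show ?thesis using lookup_g[of "(y, z)"] w(3) by simp
  next
    \<comment> \<open>Away from pairs of nonconstant monomials both sides vanish: the left by
      \<open>pi0_L1\<close>, the right by \<open>word_comult_nonzero_keys\<close>.\<close>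
    case nex: False
    have "?C w = 0"
    proof (rule ccontr)
      assume "?C w \<noteq> 0"
      then obtain a b where "w = (Some a, Some b)" "a \<in> pi0 (Lvl B_T_Ass 1)" "b \<in> pi0 (Lvl B_T_Ass 1)"
        by (auto split: prod.splits option.splits if_splits)
      then obtain y z where yz: "y \<in> monomials - {0}" "z \<in> monomials - {0}" "w = (Some (cls y), Some (cls z))"
        unfolding bar_Sr_simps pi0_L1 by blast
      then have "w = ?g (y, z)" by (simp add: basis_map_def)
      with nex yz show False by blast
    qed
    moreover have "Poly_Mapping.lookup ?R w = 0"
    proof (rule ccontr)
      assume "Poly_Mapping.lookup ?R w \<noteq> 0"
      then obtain y z where "(y, z) \<in> Poly_Mapping.keys (word_comult m)" "w = ?g (y, z)"
        using keys_R by (metis (no_types, lifting) imageE prod.collapse)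
      with word_comult_nonzero_keys[OF \<open>m \<noteq> 0\<close>] nex show False by blast
    qed
    ultimately show ?thesis by simp
  qed
  then have "?C = Poly_Mapping.lookup ?R" by blast
  then have "Abs_poly_mapping ?C = ?R" by (simp only: lookup_inverse)
  then show ?thesis
    using False by (simp add: incidence_bialgebra_def basis_map_def[of m] split_def)
qed

theorem theorem5p13:
  shows "incidence_finite (bar_Sr (T_Mr Ass)) \<and>
         isomorphic_bialgebras plethystic_bialgebra (incidence_bialgebra (bar_Sr (T_Mr Ass)) (@))"
proof (intro conjI incidence_finite_T bialgebra_transport[where h = basis_map, OF bialgebra_plethystic])
  let ?B = "incidence_bialgebra B_T_Ass (@)"
  have "0 \<in> monomials" by (simp add: monomials_def)
  then have "basis_map ` monomials = insert None (Some ` cls ` (monomials - {0}))"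
    by (auto simp: basis_map_def image_iff)
  then show "bij_betw basis_map (basis plethystic_bialgebra) (basis ?B)"
    using inj_basis_map
    by (auto simp: bij_betw_def incidence_bialgebra_def bar_Sr_simps pi0_L1 inj_on_def inj_def simp del: One_nat_def)
  show "unit_elt ?B = lin (\<lambda>z. basis_elt (basis_map z)) (unit_elt plethystic_bialgebra)"
    by (simp add: incidence_bialgebra_def basis_map_def flip: single_one)
  fix m assume m: "m \<in> basis plethystic_bialgebra"
  then show "comult ?B (basis_map m) =
      lin (\<lambda>(y, z). basis_elt (basis_map y, basis_map z)) (comult plethystic_bialgebra m)"
    by (simp add: comult_basis_map)
  show "counit ?B (basis_map m) = counit plethystic_bialgebra m"
  proof (cases "m = 0")
    case True
    then show ?thesis by (simp add: incidence_bialgebra_def basis_map_def eval_mon_eq)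
  next
    case False
    then obtain ws where "rep (cls m) = map tree1 ws" "mon ws = m" "ws \<noteq> []" "set ws \<subseteq> Words"
      using rep_cls m by (metis plethystic_bialgebra_simps(1))
    then show ?thesis
      using False incidence_counit_T(2)[of ws] by (simp add: incidence_bialgebra_def basis_map_def)
  qed
  fix n assume "n \<in> basis plethystic_bialgebra"
  with m show "bialg.mult ?B (basis_map m) (basis_map n) =
      lin (\<lambda>z. basis_elt (basis_map z)) (bialg.mult plethystic_bialgebra m n)"
    by (simp add: mult_basis_map)
qed

end
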